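(* Let $K\geq 1$ be an integer and let $s>0$. Then the supremum $$\sup\left\{\sum_{k=1}^{K}\int_\Omega|f_k(x)|^2\,dx\;:\;\Omega\subset\mathbb{R}\text{ measurable},\ |\Omega|=s,\ f_1,\ldots,f_K\in PW\text{ an orthonormal system}\right\}$$ is attained.
   Context: The Paley--Wiener space is $PW=\{f\in L^2(\mathbb{R}):\operatorname{supp}\widehat f\subseteq[-\pi,\pi]\}$, a closed subspace of $L^2(\mathbb{R})$ with the inherited inner product, where $\widehat f(\xi)=\frac{1}{\sqrt{2\pi}}\int_{\mathbb{R}}f(t)e^{-i\xi t}\,dt$. $|\Omega|$ denotes Lebesgue measure on $\mathbb{R}$. *)

theory Defs
  imports "HOL-Analysis.Analysis"
begin

text \<open>
  Elements of \<open>L\<^sup>2(\<real>)\<close> are represented by complex-valued functions; two functions that agree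
  almost everywhere represent the same element.  All notions below are invariant under such changes.
\<close>

definition L2 :: "(real \<Rightarrow> complex) set" where
  "L2 = {f \<in> borel_measurable lebesgue. integrable lebesgue (\<lambda>x. (cmod (f x))\<^sup>2)}"

definition L2_inner :: "(real \<Rightarrow> complex) \<Rightarrow> (real \<Rightarrow> complex) \<Rightarrow> complex" where
  "L2_inner f g = (LINT x|lebesgue. f x * cnj (g x))"

definition L2_tendsto :: "(nat \<Rightarrow> real \<Rightarrow> complex) \<Rightarrow> (real \<Rightarrow> complex) \<Rightarrow> bool" where
  "L2_tendsto F f \<longleftrightarrow>
     (\<lambda>n. \<integral>\<^sup>+ x. ennreal ((cmod (F n x - f x))\<^sup>2) \<partial>lebesgue) \<longlonglongrightarrow> 0"

definition fourier :: "(real \<Rightarrow> complex) \<Rightarrow> real \<Rightarrow> complex" where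
  "fourier f \<xi> =
     complex_of_real (1 / sqrt (2 * pi)) *
       (LINT t|lebesgue. f t * exp (- (\<i> * complex_of_real \<xi> * complex_of_real t)))"

text \<open>
  The integral above is meaningful for integrable \<open>f\<close> only.  On \<open>L\<^sup>2(\<real>)\<close> the Fourier transform is
  its continuous extension from \<open>L\<^sup>1(\<real>) \<inter> L\<^sup>2(\<real>)\<close>: \<open>g\<close> (determined up to a null set, by
  Plancherel's theorem) is the transform of \<open>f\<close> if some sequence in \<open>L\<^sup>1(\<real>) \<inter> L\<^sup>2(\<real>)\<close> converges
  to \<open>f\<close> in \<open>L\<^sup>2\<close> while the transforms converge to \<open>g\<close> in \<open>L\<^sup>2\<close>.
\<close>

definition has_L2_fourier :: "(real \<Rightarrow> complex) \<Rightarrow> (real \<Rightarrow> complex) \<Rightarrow> bool" where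
  "has_L2_fourier f g \<longleftrightarrow>
     f \<in> L2 \<and> g \<in> L2 \<and>
     (\<exists>F. (\<forall>n. F n \<in> L2 \<and> integrable lebesgue (F n)) \<and>
          L2_tendsto F f \<and> L2_tendsto (\<lambda>n. fourier (F n)) g)"

text \<open>
  The support of an \<open>L\<^sup>2\<close> function is its essential support, so it lies in the closed set
  \<open>[-\<pi>, \<pi>]\<close> iff the function vanishes almost everywhere outside that set.
\<close>

definition PW :: "(real \<Rightarrow> complex) set" where
  "PW = {f \<in> L2. \<exists>g. has_L2_fourier f g \<and> (AE \<xi> in lebesgue. \<xi> \<notin> {-pi..pi} \<longrightarrow> g \<xi> = 0)}"

definition PW_orthonormal :: "nat \<Rightarrow> (nat \<Rightarrow> real \<Rightarrow> complex) \<Rightarrow> bool" where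
  "PW_orthonormal K f \<longleftrightarrow>
     (\<forall>k\<in>{1..K}. f k \<in> PW) \<and>
     (\<forall>j\<in>{1..K}. \<forall>k\<in>{1..K}. L2_inner (f j) (f k) = (if j = k then 1 else 0))"

definition concentration_values :: "nat \<Rightarrow> real \<Rightarrow> real set" where
  "concentration_values K s =
     {\<Sum>k=1..K. (LINT x:\<Omega>|lebesgue. (cmod (f k x))\<^sup>2) | \<Omega> f.
        \<Omega> \<in> sets lebesgue \<and> emeasure lebesgue \<Omega> = ennreal s \<and> PW_orthonormal K f}"

end

theory Submission
  imports Defs "HOL-Probability.Characteristic_Functions" "HOL-Probability.Sinc_Integral"
    "HOL-Complex_Analysis.Great_Picard"
begin

text \<open>
  Write \<open>P\<close> for the projection onto the Paley--Wiener space. For fixed \<open>\<Omega>\<close> the value is the sum of the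
  \<open>K\<close> largest eigenvalues of \<open>P 1\<^sub>\<Omega> P\<close>, equivalently of \<open>1\<^sub>\<Omega> P 1\<^sub>\<Omega>\<close>, so one may instead maximise
  \<open>\<Sum> \<parallel>P \<phi>\<^sub>i\<parallel>\<^sup>2\<close> over orthonormal systems \<open>\<phi>\<^sub>1, \<dots>, \<phi>\<^sub>K\<close> in \<open>L\<^sup>2(\<Omega>)\<close>. In this dual form pieces of \<open>\<Omega>\<close> can
  be translated independently without losing orthonormality. Across a gap of length \<open>D\<close> the interaction
  is \<open>O(1/D)\<close>, and after closing the gap it can be given a favourable sign by flipping the sign of all
  \<open>\<phi>\<^sub>i\<close> on one side, so closing a gap costs at most \<open>O(1/D)\<close>.

  Every system of not too small value has, for the best \<open>\<Omega>\<close> (a superlevel set of \<open>\<Sum> |f\<^sub>k|\<^sup>2\<close>), its mass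
  in a bounded number \<open>N\<close> of unit cells. Hence the supremum is a function of the \<open>N - 1\<close> gaps between
  consecutive cells. A gap sequence that beats every sequence with a vanishing gap has all its gaps
  bounded, so the maximum over gap sequences exists and \<open>\<Omega>\<close> may be confined to a bounded window. There Montel's theorem and the bathtub
  principle yield a maximiser, the limit of the \<open>f\<^sub>k\<close> being merely a contractive system, which the duality
  turns back into an orthonormal one.
\<close>

section \<open>Orthogonal systems in \<open>L\<^sup>2\<close>\<close>

text \<open>The obstacle is a maximising sequence whose mass splits into pieces that drift apart: a
  limit of the \<open>f k\<close> sees only one piece, and pushing the pieces of
  \<open>\<Omega>\<close> together destroys orthonormality in \<open>PW\<close>. The cost
  \<open>O(1/D)\<close> comes from the sinc kernel, which is at most
  \<open>1 / \<bar>u\<bar>\<close>, together with Cauchy--Schwarz on a set of measure at most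
  \<open>s\<close>, which bounds both \<open>L^1\<close> norms by \<open>sqrt s\<close>. One sign
  has to serve all \<open>\<phi> i\<close>, because separate signs would change their inner
  products; it is chosen to favour the sum of the interaction terms. The number \<open>N\<close> is
  uniform by compactness. Once the density of the system reaches a fixed height somewhere, its
  superlevel set at some fixed level \<open>c > 0\<close> has measure above \<open>s\<close>, so the
  best \<open>\<Omega>\<close> lies where the density is at least \<open>c\<close>. The density is
  Lipschitz with total mass \<open>K\<close>, hence only boundedly many unit cells meet that set.
  The fixed height is forced by considering only values above half of the supremum.\<close>

definition L2_sq :: "(real \<Rightarrow> complex) \<Rightarrow> real" where
  "L2_sq f = (LINT x|lebesgue. (cmod (f x))\<^sup>2)"

lemma L2_measurable: "f \<in> L2 \<Longrightarrow> f \<in> borel_measurable lebesgue"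
  and L2_sq_integrable: "f \<in> L2 \<Longrightarrow> integrable lebesgue (\<lambda>x. (cmod (f x))\<^sup>2)"
  by (auto simp: L2_def)

lemma L2I:
  assumes "f \<in> borel_measurable lebesgue" "integrable lebesgue g"
    "\<And>x. (cmod (f x))\<^sup>2 \<le> g x"
  shows "f \<in> L2"
proof -
  have [measurable]: "f \<in> borel_measurable lebesgue" by fact
  have "(cmod (f x))\<^sup>2 \<le> norm (g x)" for x using assms(3)[of x] by simp
  then have "integrable lebesgue (\<lambda>x. (cmod (f x))\<^sup>2)"
    by (intro Bochner_Integration.integrable_bound[OF assms(2)]) auto
  then show ?thesis using assms(1) by (simp add: L2_def)
qed

lemma two_mult_le_squares: "2 * (a * b) \<le> a\<^sup>2 + b\<^sup>2" for a b :: real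
  using sum_squares_bound[of a b] by simp

lemma norm_add_power2_le: "(cmod (a + b))\<^sup>2 \<le> 2 * (cmod a)\<^sup>2 + 2 * (cmod b)\<^sup>2"
proof -
  have "(cmod (a + b))\<^sup>2 \<le> (cmod a + cmod b)\<^sup>2"
    by (intro power_mono norm_triangle_ineq) auto
  also have "\<dots> \<le> 2 * (cmod a)\<^sup>2 + 2 * (cmod b)\<^sup>2"
    using two_mult_le_squares[of "cmod a" "cmod b"] by (simp add: power2_sum)
  finally show ?thesis .
qed

lemma L2_mult_integrable:
  assumes "f \<in> L2" "g \<in> L2"
  shows "integrable lebesgue (\<lambda>x. f x * g x)"
proof -
  have [measurable]: "f \<in> borel_measurable lebesgue" "g \<in> borel_measurable lebesgue"
    using assms L2_measurable by auto
  show ?thesis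
  proof (rule Bochner_Integration.integrable_bound)
    show "integrable lebesgue (\<lambda>x. (cmod (f x))\<^sup>2 + (cmod (g x))\<^sup>2)"
      using assms by (intro Bochner_Integration.integrable_add L2_sq_integrable)
    show "AE x in lebesgue. norm (f x * g x) \<le> norm ((cmod (f x))\<^sup>2 + (cmod (g x))\<^sup>2)"
    proof (rule AE_I2)
      fix x
      have "cmod (f x) * cmod (g x) \<ge> 0" by simp
      then show "norm (f x * g x) \<le> norm ((cmod (f x))\<^sup>2 + (cmod (g x))\<^sup>2)"
        using two_mult_le_squares[of "cmod (f x)" "cmod (g x)"]
        unfolding norm_mult real_norm_def by linarith
    qed
  qed measurable
qed

lemma L2_cnj:
  assumes "f \<in> L2" shows "(\<lambda>x. cnj (f x)) \<in> L2"
proof (rule L2I)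
  have "cnj \<in> borel_measurable borel"
    by (intro borel_measurable_continuous_onI continuous_intros)
  then show "(\<lambda>x. cnj (f x)) \<in> borel_measurable lebesgue"
    using measurable_compose[OF L2_measurable[OF assms]] by blast
qed (use L2_sq_integrable[OF assms] in auto)

lemma L2_scale: "f \<in> L2 \<Longrightarrow> (\<lambda>x. c * f x) \<in> L2"
  by (auto simp: L2_def norm_mult power_mult_distrib)

lemma L2_zero: "(\<lambda>x. 0) \<in> L2"
  by (simp add: L2_def)

lemma L2_add:
  assumes "f \<in> L2" "g \<in> L2" shows "(\<lambda>x. f x + g x) \<in> L2"
proof (rule L2I)
  show "(\<lambda>x. f x + g x) \<in> borel_measurable lebesgue" using assms by (auto simp: L2_def)
  show "integrable lebesgue (\<lambda>x. 2 * (cmod (f x))\<^sup>2 + 2 * (cmod (g x))\<^sup>2)"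
    using assms by (auto simp: L2_def)
qed (rule norm_add_power2_le)

lemma L2_diff:
  assumes "f \<in> L2" "g \<in> L2" shows "(\<lambda>x. f x - g x) \<in> L2"
  using L2_add[OF assms(1) L2_scale[OF assms(2), of "-1"]] by simp

lemma L2_sum:
  "(\<And>i. i \<in> I \<Longrightarrow> f i \<in> L2) \<Longrightarrow> (\<lambda>x. \<Sum>i\<in>I. f i x) \<in> L2"
  by (induction I rule: infinite_finite_induct) (auto intro: L2_zero L2_add)

lemma L2_restrict:
  assumes "f \<in> L2" "A \<in> sets lebesgue" shows "(\<lambda>x. indicator A x * f x) \<in> L2"
proof (rule L2I)
  show "(\<lambda>x. indicator A x * f x) \<in> borel_measurable lebesgue"
    using assms L2_measurable by (intro borel_measurable_times) auto
  show "integrable lebesgue (\<lambda>x. (cmod (f x))\<^sup>2)" using assms L2_sq_integrable by auto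
  show "\<And>x. (cmod (indicator A x * f x))\<^sup>2 \<le> (cmod (f x))\<^sup>2" by (auto simp: indicator_def)
qed

lemma L2_inner_integrable: "f \<in> L2 \<Longrightarrow> g \<in> L2 \<Longrightarrow> integrable lebesgue (\<lambda>x. f x * cnj (g x))"
  by (intro L2_mult_integrable L2_cnj)

lemma L2_inner_add_left: "f \<in> L2 \<Longrightarrow> g \<in> L2 \<Longrightarrow> h \<in> L2 \<Longrightarrow>
    L2_inner (\<lambda>x. f x + g x) h = L2_inner f h + L2_inner g h"
  by (simp add: L2_inner_def distrib_right L2_inner_integrable)

lemma L2_inner_diff_left: "f \<in> L2 \<Longrightarrow> g \<in> L2 \<Longrightarrow> h \<in> L2 \<Longrightarrow>
    L2_inner (\<lambda>x. f x - g x) h = L2_inner f h - L2_inner g h"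
  by (simp add: L2_inner_def left_diff_distrib L2_inner_integrable)

lemma L2_inner_scale_left: "L2_inner (\<lambda>x. c * f x) h = c * L2_inner f h"
  by (simp add: L2_inner_def mult.assoc)

lemma L2_inner_cnj: "L2_inner g f = cnj (L2_inner f g)"
  unfolding L2_inner_def Bochner_Integration.integral_cnj[symmetric] by (simp add: mult.commute)

lemma L2_inner_norm_commute: "cmod (L2_inner g f) = cmod (L2_inner f g)"
  by (subst L2_inner_cnj) simp

lemma L2_inner_add_right: "f \<in> L2 \<Longrightarrow> g \<in> L2 \<Longrightarrow> h \<in> L2 \<Longrightarrow>
    L2_inner h (\<lambda>x. f x + g x) = L2_inner h f + L2_inner h g"
  by (simp add: L2_inner_cnj[of h] L2_inner_add_left)

lemma L2_inner_diff_right: "f \<in> L2 \<Longrightarrow> g \<in> L2 \<Longrightarrow> h \<in> L2 \<Longrightarrow>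
    L2_inner h (\<lambda>x. f x - g x) = L2_inner h f - L2_inner h g"
  by (simp add: L2_inner_cnj[of h] L2_inner_diff_left)

lemma L2_inner_scale_right: "L2_inner h (\<lambda>x. c * f x) = cnj c * L2_inner h f"
  by (simp add: L2_inner_cnj[of h] L2_inner_scale_left)

lemma L2_inner_zero_left: "L2_inner (\<lambda>x. 0) h = 0"
  by (simp add: L2_inner_def)

lemma L2_inner_sum_left: "(\<And>i. i \<in> I \<Longrightarrow> f i \<in> L2) \<Longrightarrow> h \<in> L2 \<Longrightarrow>
    L2_inner (\<lambda>x. \<Sum>i\<in>I. f i x) h = (\<Sum>i\<in>I. L2_inner (f i) h)"
  by (induction I rule: infinite_finite_induct)
    (auto simp: L2_inner_zero_left L2_inner_add_left L2_sum)

lemma L2_inner_self: "L2_inner f f = complex_of_real (L2_sq f)"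
  unfolding L2_inner_def L2_sq_def complex_norm_square[symmetric] by (rule integral_complex_of_real)

lemma L2_sq_nonneg: "L2_sq f \<ge> 0"
  by (simp add: L2_sq_def)

lemma L2_sq_add: "f \<in> L2 \<Longrightarrow> g \<in> L2 \<Longrightarrow>
    L2_sq (\<lambda>x. f x + g x) = L2_sq f + L2_sq g + 2 * Re (L2_inner f g)"
proof -
  assume fg: "f \<in> L2" "g \<in> L2"
  have "L2_inner (\<lambda>x. f x + g x) (\<lambda>x. f x + g x)
      = L2_inner f f + L2_inner g g + (L2_inner f g + cnj (L2_inner f g))"
    using fg by (simp add: L2_inner_add_left L2_inner_add_right L2_add L2_inner_cnj[of g f])
  then have "Re (complex_of_real (L2_sq (\<lambda>x. f x + g x))) = 
     Re (complex_of_real (L2_sq f) + complex_of_real (L2_sq g) + (L2_inner f g + cnj (L2_inner f g)))"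
    unfolding L2_inner_self by presburger
  then show ?thesis by simp
qed

lemma L2_sq_scale: "L2_sq (\<lambda>x. c * f x) = (cmod c)\<^sup>2 * L2_sq f"
  by (simp add: L2_sq_def norm_mult power_mult_distrib)

lemma L2_cauchy_schwarz:
  assumes "f \<in> L2" "g \<in> L2"
  shows "(cmod (L2_inner f g))\<^sup>2 \<le> L2_sq f * L2_sq g"
proof -
  define z where "z = L2_inner f g"
  \<comment> \<open>The squared norm of \<open>f - t z g\<close>. The factor \<open>z\<close> aligns
    the phase, so a real parameter \<open>t\<close> suffices; the best choice is
    \<open>t = 1 / L2_sq g\<close>.\<close>
  have *: "0 \<le> L2_sq f + t\<^sup>2 * (cmod z)\<^sup>2 * L2_sq g - 2 * t * (cmod z)\<^sup>2" for t :: real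
  proof -
    let ?c = "complex_of_real (- t) * z"
    have "0 \<le> L2_sq (\<lambda>x. f x + ?c * g x)" by (rule L2_sq_nonneg)
    also have "\<dots> = L2_sq f + L2_sq (\<lambda>x. ?c * g x) + 2 * Re (L2_inner f (\<lambda>x. ?c * g x))"
      using assms by (intro L2_sq_add L2_scale)
    also have "L2_sq (\<lambda>x. ?c * g x) = t\<^sup>2 * (cmod z)\<^sup>2 * L2_sq g"
      by (simp only: L2_sq_scale) (simp add: norm_mult power_mult_distrib)
    also have "L2_inner f (\<lambda>x. ?c * g x) = cnj ?c * z"
      unfolding L2_inner_scale_right by (simp add: z_def)
    also have "cnj ?c * z = complex_of_real (- t * (cmod z)\<^sup>2)"
      by (simp add: complex_norm_square mult.commute del: of_real_power)
    finally show ?thesis by (simp add: algebra_simps)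
  qed
  show ?thesis
  proof (cases "L2_sq g = 0")
    case True
    \<comment> \<open>For \<open>L2_sq g = 0\<close> the bound is affine in \<open>t\<close>, and a
      large \<open>t\<close> makes it negative unless \<open>z = 0\<close>.\<close>
    have "(cmod z)\<^sup>2 \<le> 0"
    proof (rule ccontr)
      assume "\<not> (cmod z)\<^sup>2 \<le> 0"
      then have p: "(cmod z)\<^sup>2 > 0" by simp
      have "0 \<le> L2_sq f - 2 * ((L2_sq f + 1) / (cmod z)\<^sup>2) * (cmod z)\<^sup>2"
        using *[of "(L2_sq f + 1) / (cmod z)\<^sup>2"] True by simp
      with p have "0 \<le> L2_sq f - 2 * (L2_sq f + 1)" by simp
      then show False using L2_sq_nonneg[of f] by simp
    qed
    then show ?thesis using True z_def by simp
  next
    case False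
    then have g: "L2_sq g > 0" using L2_sq_nonneg[of g] by simp
    have "0 \<le> L2_sq f + (1 / L2_sq g)\<^sup>2 * (cmod z)\<^sup>2 * L2_sq g - 2 * (1 / L2_sq g) * (cmod z)\<^sup>2"
      by (rule *)
    also have "\<dots> = L2_sq f - (cmod z)\<^sup>2 / L2_sq g"
      using g by (simp add: field_simps power2_eq_square)
    finally show ?thesis using g by (simp add: z_def field_simps)
  qed
qed

text \<open>Cauchy--Schwarz against the indicator of \<open>A\<close>.\<close>

lemma L2_support_integral_le:
  assumes f: "f \<in> L2" and A: "A \<in> sets lebesgue" "emeasure lebesgue A < \<infinity>" "\<And>x. x \<notin> A \<Longrightarrow> f x = 0"
  shows "(LINT x|lebesgue. cmod (f x)) \<le> sqrt (L2_sq f * measure lebesgue A)"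
proof -
  let ?a = "\<lambda>x. complex_of_real (cmod (f x))"
  let ?i = "\<lambda>x. indicator A x :: complex"
  have a2: "?a \<in> L2" using f L2_measurable[OF f] by (auto simp: L2_def)
  have i2: "?i \<in> L2"
  proof (rule L2I)
    show "?i \<in> borel_measurable lebesgue" using A(1) by (intro borel_measurable_indicator)
    show "integrable lebesgue (indicat_real A)" using A(1,2) by (intro integrable_real_indicator)
  qed (auto simp: indicator_def)
  have "L2_inner ?a ?i = (LINT x|lebesgue. complex_of_real (cmod (f x)))"
    unfolding L2_inner_def using A(3) by (intro Bochner_Integration.integral_cong) (auto simp: indicator_def)
  then have 1: "L2_inner ?a ?i = complex_of_real (LINT x|lebesgue. cmod (f x))" by simp
  have "L2_sq ?i = (LINT x|lebesgue. indicat_real A x)"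
    unfolding L2_sq_def by (intro Bochner_Integration.integral_cong) (auto simp: indicator_def)
  then have 2: "L2_sq ?i = measure lebesgue A" by simp
  have 3: "L2_sq ?a = L2_sq f" by (simp add: L2_sq_def)
  have "(LINT x|lebesgue. cmod (f x))\<^sup>2 \<le> L2_sq f * measure lebesgue A"
    using L2_cauchy_schwarz[OF a2 i2] unfolding 1 2 3 by simp
  then show ?thesis by (rule real_le_rsqrt)
qed

text \<open>Zero vectors are admitted, so that normalising a vanishing residual (where \<open>1 / 0 = 0\<close>)
  needs no case distinction in the Gram--Schmidt process.\<close>

definition L2_ortho :: "nat set \<Rightarrow> (nat \<Rightarrow> real \<Rightarrow> complex) \<Rightarrow> bool" where
  "L2_ortho I \<phi> \<longleftrightarrow> (\<forall>i\<in>I. \<phi> i \<in> L2 \<and> L2_sq (\<phi> i) \<in> {0, 1}) \<and>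
     (\<forall>i\<in>I. \<forall>j\<in>I. i \<noteq> j \<longrightarrow> L2_inner (\<phi> i) (\<phi> j) = 0)"

definition L2_residual :: "nat set \<Rightarrow> (nat \<Rightarrow> real \<Rightarrow> complex) \<Rightarrow> (real \<Rightarrow> complex) \<Rightarrow> real \<Rightarrow> complex" where
  "L2_residual I \<phi> u = (\<lambda>x. u x - (\<Sum>i\<in>I. L2_inner u (\<phi> i) * \<phi> i x))"

lemma L2_residual_in_L2: "L2_ortho I \<phi> \<Longrightarrow> u \<in> L2 \<Longrightarrow> L2_residual I \<phi> u \<in> L2"
  unfolding L2_residual_def by (intro L2_diff L2_sum L2_scale) (auto simp: L2_ortho_def)

lemma L2_residual_ortho:
  assumes o: "L2_ortho I \<phi>" and u: "u \<in> L2" and I: "finite I" "j \<in> I"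
  shows "L2_inner (L2_residual I \<phi> u) (\<phi> j) = 0"
proof -
  have L: "\<And>i. i \<in> I \<Longrightarrow> \<phi> i \<in> L2" using o by (auto simp: L2_ortho_def)
  have "L2_inner (L2_residual I \<phi> u) (\<phi> j)
      = L2_inner u (\<phi> j) - (\<Sum>i\<in>I. L2_inner u (\<phi> i) * L2_inner (\<phi> i) (\<phi> j))"
    unfolding L2_residual_def using L u I
    by (simp add: L2_inner_diff_left L2_inner_sum_left L2_sum L2_scale L2_inner_scale_left)
  also have "(\<Sum>i\<in>I. L2_inner u (\<phi> i) * L2_inner (\<phi> i) (\<phi> j))
      = (\<Sum>i\<in>I. if i = j then L2_inner u (\<phi> j) * L2_sq (\<phi> j) else 0)"
    using o I by (intro sum.cong) (auto simp: L2_ortho_def L2_inner_self)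
  also have "\<dots> = L2_inner u (\<phi> j) * L2_sq (\<phi> j)" using I by simp
  \<comment> \<open>Against a zero vector both sides vanish by Cauchy--Schwarz, so the missing
    normalisation does no harm.\<close>
  also have "\<dots> = L2_inner u (\<phi> j)"
  proof (cases "L2_sq (\<phi> j) = 0")
    case True
    then have "L2_inner u (\<phi> j) = 0" using L2_cauchy_schwarz[OF u L[OF I(2)]] by simp
    then show ?thesis by simp
  next
    case False
    then show ?thesis using o I by (auto simp: L2_ortho_def)
  qed
  finally show ?thesis by simp
qed

text \<open>The residual is orthogonal to the sum that was subtracted, so pairing it with
  \<open>u\<close> or with itself gives the same number; the first claim is then Pythagoras.\<close>

lemma L2_sq_residual:
  assumes o: "L2_ortho I \<phi>" and u: "u \<in> L2" and I: "finite I"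
  shows "L2_sq (L2_residual I \<phi> u) = L2_sq u - (\<Sum>i\<in>I. (cmod (L2_inner u (\<phi> i)))\<^sup>2)"
    and "L2_inner (L2_residual I \<phi> u) u = L2_sq (L2_residual I \<phi> u)"
proof -
  let ?r = "L2_residual I \<phi> u"
  have L: "\<And>i. i \<in> I \<Longrightarrow> \<phi> i \<in> L2" using o by (auto simp: L2_ortho_def)
  have r: "?r \<in> L2" by (rule L2_residual_in_L2[OF o u])
  have "L2_inner ?r (\<lambda>x. \<Sum>i\<in>I. L2_inner u (\<phi> i) * \<phi> i x)
      = cnj (\<Sum>i\<in>I. L2_inner u (\<phi> i) * L2_inner (\<phi> i) ?r)"
    using L r by (subst L2_inner_cnj) (simp add: L2_inner_sum_left L2_scale L2_inner_scale_left)
  also have "\<dots> = 0"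
    using L2_residual_ortho[OF o u I] by (simp add: L2_inner_cnj[of "\<phi> _" ?r])
  finally have z: "L2_inner ?r (\<lambda>x. \<Sum>i\<in>I. L2_inner u (\<phi> i) * \<phi> i x) = 0" .
  have "L2_inner ?r ?r = L2_inner ?r u - L2_inner ?r (\<lambda>x. \<Sum>i\<in>I. L2_inner u (\<phi> i) * \<phi> i x)"
    using L u r by (subst (2) L2_residual_def) (intro L2_inner_diff_right L2_sum L2_scale)
  then show 1: "L2_inner ?r u = L2_sq ?r" using z by (simp add: L2_inner_self)
  have "L2_inner ?r u = L2_inner u u - (\<Sum>i\<in>I. L2_inner u (\<phi> i) * L2_inner (\<phi> i) u)"
    unfolding L2_residual_def using L u
    by (simp add: L2_inner_diff_left L2_inner_sum_left L2_sum L2_scale L2_inner_scale_left)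
  also have "\<dots> = complex_of_real (L2_sq u - (\<Sum>i\<in>I. (cmod (L2_inner u (\<phi> i)))\<^sup>2))"
    by (simp add: L2_inner_self L2_inner_cnj[of "\<phi> _" u] complex_norm_square del: of_real_power)
  finally show "L2_sq ?r = L2_sq u - (\<Sum>i\<in>I. (cmod (L2_inner u (\<phi> i)))\<^sup>2)"
    using 1 by (metis of_real_eq_iff)
qed

lemma L2_bessel:
  assumes "L2_ortho I \<phi>" "u \<in> L2" "finite I"
  shows "(\<Sum>i\<in>I. (cmod (L2_inner u (\<phi> i)))\<^sup>2) \<le> L2_sq u"
  using L2_sq_residual(1)[OF assms] L2_sq_nonneg[of "L2_residual I \<phi> u"] by linarith

section \<open>Gram--Schmidt inside a subspace\<close>

definition L2_subspace :: "(real \<Rightarrow> complex) set \<Rightarrow> bool" where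
  "L2_subspace W \<longleftrightarrow> W \<subseteq> L2 \<and> (\<lambda>x. 0) \<in> W \<and> (\<forall>f\<in>W. \<forall>g\<in>W. (\<lambda>x. f x + g x) \<in> W) \<and>
     (\<forall>c. \<forall>f\<in>W. (\<lambda>x. c * f x) \<in> W)"

lemma L2_subspace_add: "L2_subspace W \<Longrightarrow> f \<in> W \<Longrightarrow> g \<in> W \<Longrightarrow> (\<lambda>x. f x + g x) \<in> W"
  and L2_subspace_scale: "L2_subspace W \<Longrightarrow> f \<in> W \<Longrightarrow> (\<lambda>x. c * f x) \<in> W"
  and L2_subspace_zero: "L2_subspace W \<Longrightarrow> (\<lambda>x. 0) \<in> W"
  by (simp_all add: L2_subspace_def)

lemma L2_subspace_sum:
  assumes "L2_subspace W"
  shows "(\<And>i. i \<in> I \<Longrightarrow> f i \<in> W) \<Longrightarrow> (\<lambda>x. \<Sum>i\<in>I. f i x) \<in> W"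
  by (induction I rule: infinite_finite_induct)
    (simp_all add: L2_subspace_zero[OF assms] L2_subspace_add[OF assms])

lemma L2_subspace_residual:
  assumes W: "L2_subspace W" and "\<And>i. i \<in> I \<Longrightarrow> \<phi> i \<in> W" "u \<in> W"
  shows "L2_residual I \<phi> u \<in> W"
proof -
  have "(\<lambda>x. u x + (- 1) * (\<Sum>i\<in>I. L2_inner u (\<phi> i) * \<phi> i x)) \<in> W"
    using assms by (intro L2_subspace_add[OF W] L2_subspace_scale[OF W] L2_subspace_sum[OF W])
  then show ?thesis by (simp add: L2_residual_def)
qed

text \<open>By the second claim the new vector captures exactly the part of \<open>u\<close> that
  Bessel's inequality for \<open>I\<close> leaves over, also when the residual vanishes.\<close>

lemma L2_ortho_insert_residual:
  assumes o: "L2_ortho I \<phi>" and u: "u \<in> L2" and I: "finite I" and n: "n \<notin> I"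
  defines "r \<equiv> L2_residual I \<phi> u"
  defines "\<psi> \<equiv> \<phi>(n := (\<lambda>x. complex_of_real (1 / sqrt (L2_sq r)) * r x))"
  shows "L2_ortho (insert n I) \<psi>"
    and "(cmod (L2_inner u (\<psi> n)))\<^sup>2 = L2_sq r"
    and "L2_sq r \<noteq> 0 \<Longrightarrow> L2_sq (\<psi> n) = 1"
proof -
  define c where "c = 1 / sqrt (L2_sq r)"
  have \<psi>n: "\<psi> n = (\<lambda>x. complex_of_real c * r x)" by (simp only: \<psi>_def c_def fun_upd_same)
  have \<psi>o: "\<psi> j = \<phi> j" if "j \<in> I" for j using that n by (auto simp: \<psi>_def)
  have c2: "c\<^sup>2 * L2_sq r = (if L2_sq r = 0 then 0 else 1)" "c\<^sup>2 * (L2_sq r)\<^sup>2 = L2_sq r"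
    using L2_sq_nonneg[of r] by (simp_all add: c_def power_divide power2_eq_square)
  have rL: "r \<in> L2" unfolding r_def by (rule L2_residual_in_L2[OF o u])
  have sq: "L2_sq (\<psi> n) = (if L2_sq r = 0 then 0 else 1)"
    using c2(1) by (simp add: \<psi>n L2_sq_scale)
  then show "L2_sq r \<noteq> 0 \<Longrightarrow> L2_sq (\<psi> n) = 1" by simp
  have rz: "L2_inner r (\<phi> j) = 0" if "j \<in> I" for j
    unfolding r_def by (rule L2_residual_ortho[OF o u I that])
  have n1: "L2_inner (\<psi> n) (\<psi> j) = 0" "L2_inner (\<psi> j) (\<psi> n) = 0" if "j \<in> I" for j
    using rz[OF that] L2_inner_cnj[of "\<phi> j" r] \<psi>o[OF that]
    by (simp_all add: \<psi>n L2_inner_scale_left L2_inner_scale_right)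
  have \<psi>L: "\<psi> n \<in> L2" unfolding \<psi>n by (rule L2_scale[OF rL])
  have "\<psi> i \<in> L2 \<and> L2_sq (\<psi> i) \<in> {0, 1}" if "i \<in> insert n I" for i
    using that o \<psi>o \<psi>L sq by (cases "i = n") (simp_all add: L2_ortho_def)
  moreover have "L2_inner (\<psi> i) (\<psi> j) = 0" if "i \<in> insert n I" "j \<in> insert n I" "i \<noteq> j" for i j
    using that o n1 \<psi>o by (cases "i = n"; cases "j = n") (simp_all add: L2_ortho_def)
  ultimately show "L2_ortho (insert n I) \<psi>" by (simp add: L2_ortho_def)
  have "L2_inner u (\<psi> n) = complex_of_real c * cnj (L2_inner r u)"
    by (simp add: \<psi>n L2_inner_scale_right L2_inner_cnj[of u r])
  also have "L2_inner r u = L2_sq r" unfolding r_def by (rule L2_sq_residual(2)[OF o u I])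
  finally show "(cmod (L2_inner u (\<psi> n)))\<^sup>2 = L2_sq r"
    using c2(2) by (simp add: norm_mult power_mult_distrib)
qed

text \<open>That \<open>u k\<close> lies in the span of the \<open>\<phi> i\<close> is expressed by
  equality in Bessel's inequality, the form in which the duality uses it. The subspace is kept
  abstract because the process runs both in \<open>PW\<close> and in the functions supported on a
  given set.\<close>

lemma L2_gram_schmidt:
  assumes W: "L2_subspace W"
  shows "(\<And>k. k \<in> {1..n} \<Longrightarrow> u k \<in> W) \<Longrightarrow>
    \<exists>\<phi>. L2_ortho {1..n} \<phi> \<and> (\<forall>k\<in>{1..n}. \<phi> k \<in> W) \<and>
      (\<forall>k\<in>{1..n}. L2_sq (u k) = (\<Sum>i\<in>{1..n}. (cmod (L2_inner (u k) (\<phi> i)))\<^sup>2))"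
proof (induction n)
  case 0
  then show ?case by (auto simp: L2_ortho_def)
next
  case (Suc n)
  then obtain \<phi> where o: "L2_ortho {1..n} \<phi>" and \<phi>W: "\<forall>k\<in>{1..n}. \<phi> k \<in> W"
    and p: "\<forall>k\<in>{1..n}. L2_sq (u k) = (\<Sum>i\<in>{1..n}. (cmod (L2_inner (u k) (\<phi> i)))\<^sup>2)"
    by fastforce
  define r where "r = L2_residual {1..n} \<phi> (u (Suc n))"
  define \<psi> where "\<psi> = \<phi>(Suc n := (\<lambda>x. complex_of_real (1 / sqrt (L2_sq r)) * r x))"
  have WL: "W \<subseteq> L2" using W by (simp add: L2_subspace_def)
  have uL: "u k \<in> L2" if "k \<in> {1..Suc n}" for k using Suc.prems[OF that] WL by auto
  have rW: "r \<in> W"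
    unfolding r_def using \<phi>W Suc.prems by (intro L2_subspace_residual[OF W]) auto
  then have scW: "(\<lambda>x. complex_of_real (1 / sqrt (L2_sq r)) * r x) \<in> W"
    by (rule L2_subspace_scale[OF W])
  then have \<psi>W: "\<forall>k\<in>{1..Suc n}. \<psi> k \<in> W"
    using \<phi>W scW by (auto simp: atLeastAtMostSuc_conv \<psi>_def simp del: of_real_divide)
  have ins: "{1..Suc n} = insert (Suc n) {1..n}" by auto
  have *: "L2_ortho {1..Suc n} \<psi>" "(cmod (L2_inner (u (Suc n)) (\<psi> (Suc n))))\<^sup>2 = L2_sq r"
    using L2_ortho_insert_residual[OF o uL[of "Suc n"], of "Suc n"]
    unfolding ins \<psi>_def r_def by auto
  have old: "(\<Sum>i\<in>{1..n}. (cmod (L2_inner v (\<psi> i)))\<^sup>2) = (\<Sum>i\<in>{1..n}. (cmod (L2_inner v (\<phi> i)))\<^sup>2)" for v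
    by (intro sum.cong) (auto simp: \<psi>_def)
  have "L2_sq (u k) = (\<Sum>i\<in>{1..Suc n}. (cmod (L2_inner (u k) (\<psi> i)))\<^sup>2)" if k: "k \<in> {1..Suc n}" for k
  proof (cases "k = Suc n")
    case True
    have "L2_sq r = L2_sq (u (Suc n)) - (\<Sum>i\<in>{1..n}. (cmod (L2_inner (u (Suc n)) (\<phi> i)))\<^sup>2)"
      unfolding r_def using o uL by (intro L2_sq_residual) auto
    then show ?thesis using *(2) old[of "u k"] True by simp
  next
    case False
    with k have k': "k \<in> {1..n}" by auto
    \<comment> \<open>The first \<open>n\<close> terms already exhaust \<open>L2_sq (u k)\<close>,
      so Bessel's inequality for the enlarged system forces the new term to be zero.\<close>
    have "(\<Sum>i\<in>{1..Suc n}. (cmod (L2_inner (u k) (\<psi> i)))\<^sup>2) \<le> L2_sq (u k)"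
      using L2_bessel[OF *(1) uL[OF k]] by simp
    moreover have "L2_sq (u k) = (\<Sum>i\<in>{1..n}. (cmod (L2_inner (u k) (\<psi> i)))\<^sup>2)"
      using p k' old by simp
    ultimately show ?thesis by simp
  qed
  with *(1) \<psi>W show ?case by blast
qed

text \<open>Zero vectors are replaced one at a time, with induction on their number. Some
  \<open>e m\<close> has a nonzero residual against the other \<open>n - 1\<close> vectors:
  otherwise the double sum of squared inner products of these with \<open>n\<close> of the
  \<open>e m\<close> would be \<open>n\<close> in one order of summation and at most
  \<open>n - 1\<close> in the other.\<close>

lemma L2_ortho_extend:
  assumes W: "L2_subspace W" and o: "L2_ortho {1..n} \<phi>" and \<phi>: "\<forall>k\<in>{1..n}. \<phi> k \<in> W"
    and e: "\<And>m::nat. e m \<in> W" "\<And>m l. L2_inner (e m) (e l) = (if m = l then 1 else 0)"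
  shows "\<exists>\<psi>. L2_ortho {1..n} \<psi> \<and> (\<forall>k\<in>{1..n}. \<psi> k \<in> W \<and> L2_sq (\<psi> k) = 1 \<and>
      (L2_sq (\<phi> k) = 1 \<longrightarrow> \<psi> k = \<phi> k))"
  using o \<phi>
proof (induction "card {k\<in>{1..n}. L2_sq (\<phi> k) \<noteq> 1}" arbitrary: \<phi> rule: less_induct)
  case less
  note o = less.prems(1) and \<phi> = less.prems(2)
  have WL: "W \<subseteq> L2" using W by (simp add: L2_subspace_def)
  show ?case
  proof (cases "\<forall>k\<in>{1..n}. L2_sq (\<phi> k) = 1")
    case True
    then show ?thesis using o \<phi> by blast
  next
    case False
    then obtain k where k: "k \<in> {1..n}" "L2_sq (\<phi> k) \<noteq> 1" by blast
    define I where "I = {1..n} - {k}"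
    have I: "finite I" "k \<notin> I" "{1..n} = insert k I" using k by (auto simp: I_def)
    have oI: "L2_ortho I \<phi>" using o by (auto simp: L2_ortho_def I_def)
    have e1: "L2_sq (e m) = 1" for m
      using e(2)[of m m] by (simp add: L2_inner_self)
    have eL: "e m \<in> L2" for m using e(1) WL by blast
    have eo: "L2_ortho M e" for M
      by (simp add: L2_ortho_def e(2) e1 eL)
    have "\<exists>m. L2_sq (L2_residual I \<phi> (e m)) \<noteq> 0"
    proof (rule ccontr)
      assume "\<not> ?thesis"
      then have z: "L2_sq (L2_residual I \<phi> (e m)) = 0" for m by auto
      have "(\<Sum>i\<in>I. (cmod (L2_inner (e m) (\<phi> i)))\<^sup>2) = 1" for m
        using L2_sq_residual(1)[OF oI _ I(1), of "e m"] z[of m] e(1)[of m] e1[of m] WL by auto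
      then have "real n = (\<Sum>m\<in>{1..n}. \<Sum>i\<in>I. (cmod (L2_inner (e m) (\<phi> i)))\<^sup>2)" by simp
      also have "\<dots> = (\<Sum>i\<in>I. \<Sum>m\<in>{1..n}. (cmod (L2_inner (\<phi> i) (e m)))\<^sup>2)"
        by (subst sum.swap) (simp only: L2_inner_norm_commute)
      also have "\<dots> \<le> (\<Sum>i\<in>I. 1)"
      proof (rule sum_mono)
        fix i assume "i \<in> I"
        then have "\<phi> i \<in> L2" "L2_sq (\<phi> i) \<le> 1" using oI by (auto simp: L2_ortho_def)
        then show "(\<Sum>m\<in>{1..n}. (cmod (L2_inner (\<phi> i) (e m)))\<^sup>2) \<le> 1"
          using L2_bessel[OF eo, of "\<phi> i" "{1..n}"] by simp
      qed
      also have "\<dots> = real (card I)" by simp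
      also have "\<dots> < real n" using k by (simp add: I_def)
      finally show False by simp
    qed
    then obtain m where m: "L2_sq (L2_residual I \<phi> (e m)) \<noteq> 0" by blast
    define r where "r = L2_residual I \<phi> (e m)"
    define \<psi> where "\<psi> = \<phi>(k := (\<lambda>x. complex_of_real (1 / sqrt (L2_sq r)) * r x))"
    have em: "e m \<in> L2" using e(1) WL by auto
    note ins = L2_ortho_insert_residual[OF oI em I(1,2), folded r_def, folded \<psi>_def]
    have "r \<in> W"
      unfolding r_def using \<phi> e(1) by (intro L2_subspace_residual[OF W]) (auto simp: I_def)
    then have "(\<lambda>x. complex_of_real (1 / sqrt (L2_sq r)) * r x) \<in> W"
      by (rule L2_subspace_scale[OF W])
    then have \<psi>W: "\<forall>k\<in>{1..n}. \<psi> k \<in> W"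
      using \<phi> by (auto simp: \<psi>_def simp del: of_real_divide)
    have k1: "L2_sq (\<psi> k) = 1" using ins(3) m by (simp add: r_def)
    have "{k\<in>{1..n}. L2_sq (\<psi> k) \<noteq> 1} \<subset> {k\<in>{1..n}. L2_sq (\<phi> k) \<noteq> 1}"
      using k k1 by (auto simp: \<psi>_def)
    then have "card {k\<in>{1..n}. L2_sq (\<psi> k) \<noteq> 1} < card {k\<in>{1..n}. L2_sq (\<phi> k) \<noteq> 1}"
      by (intro psubset_card_mono) auto
    from less.hyps[OF this ins(1)[folded I(3)] \<psi>W] obtain \<theta> where
      \<theta>: "L2_ortho {1..n} \<theta>" "\<forall>k\<in>{1..n}. \<theta> k \<in> W \<and> L2_sq (\<theta> k) = 1 \<and> (L2_sq (\<psi> k) = 1 \<longrightarrow> \<theta> k = \<psi> k)"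
      by blast
    have "L2_sq (\<phi> j) = 1 \<longrightarrow> \<theta> j = \<phi> j" if "j \<in> {1..n}" for j
      using \<theta>(2) that k by (cases "j = k") (auto simp: \<psi>_def)
    then show ?thesis using \<theta> by blast
  qed
qed

section \<open>The Fourier transform of integrable functions\<close>

lemma sigma_finite_lebesgue: "sigma_finite_measure (lebesgue :: real measure)"
proof -
  obtain A :: "real set set" where A: "countable A" "A \<subseteq> sets lborel" "\<Union>A = space lborel"
    "\<forall>a\<in>A. emeasure lborel a \<noteq> \<infinity>"
    using lborel.sigma_finite_countable by auto
  show ?thesis
    by (rule sigma_finite_measure.intro, rule exI[of _ A])
      (use A in \<open>auto simp: subset_iff\<close>)
qed

lemma pair_sigma_finite_lebesgue: "pair_sigma_finite (lebesgue :: real measure) (lebesgue :: real measure)"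
  by (simp add: pair_sigma_finite_def sigma_finite_lebesgue)

text \<open>Fubini is applied on the product of two completed measures, whereas the kernels are only
  known to be jointly Borel.\<close>

lemma measurable_lebesgue_pair:
  assumes "k \<in> borel_measurable (borel \<Otimes>\<^sub>M borel)"
  shows "k \<in> borel_measurable (lebesgue \<Otimes>\<^sub>M (lebesgue :: real measure) :: (real \<times> real) measure)"
proof -
  have "(id :: real \<Rightarrow> real) \<in> lebesgue \<rightarrow>\<^sub>M borel"
    unfolding id_def by (intro measurable_completion) simp
  then have "(\<lambda>z. (id (fst z), id (snd z))) \<in> lebesgue \<Otimes>\<^sub>M (lebesgue :: real measure) \<rightarrow>\<^sub>M (borel :: real measure) \<Otimes>\<^sub>M borel"
    by (intro measurable_Pair measurable_compose[OF measurable_fst] measurable_compose[OF measurable_snd])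
  then have "(\<lambda>z. k (id (fst z), id (snd z))) \<in> borel_measurable (lebesgue \<Otimes>\<^sub>M (lebesgue :: real measure))"
    using assms by (rule measurable_compose)
  then show ?thesis by simp
qed

lemma continuous_lebesgue_measurable:
  fixes f :: "real \<Rightarrow> 'a::topological_space"
  assumes "continuous_on UNIV f" shows "f \<in> borel_measurable lebesgue"
  using borel_measurable_continuous_onI[OF assms] by (intro measurable_completion) simp

lemma continuous_lebesgue_pair_measurable:
  fixes k :: "real \<times> real \<Rightarrow> complex"
  assumes "continuous_on UNIV k"
  shows "k \<in> borel_measurable (lebesgue \<Otimes>\<^sub>M lebesgue)"
  using borel_measurable_continuous_onI[OF assms]
  by (intro measurable_lebesgue_pair) (simp add: borel_prod)

lemma pair_integrable_bounded:
  fixes F \<psi> :: "real \<Rightarrow> complex"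
  assumes F: "integrable lebesgue F" and \<psi>: "integrable lebesgue \<psi>"
    and k: "k \<in> borel_measurable (lebesgue \<Otimes>\<^sub>M lebesgue)" "\<And>x y. cmod (k (x, y)) \<le> B"
  shows "integrable (lebesgue \<Otimes>\<^sub>M lebesgue) (\<lambda>(x, y). F x * \<psi> y * k (x, y))"
proof -
  interpret L: pair_sigma_finite "lebesgue :: real measure" "lebesgue :: real measure"
    by (rule pair_sigma_finite_lebesgue)
  have [measurable]: "F \<in> borel_measurable lebesgue" "\<psi> \<in> borel_measurable lebesgue"
    using F \<psi> by auto
  note [measurable] = k(1)
  have 1: "integrable (lebesgue \<Otimes>\<^sub>M lebesgue) (\<lambda>z. F (fst z) * \<psi> (snd z))"
  proof (rule L.Fubini_integrable)
    show "(\<lambda>z. F (fst z) * \<psi> (snd z)) \<in> borel_measurable (lebesgue \<Otimes>\<^sub>M lebesgue)" by measurable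
    show "AE x in lebesgue. integrable lebesgue (\<lambda>y. F (fst (x, y)) * \<psi> (snd (x, y)))"
      using \<psi> by simp
    have "(\<lambda>x. LINT y|lebesgue. norm (F (fst (x, y)) * \<psi> (snd (x, y))))
        = (\<lambda>x. cmod (F x) * (LINT y|lebesgue. cmod (\<psi> y)))" by (simp add: norm_mult)
    then show "integrable lebesgue (\<lambda>x. LINT y|lebesgue. norm (F (fst (x, y)) * \<psi> (snd (x, y))))"
      using F by simp
  qed
  have "integrable (lebesgue \<Otimes>\<^sub>M lebesgue) (\<lambda>z. F (fst z) * \<psi> (snd z) * k z)"
  proof (rule Bochner_Integration.integrable_bound)
    show "integrable (lebesgue \<Otimes>\<^sub>M lebesgue) (\<lambda>z. B * norm (F (fst z) * \<psi> (snd z)))"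
      using 1 by (intro integrable_mult_right integrable_norm)
    show "AE z in lebesgue \<Otimes>\<^sub>M lebesgue. norm (F (fst z) * \<psi> (snd z) * k z)
        \<le> norm (B * norm (F (fst z) * \<psi> (snd z)))"
    proof (rule AE_I2)
      fix z :: "real \<times> real"
      have "cmod (k z) \<le> \<bar>B\<bar>" using k(2)[of "fst z" "snd z"] by simp
      then have "cmod (k z) * norm (F (fst z) * \<psi> (snd z)) \<le> \<bar>B\<bar> * norm (F (fst z) * \<psi> (snd z))"
        by (intro mult_right_mono) auto
      then show "norm (F (fst z) * \<psi> (snd z) * k z) \<le> norm (B * norm (F (fst z) * \<psi> (snd z)))"
        by (simp add: norm_mult abs_mult mult.commute)
    qed
  qed measurable
  then show ?thesis by (simp add: case_prod_unfold)
qed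

lemma lebesgue_Fubini_bounded:
  fixes F \<psi> :: "real \<Rightarrow> complex"
  assumes F: "integrable lebesgue F" and \<psi>: "integrable lebesgue \<psi>"
    and k: "k \<in> borel_measurable (lebesgue \<Otimes>\<^sub>M lebesgue)" "\<And>x y. cmod (k (x, y)) \<le> B"
  shows "(LINT y|lebesgue. LINT x|lebesgue. F x * \<psi> y * k (x, y))
    = (LINT x|lebesgue. LINT y|lebesgue. F x * \<psi> y * k (x, y))"
  using pair_integrable_bounded[OF assms] pair_sigma_finite.Fubini_integral[OF pair_sigma_finite_lebesgue]
  by blast

text \<open>With the symmetric normalisation of \<open>fourier\<close>, reflecting the argument
  gives the inverse transform.\<close>

definition ifourier :: "(real \<Rightarrow> complex) \<Rightarrow> real \<Rightarrow> complex" where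
  "ifourier f x = fourier f (- x)"

lemma fourier_kernel_norm: "cmod (exp (- (\<i> * complex_of_real \<xi> * complex_of_real t))) = 1"
  by (simp add: norm_exp_eq_Re)

lemma integrable_bounded_mult:
  fixes F k :: "real \<Rightarrow> complex"
  assumes "integrable lebesgue F" "k \<in> borel_measurable lebesgue" "\<And>t. cmod (k t) \<le> B"
  shows "integrable lebesgue (\<lambda>t. F t * k t)"
proof (rule Bochner_Integration.integrable_bound)
  show "integrable lebesgue (\<lambda>t. B * norm (F t))" using assms by auto
  show "(\<lambda>t. F t * k t) \<in> borel_measurable lebesgue" using assms by (intro borel_measurable_times) auto
  show "AE t in lebesgue. norm (F t * k t) \<le> norm (B * norm (F t))"
  proof (rule AE_I2)
    fix t
    have "cmod (k t) * cmod (F t) \<le> \<bar>B\<bar> * cmod (F t)"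
      using assms(3)[of t] by (intro mult_right_mono) auto
    then show "norm (F t * k t) \<le> norm (B * norm (F t))"
      by (simp add: norm_mult abs_mult mult.commute)
  qed
qed

lemma fourier_integrand_integrable:
  "integrable lebesgue F \<Longrightarrow> integrable lebesgue (\<lambda>t. F t * exp (- (\<i> * complex_of_real \<xi> * complex_of_real t)))"
  by (rule integrable_bounded_mult[where B=1])
    (auto simp: fourier_kernel_norm intro!: continuous_lebesgue_measurable continuous_intros)

text \<open>Fubini with a bounded kernel that is symmetric in the two variables. All later transfers
  between the two sides of the transform rest on this formula.\<close>

lemma fourier_multiplication:
  assumes F: "integrable lebesgue F" and \<psi>: "integrable lebesgue \<psi>"
  shows "(LINT \<xi>|lebesgue. fourier F \<xi> * \<psi> \<xi>) = (LINT t|lebesgue. F t * fourier \<psi> t)"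
proof -
  define k :: "real \<times> real \<Rightarrow> complex" where "k = (\<lambda>(t, \<xi>). exp (- (\<i> * complex_of_real \<xi> * complex_of_real t)))"
  let ?c = "complex_of_real (1 / sqrt (2 * pi))"
  have km: "k \<in> borel_measurable (lebesgue \<Otimes>\<^sub>M lebesgue)"
    unfolding k_def case_prod_unfold by (intro continuous_lebesgue_pair_measurable continuous_intros)
  have kb: "cmod (k (x, y)) \<le> 1" for x y by (simp add: k_def fourier_kernel_norm)
  have "(LINT \<xi>|lebesgue. fourier F \<xi> * \<psi> \<xi>)
      = (LINT \<xi>|lebesgue. LINT t|lebesgue. ?c * (F t * \<psi> \<xi> * k (t, \<xi>)))"
  proof (rule Bochner_Integration.integral_cong[OF refl])
    fix \<xi>
    have "fourier F \<xi> * \<psi> \<xi> = ?c * ((LINT t|lebesgue. F t * k (t, \<xi>)) * \<psi> \<xi>)"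
      by (simp add: fourier_def k_def)
    also have "(LINT t|lebesgue. F t * k (t, \<xi>)) * \<psi> \<xi> = (LINT t|lebesgue. F t * \<psi> \<xi> * k (t, \<xi>))"
      by (subst integral_mult_left_zero[symmetric]) (simp add: mult_ac)
    finally show "fourier F \<xi> * \<psi> \<xi> = (LINT t|lebesgue. ?c * (F t * \<psi> \<xi> * k (t, \<xi>)))"
      by simp
  qed
  also have "\<dots> = ?c * (LINT \<xi>|lebesgue. LINT t|lebesgue. F t * \<psi> \<xi> * k (t, \<xi>))" by simp
  also have "\<dots> = ?c * (LINT t|lebesgue. LINT \<xi>|lebesgue. F t * \<psi> \<xi> * k (t, \<xi>))"
    using lebesgue_Fubini_bounded[OF F \<psi> km kb] by simp
  also have "\<dots> = (LINT t|lebesgue. ?c * (LINT \<xi>|lebesgue. F t * \<psi> \<xi> * k (t, \<xi>)))" by simp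
  also have "\<dots> = (LINT t|lebesgue. F t * fourier \<psi> t)"
    by (intro Bochner_Integration.integral_cong refl)
       (simp add: fourier_def k_def mult_ac flip: integral_mult_right_zero)
  finally show ?thesis .
qed

lemma fourier_cnj: "cnj (fourier F \<xi>) = ifourier (\<lambda>t. cnj (F t)) \<xi>"
  by (simp add: ifourier_def fourier_def exp_cnj flip: Bochner_Integration.integral_cnj)

lemma ifourier_cnj: "cnj (ifourier F x) = fourier (\<lambda>t. cnj (F t)) x"
  by (simp add: fourier_cnj ifourier_def)

text \<open>The conjugated multiplication formula: on integrable functions \<open>ifourier\<close>
  is the adjoint of \<open>fourier\<close>.\<close>

lemma ifourier_inner:
  assumes "integrable lebesgue F" "integrable lebesgue g"
  shows "(LINT x|lebesgue. ifourier g x * cnj (F x)) = (LINT \<xi>|lebesgue. g \<xi> * cnj (fourier F \<xi>))"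
proof -
  have "cnj (LINT x|lebesgue. ifourier g x * cnj (F x))
      = (LINT x|lebesgue. fourier (\<lambda>t. cnj (g t)) x * F x)"
    by (simp add: ifourier_cnj flip: Bochner_Integration.integral_cnj)
  also have "\<dots> = (LINT t|lebesgue. cnj (g t) * fourier F t)"
    using assms by (intro fourier_multiplication) auto
  also have "\<dots> = cnj (LINT \<xi>|lebesgue. g \<xi> * cnj (fourier F \<xi>))"
    by (simp flip: Bochner_Integration.integral_cnj)
  finally show ?thesis by (metis complex_cnj_cnj)
qed

lemma fourier_norm_le:
  assumes "integrable lebesgue F"
  shows "cmod (fourier F \<xi>) \<le> (LINT t|lebesgue. cmod (F t)) / sqrt (2 * pi)"
proof -
  have "cmod (LINT t|lebesgue. F t * exp (- (\<i> * complex_of_real \<xi> * complex_of_real t)))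
      \<le> (LINT t|lebesgue. cmod (F t * exp (- (\<i> * complex_of_real \<xi> * complex_of_real t))))"
    by (rule integral_norm_bound)
  also have "\<dots> = (LINT t|lebesgue. cmod (F t))" by (simp add: norm_mult fourier_kernel_norm)
  finally show ?thesis by (simp add: fourier_def norm_mult norm_divide divide_right_mono)
qed

lemma fourier_continuous:
  assumes F: "integrable lebesgue F" shows "continuous_on UNIV (fourier F)"
proof -
  have "isCont (fourier F) \<xi>" for \<xi>
    unfolding continuous_at_sequentially o_def
  proof safe
    fix X :: "nat \<Rightarrow> real" assume X: "X \<longlonglongrightarrow> \<xi>"
    have "(\<lambda>n. LINT t|lebesgue. F t * exp (- (\<i> * complex_of_real (X n) * complex_of_real t))) \<longlonglongrightarrow>
        (LINT t|lebesgue. F t * exp (- (\<i> * complex_of_real \<xi> * complex_of_real t)))"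
    proof (rule integral_dominated_convergence[where w="\<lambda>t. cmod (F t)"])
      show "AE t in lebesgue. (\<lambda>n. F t * exp (- (\<i> * complex_of_real (X n) * complex_of_real t)))
          \<longlonglongrightarrow> F t * exp (- (\<i> * complex_of_real \<xi> * complex_of_real t))"
        using X by (intro AE_I2 tendsto_intros)
    qed (use F fourier_integrand_integrable[OF F] in \<open>auto simp: norm_mult fourier_kernel_norm\<close>)
    then show "(\<lambda>n. fourier F (X n)) \<longlonglongrightarrow> fourier F \<xi>"
      unfolding fourier_def by (intro tendsto_intros)
  qed
  then show ?thesis by (simp add: continuous_on_eq_continuous_at)
qed

lemma fourier_scale: "fourier (\<lambda>t. c * F t) \<xi> = c * fourier F \<xi>"
  by (simp add: fourier_def mult.assoc mult.left_commute)

lemma fourier_add: "integrable lebesgue F \<Longrightarrow> integrable lebesgue G \<Longrightarrow>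
    fourier (\<lambda>t. F t + G t) \<xi> = fourier F \<xi> + fourier G \<xi>"
  using fourier_integrand_integrable[of F \<xi>] fourier_integrand_integrable[of G \<xi>]
  by (simp add: fourier_def distrib_right distrib_left)

lemma fourier_shift: "fourier (\<lambda>t. F (t + d)) \<xi> = exp (\<i> * complex_of_real \<xi> * complex_of_real d) * fourier F \<xi>"
proof -
  have "(LINT t|lebesgue. F t * exp (- (\<i> * complex_of_real \<xi> * complex_of_real t)))
      = (LINT t|lebesgue. F (d + 1 * t) * exp (- (\<i> * complex_of_real \<xi> * complex_of_real (d + 1 * t))))"
    by (subst lebesgue_integral_real_affine[where c=1 and t=d]) auto
  also have "\<dots> = (LINT t|lebesgue. exp (- (\<i> * complex_of_real \<xi> * complex_of_real d)) *
      (F (t + d) * exp (- (\<i> * complex_of_real \<xi> * complex_of_real t))))"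
    by (simp add: algebra_simps exp_add exp_diff exp_minus divide_inverse)
  finally have "fourier F \<xi> = exp (- (\<i> * complex_of_real \<xi> * complex_of_real d)) * fourier (\<lambda>t. F (t + d)) \<xi>"
    by (simp add: fourier_def)
  then show ?thesis by (simp add: exp_minus field_simps)
qed

section \<open>Gaussian damping and its Fourier transform\<close>

lemma normal_density_shift: "normal_density 0 \<epsilon> (x - t) = normal_density t \<epsilon> x"
  by (simp add: normal_density_def)

lemma normal_density_flip: "normal_density 0 \<epsilon> (t - x) = normal_density 0 \<epsilon> (x - t)"
  by (simp add: normal_density_def power2_commute)

lemma integrable_normal_density_lebesgue: "\<epsilon> > 0 \<Longrightarrow> integrable lebesgue (\<lambda>x. normal_density 0 \<epsilon> (x - t))"
  by (simp add: normal_density_shift integrable_completion)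

lemma integral_normal_density_lebesgue: "\<epsilon> > 0 \<Longrightarrow> (LINT x|lebesgue. normal_density 0 \<epsilon> (x - t)) = 1"
  by (simp add: normal_density_shift integral_completion)

text \<open>A Gaussian regulariser: it makes bounded measurable factors integrable, tends to 1 as
  \<open>\<epsilon>\<close> tends to 0, and its transform is \<open>sqrt (2 * pi)\<close> times the
  normal density with standard deviation \<open>\<epsilon>\<close>, an approximate identity.\<close>

definition damp :: "real \<Rightarrow> real \<Rightarrow> complex" where
  "damp \<epsilon> \<xi> = complex_of_real (exp (- (\<epsilon>\<^sup>2 * \<xi>\<^sup>2) / 2))"

lemma damp_eq_density:
  assumes "\<epsilon> > 0" shows "damp \<epsilon> \<xi> = complex_of_real (sqrt (2 * pi) / \<epsilon> * normal_density 0 (1 / \<epsilon>) \<xi>)"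
  using assms by (simp add: damp_def normal_density_def real_sqrt_mult real_sqrt_divide power_divide mult_ac)

lemma damp_integrable:
  assumes "\<epsilon> > 0" shows "integrable lebesgue (damp \<epsilon>)"
proof -
  have "integrable lebesgue (\<lambda>x. complex_of_real (sqrt (2 * pi) / \<epsilon> * normal_density 0 (1 / \<epsilon>) (x - 0)))"
    using assms by (intro integrable_of_real integrable_mult_right integrable_normal_density_lebesgue) simp
  moreover have "damp \<epsilon> = (\<lambda>x. complex_of_real (sqrt (2 * pi) / \<epsilon> * normal_density 0 (1 / \<epsilon>) (x - 0)))"
    using damp_eq_density[OF assms] by (intro ext) simp
  ultimately show ?thesis by metis
qed

lemma damp_norm_le: "cmod (damp \<epsilon> \<xi>) \<le> 1"
  by (simp add: damp_def)

lemma damp_continuous: "continuous_on A (damp \<epsilon>)"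
  unfolding damp_def by (intro continuous_intros) auto

lemma damp_tendsto: "\<epsilon> \<longlonglongrightarrow> 0 \<Longrightarrow> (\<lambda>n. damp (\<epsilon> n) \<xi>) \<longlonglongrightarrow> 1"
proof -
  assume "\<epsilon> \<longlonglongrightarrow> 0"
  then have "(\<lambda>n. damp (\<epsilon> n) \<xi>) \<longlonglongrightarrow> complex_of_real (exp (- (0\<^sup>2 * \<xi>\<^sup>2) / 2))"
    unfolding damp_def by (intro tendsto_intros) auto
  then show ?thesis by simp
qed

text \<open>The substitution \<open>y = \<epsilon> * \<xi>\<close> turns the integral into the
  characteristic function of the standard normal distribution at
  \<open>- u / \<epsilon>\<close>.\<close>

lemma fourier_damp:
  assumes "\<epsilon> > 0"
  shows "fourier (damp \<epsilon>) u = complex_of_real (sqrt (2 * pi) * normal_density 0 \<epsilon> u)"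
proof -
  define v where "v = - u / \<epsilon>"
  have "complex_of_real (exp (- (v^2) / 2)) = char std_normal_distribution v"
    by (simp add: char_std_normal_distribution)
  also have "\<dots> = (LINT y|lborel. std_normal_density y *\<^sub>R iexp (v * y))"
    unfolding char_def by (subst integral_density) auto
  also have "\<dots> = \<bar>\<epsilon>\<bar> *\<^sub>R (LINT \<xi>|lborel. std_normal_density (0 + \<epsilon> * \<xi>) *\<^sub>R iexp (v * (0 + \<epsilon> * \<xi>)))"
    using assms by (intro lborel_integral_real_affine) auto
  also have "\<dots> = complex_of_real (\<epsilon> / sqrt (2 * pi)) *
      (LINT \<xi>|lborel. damp \<epsilon> \<xi> * exp (- (\<i> * complex_of_real u * complex_of_real \<xi>)))"
  proof -
    have "std_normal_density (0 + \<epsilon> * \<xi>) *\<^sub>R iexp (v * (0 + \<epsilon> * \<xi>)) = 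
        complex_of_real (1 / sqrt (2 * pi)) * (damp \<epsilon> \<xi> * exp (- (\<i> * complex_of_real u * complex_of_real \<xi>)))" for \<xi>
      using assms by (simp add: damp_def std_normal_density_def v_def scaleR_conv_of_real power_mult_distrib)
        (simp add: mult_ac)
    then show ?thesis using assms by (simp add: scaleR_conv_of_real)
  qed
  also have "(LINT \<xi>|lborel. damp \<epsilon> \<xi> * exp (- (\<i> * complex_of_real u * complex_of_real \<xi>)))
      = (LINT \<xi>|lebesgue. damp \<epsilon> \<xi> * exp (- (\<i> * complex_of_real u * complex_of_real \<xi>)))"
    by (rule integral_completion[symmetric])
      (auto simp: damp_def intro!: borel_measurable_continuous_onI continuous_intros)
  finally have 1: "complex_of_real (exp (- (v^2) / 2)) = complex_of_real \<epsilon> * fourier (damp \<epsilon>) u"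
    by (simp add: fourier_def)
  have "sqrt (2 * pi) * normal_density 0 \<epsilon> u = exp (- (v^2) / 2) / \<epsilon>"
    using assms by (simp add: normal_density_def v_def real_sqrt_mult power_divide)
  then have "complex_of_real (sqrt (2 * pi) * normal_density 0 \<epsilon> u) = complex_of_real (exp (- (v^2) / 2)) / \<epsilon>"
    by (simp only: of_real_divide)
  then show ?thesis unfolding 1 using assms by simp
qed

section \<open>Plancherel inequality and Gaussian mollification\<close>

lemma fourier_modulate:
  "fourier (\<lambda>\<xi>. f \<xi> * exp (\<i> * complex_of_real x * complex_of_real \<xi>)) y = fourier f (y - x)"
  unfolding fourier_def by (simp add: mult.assoc flip: exp_add) (simp add: algebra_simps)

lemma ifourier_eq: "ifourier g x = complex_of_real (1 / sqrt (2 * pi)) *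
    (LINT \<xi>|lebesgue. g \<xi> * exp (\<i> * complex_of_real x * complex_of_real \<xi>))"
  by (simp add: ifourier_def fourier_def)

text \<open>Damping the transform amounts to mollifying \<open>F\<close> by a Gaussian; the
  multiplication formula moves the transform from \<open>F\<close> onto the modulated damping
  factor.\<close>

lemma ifourier_damped_fourier:
  assumes F: "integrable lebesgue F" and e: "\<epsilon> > 0"
  shows "ifourier (\<lambda>\<xi>. fourier F \<xi> * damp \<epsilon> \<xi>) x
    = (LINT y|lebesgue. F y * complex_of_real (normal_density 0 \<epsilon> (y - x)))"
proof -
  let ?E = "\<lambda>\<xi>. exp (\<i> * complex_of_real x * complex_of_real \<xi>)"
  let ?c = "complex_of_real (1 / sqrt (2 * pi))"
  have i: "integrable lebesgue (\<lambda>\<xi>. damp \<epsilon> \<xi> * ?E \<xi>)"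
    by (rule integrable_bounded_mult[OF damp_integrable[OF e], where B=1])
      (auto simp: norm_exp_eq_Re intro!: continuous_lebesgue_measurable continuous_intros)
  have "ifourier (\<lambda>\<xi>. fourier F \<xi> * damp \<epsilon> \<xi>) x = ?c * (LINT \<xi>|lebesgue. fourier F \<xi> * (damp \<epsilon> \<xi> * ?E \<xi>))"
    by (simp add: ifourier_eq mult.assoc)
  also have "\<dots> = ?c * (LINT y|lebesgue. F y * fourier (\<lambda>\<xi>. damp \<epsilon> \<xi> * ?E \<xi>) y)"
    by (simp add: fourier_multiplication[OF F i])
  also have "\<dots> = (LINT y|lebesgue. F y * complex_of_real (normal_density 0 \<epsilon> (y - x)))"
    unfolding fourier_modulate fourier_damp[OF e]
    by (subst integral_mult_right_zero[symmetric]) (simp add: field_simps)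
  finally show ?thesis .
qed

lemma nn_integral_normal_density_lebesgue:
  assumes "\<epsilon> > 0" shows "(\<integral>\<^sup>+ y. ennreal (normal_density 0 \<epsilon> (y - t)) \<partial>lebesgue) = 1"
proof -
  have "(\<integral>\<^sup>+ y. ennreal (normal_density 0 \<epsilon> (y - t)) \<partial>lebesgue)
      = ennreal (LINT y|lebesgue. normal_density 0 \<epsilon> (y - t))"
    using assms by (intro nn_integral_eq_integral integrable_normal_density_lebesgue) auto
  then show ?thesis using integral_normal_density_lebesgue[OF assms] by simp
qed

text \<open>Schur's test, by \<open>2 |F(t)| |F(y)| \<le> |F(t)|\<^sup>2 + |F(y)|\<^sup>2\<close>.\<close>

lemma gauss_form_le:
  fixes F :: "real \<Rightarrow> complex"
  assumes F: "F \<in> borel_measurable lebesgue" and e: "\<epsilon> > 0"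
  shows "(\<integral>\<^sup>+ t. \<integral>\<^sup>+ y. ennreal (cmod (F t) * cmod (F y) * normal_density 0 \<epsilon> (y - t)) \<partial>lebesgue \<partial>lebesgue)
    \<le> (\<integral>\<^sup>+ t. ennreal ((cmod (F t))\<^sup>2) \<partial>lebesgue)"
proof -
  interpret L: pair_sigma_finite "lebesgue :: real measure" "lebesgue :: real measure"
    by (rule pair_sigma_finite_lebesgue)
  note [measurable] = F
  let ?X = "\<integral>\<^sup>+ t. ennreal ((cmod (F t))\<^sup>2) \<partial>lebesgue"
  let ?G = "\<lambda>t y. normal_density 0 \<epsilon> (y - t)"
  have "(\<lambda>z. normal_density 0 \<epsilon> (snd z - fst z)) \<in> borel_measurable (borel \<Otimes>\<^sub>M borel)"
    by measurable
  then have [measurable]: "(\<lambda>z. normal_density 0 \<epsilon> (snd z - fst z)) \<in> borel_measurable (lebesgue \<Otimes>\<^sub>M (lebesgue :: real measure))"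
    by (rule measurable_lebesgue_pair)
  have Gm [measurable]: "(\<lambda>y. ?G t y) \<in> borel_measurable lebesgue" "(\<lambda>y. ?G y t) \<in> borel_measurable lebesgue" for t
    by (intro measurable_completion; measurable)+
  have 1: "(\<integral>\<^sup>+ t. \<integral>\<^sup>+ y. ennreal ((cmod (F t))\<^sup>2 * ?G t y) \<partial>lebesgue \<partial>lebesgue) = ?X"
    by (simp add: ennreal_mult nn_integral_cmult nn_integral_normal_density_lebesgue[OF e])
  have "(\<integral>\<^sup>+ t. \<integral>\<^sup>+ y. ennreal ((cmod (F y))\<^sup>2 * ?G t y) \<partial>lebesgue \<partial>lebesgue)
      = (\<integral>\<^sup>+ y. \<integral>\<^sup>+ t. ennreal ((cmod (F y))\<^sup>2 * ?G t y) \<partial>lebesgue \<partial>lebesgue)"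
    by (rule L.Fubini'[symmetric]) (simp add: case_prod_unfold)
  also have "\<dots> = (\<integral>\<^sup>+ y. \<integral>\<^sup>+ t. ennreal ((cmod (F y))\<^sup>2 * normal_density 0 \<epsilon> (t - y)) \<partial>lebesgue \<partial>lebesgue)"
    by (subst normal_density_flip) simp
  also have "\<dots> = ?X" by (rule 1)
  finally have 2: "(\<integral>\<^sup>+ t. \<integral>\<^sup>+ y. ennreal ((cmod (F y))\<^sup>2 * ?G t y) \<partial>lebesgue \<partial>lebesgue) = ?X" .
  have "2 * (\<integral>\<^sup>+ t. \<integral>\<^sup>+ y. ennreal (cmod (F t) * cmod (F y) * ?G t y) \<partial>lebesgue \<partial>lebesgue)
      = (\<integral>\<^sup>+ t. \<integral>\<^sup>+ y. 2 * ennreal (cmod (F t) * cmod (F y) * ?G t y) \<partial>lebesgue \<partial>lebesgue)"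
    by (subst nn_integral_cmult; (subst nn_integral_cmult)?) (simp_all add: case_prod_unfold)
  also have "\<dots> \<le> (\<integral>\<^sup>+ t. \<integral>\<^sup>+ y. ennreal ((cmod (F t))\<^sup>2 * ?G t y) + ennreal ((cmod (F y))\<^sup>2 * ?G t y) \<partial>lebesgue \<partial>lebesgue)"
  proof (intro nn_integral_mono)
    fix t y
    have "2 * (cmod (F t) * cmod (F y)) * ?G t y \<le> ((cmod (F t))\<^sup>2 + (cmod (F y))\<^sup>2) * ?G t y"
      by (intro mult_right_mono two_mult_le_squares) simp
    then have "ennreal (2 * (cmod (F t) * cmod (F y) * ?G t y)) \<le> ennreal ((cmod (F t))\<^sup>2 * ?G t y + (cmod (F y))\<^sup>2 * ?G t y)"
      by (intro ennreal_leI) (simp add: algebra_simps)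
    then show "2 * ennreal (cmod (F t) * cmod (F y) * ?G t y)
        \<le> ennreal ((cmod (F t))\<^sup>2 * ?G t y) + ennreal ((cmod (F y))\<^sup>2 * ?G t y)"
      by (simp add: ennreal_mult)
  qed
  also have "\<dots> = ?X + ?X"
    by (subst nn_integral_add) (simp_all add: 1 2 nn_integral_add case_prod_unfold)
  also have "\<dots> = 2 * ?X" by (simp add: mult_2)
  finally show ?thesis by (simp add: ennreal_mult_le_mult_iff)
qed

text \<open>Pair \<open>fourier F\<close> with its own damped conjugate. The multiplication formula
  turns the damped energy into \<open>F\<close> against its Gaussian mollification, which
  \<open>gauss_form_le\<close> bounds by \<open>L2_sq F\<close>, and Fatou's lemma removes the
  damping.\<close>

lemma plancherel_le:
  assumes F: "F \<in> L2" "integrable lebesgue F"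
  shows "fourier F \<in> L2" "L2_sq (fourier F) \<le> L2_sq F"
proof -
  define e where "e = (\<lambda>n. inverse (real (Suc n)))"
  have e: "e n > 0" "e \<longlonglongrightarrow> 0" for n
    using LIMSEQ_inverse_real_of_nat by (auto simp: e_def)
  let ?X = "\<integral>\<^sup>+ t. ennreal ((cmod (F t))\<^sup>2) \<partial>lebesgue"
  have X: "?X = ennreal (L2_sq F)"
    unfolding L2_sq_def using F L2_sq_integrable by (intro nn_integral_eq_integral) auto
  have fm [measurable]: "fourier F \<in> borel_measurable lebesgue"
    by (rule continuous_lebesgue_measurable[OF fourier_continuous[OF F(2)]])
  define B where "B = (LINT t|lebesgue. cmod (F t)) / sqrt (2 * pi)"
  have B: "cmod (fourier F \<xi>) \<le> B" for \<xi> unfolding B_def by (rule fourier_norm_le[OF F(2)])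
  have main: "(\<integral>\<^sup>+ \<xi>. ennreal ((cmod (fourier F \<xi>))\<^sup>2 * cmod (damp (e n) \<xi>)) \<partial>lebesgue) \<le> ?X" for n
  proof -
    let ?d = "damp (e n)"
    define \<psi> where "\<psi> = (\<lambda>\<xi>. ?d \<xi> * cnj (fourier F \<xi>))"
    have \<psi>: "integrable lebesgue \<psi>" unfolding \<psi>_def
      by (rule integrable_bounded_mult[OF damp_integrable[OF e(1)], where B=B])
        (auto simp: B intro!: continuous_lebesgue_measurable continuous_intros fourier_continuous[OF F(2)])
    have fp: "cnj (fourier \<psi> t) = (LINT y|lebesgue. F y * complex_of_real (normal_density 0 (e n) (y - t)))" for t
    proof -
      have "(\<lambda>\<xi>. cnj (\<psi> \<xi>)) = (\<lambda>\<xi>. fourier F \<xi> * ?d \<xi>)"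
        by (simp add: \<psi>_def damp_def mult.commute)
      then show ?thesis
        by (simp add: fourier_cnj ifourier_damped_fourier[OF F(2) e(1)])
    qed
    have fF: "fourier F \<xi> * \<psi> \<xi> = complex_of_real ((cmod (fourier F \<xi>))\<^sup>2 * cmod (?d \<xi>))" for \<xi>
      unfolding of_real_mult complex_norm_square by (simp add: \<psi>_def damp_def mult_ac)
    have "integrable lebesgue (\<lambda>\<xi>. \<psi> \<xi> * fourier F \<xi>)"
      by (rule integrable_bounded_mult[OF \<psi> fm B])
    then have i: "integrable lebesgue (\<lambda>\<xi>. complex_of_real ((cmod (fourier F \<xi>))\<^sup>2 * cmod (?d \<xi>)))"
      by (simp only: fF mult.commute[of "\<psi> _"])
    then have i': "integrable lebesgue (\<lambda>\<xi>. (cmod (fourier F \<xi>))\<^sup>2 * cmod (?d \<xi>))"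
      by (simp only: complex_of_real_integrable_eq)
    have "(\<integral>\<^sup>+ \<xi>. ennreal ((cmod (fourier F \<xi>))\<^sup>2 * cmod (?d \<xi>)) \<partial>lebesgue)
        = ennreal (LINT \<xi>|lebesgue. (cmod (fourier F \<xi>))\<^sup>2 * cmod (?d \<xi>))"
      by (intro nn_integral_eq_integral i') auto
    also have "(LINT \<xi>|lebesgue. (cmod (fourier F \<xi>))\<^sup>2 * cmod (?d \<xi>))
        = cmod (LINT \<xi>|lebesgue. fourier F \<xi> * \<psi> \<xi>)"
      unfolding fF integral_complex_of_real norm_of_real by simp
    also have "\<dots> = cmod (LINT t|lebesgue. F t * fourier \<psi> t)"
      by (simp add: fourier_multiplication[OF F(2) \<psi>])
    also have "ennreal \<dots> \<le> (\<integral>\<^sup>+ t. ennreal (cmod (F t * fourier \<psi> t)) \<partial>lebesgue)"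
    proof (rule integral_norm_bound_ennreal)
      show "integrable lebesgue (\<lambda>t. F t * fourier \<psi> t)"
        using fourier_norm_le[OF \<psi>]
        by (rule integrable_bounded_mult[OF F(2) continuous_lebesgue_measurable[OF fourier_continuous[OF \<psi>]]])
    qed
    also have "\<dots> \<le> (\<integral>\<^sup>+ t. \<integral>\<^sup>+ y. ennreal (cmod (F t) * cmod (F y) * normal_density 0 (e n) (y - t)) \<partial>lebesgue \<partial>lebesgue)"
    proof (rule nn_integral_mono)
      fix t
      let ?g = "\<lambda>y. complex_of_real (normal_density 0 (e n) (y - t))"
      have gm [measurable]: "?g \<in> borel_measurable lebesgue" by (intro measurable_completion) measurable
      have bd: "normal_density 0 (e n) u \<le> 1 / sqrt (2 * pi * (e n)\<^sup>2)" for u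
        by (auto simp: normal_density_def divide_right_mono)
      have int: "integrable lebesgue (\<lambda>y. F y * ?g y)"
        by (rule integrable_bounded_mult[OF F(2) gm, where B="1 / sqrt (2 * pi * (e n)\<^sup>2)"])
          (simp only: norm_of_real abs_of_nonneg normal_density_nonneg bd)
      have [measurable]: "F \<in> borel_measurable lebesgue" by (rule L2_measurable[OF F(1)])
      have "ennreal (cmod (F t * fourier \<psi> t)) = ennreal (cmod (F t)) * ennreal (cmod (LINT y|lebesgue. F y * ?g y))"
        by (simp add: norm_mult ennreal_mult flip: fp)
      also have "\<dots> \<le> ennreal (cmod (F t)) * (\<integral>\<^sup>+ y. ennreal (cmod (F y * ?g y)) \<partial>lebesgue)"
        by (intro mult_left_mono integral_norm_bound_ennreal int) auto
      also have "\<dots> = (\<integral>\<^sup>+ y. ennreal (cmod (F t)) * ennreal (cmod (F y * ?g y)) \<partial>lebesgue)"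
        by (rule nn_integral_cmult[symmetric]) measurable
      also have "\<dots> = (\<integral>\<^sup>+ y. ennreal (cmod (F t) * cmod (F y) * normal_density 0 (e n) (y - t)) \<partial>lebesgue)"
        by (simp add: norm_mult mult.assoc flip: ennreal_mult)
      finally show "ennreal (cmod (F t * fourier \<psi> t)) \<le>
          (\<integral>\<^sup>+ y. ennreal (cmod (F t) * cmod (F y) * normal_density 0 (e n) (y - t)) \<partial>lebesgue)" .
    qed
    also have "\<dots> \<le> ?X" by (rule gauss_form_le[OF L2_measurable[OF F(1)] e(1)])
    finally show ?thesis .
  qed
  have dm [measurable]: "damp \<epsilon> \<in> borel_measurable lebesgue" for \<epsilon>
    by (rule continuous_lebesgue_measurable[OF damp_continuous])
  have "(\<integral>\<^sup>+ \<xi>. ennreal ((cmod (fourier F \<xi>))\<^sup>2) \<partial>lebesgue)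
      = (\<integral>\<^sup>+ \<xi>. liminf (\<lambda>n. ennreal ((cmod (fourier F \<xi>))\<^sup>2 * cmod (damp (e n) \<xi>))) \<partial>lebesgue)"
  proof (rule nn_integral_cong)
    fix \<xi>
    have "(\<lambda>n. (cmod (fourier F \<xi>))\<^sup>2 * cmod (damp (e n) \<xi>)) \<longlonglongrightarrow> (cmod (fourier F \<xi>))\<^sup>2 * cmod 1"
      by (intro tendsto_intros damp_tendsto e(2))
    then have "(\<lambda>n. ennreal ((cmod (fourier F \<xi>))\<^sup>2 * cmod (damp (e n) \<xi>))) \<longlonglongrightarrow> ennreal ((cmod (fourier F \<xi>))\<^sup>2)"
      by simp
    then show "ennreal ((cmod (fourier F \<xi>))\<^sup>2) = liminf (\<lambda>n. ennreal ((cmod (fourier F \<xi>))\<^sup>2 * cmod (damp (e n) \<xi>)))"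
      by (intro lim_imp_Liminf[symmetric]) auto
  qed
  also have "\<dots> \<le> liminf (\<lambda>n. \<integral>\<^sup>+ \<xi>. ennreal ((cmod (fourier F \<xi>))\<^sup>2 * cmod (damp (e n) \<xi>)) \<partial>lebesgue)"
    by (intro nn_integral_liminf) measurable
  also have "\<dots> \<le> liminf (\<lambda>n::nat. ?X)"
    by (intro Liminf_mono always_eventually allI main)
  finally have fin: "(\<integral>\<^sup>+ \<xi>. ennreal ((cmod (fourier F \<xi>))\<^sup>2) \<partial>lebesgue) \<le> ennreal (L2_sq F)"
    by (simp add: X Liminf_const)
  then have "(\<integral>\<^sup>+ \<xi>. ennreal ((cmod (fourier F \<xi>))\<^sup>2) \<partial>lebesgue) < \<infinity>"
    using le_less_trans ennreal_less_top by (metis infinity_ennreal_def)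
  then have int: "integrable lebesgue (\<lambda>\<xi>. (cmod (fourier F \<xi>))\<^sup>2)"
    by (intro integrableI_bounded) auto
  then show "fourier F \<in> L2" by (simp add: L2_def fm)
  have "(\<integral>\<^sup>+ \<xi>. ennreal ((cmod (fourier F \<xi>))\<^sup>2) \<partial>lebesgue) = ennreal (L2_sq (fourier F))"
    unfolding L2_sq_def using int by (intro nn_integral_eq_integral) auto
  then show "L2_sq (fourier F) \<le> L2_sq F"
    using fin L2_sq_nonneg[of F] by (simp add: ennreal_le_iff)
qed


text \<open>A bound uniform in \<open>\<epsilon>\<close>, from \<open>v \<le> exp v\<close> with
  \<open>v\<close> the Gaussian exponent; it leaves over a factor
  \<open>\<epsilon> \<le> 1\<close>.\<close>

lemma normal_density_le_inverse_square:
  assumes "0 < \<epsilon>" "\<epsilon> \<le> 1" "u \<noteq> 0"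
  shows "normal_density 0 \<epsilon> u \<le> 1 / u\<^sup>2"
proof -
  define v where "v = u\<^sup>2 / (2 * \<epsilon>\<^sup>2)"
  have v: "v > 0" using assms by (simp add: v_def)
  have "v \<le> exp v" using exp_ge_add_one_self[of v] by linarith
  then have "exp (- v) \<le> 1 / v" using v by (simp add: exp_minus field_simps)
  moreover have "2 \<le> sqrt (2 * pi)" using pi_gt3 by (intro real_le_rsqrt) simp
  then have "2 * \<epsilon> \<le> sqrt (2 * pi * \<epsilon>\<^sup>2)"
    using assms by (simp add: real_sqrt_mult)
  then have "1 / sqrt (2 * pi * \<epsilon>\<^sup>2) \<le> 1 / (2 * \<epsilon>)"
    using assms by (intro divide_left_mono) auto
  ultimately have "1 / sqrt (2 * pi * \<epsilon>\<^sup>2) * exp (- v) \<le> 1 / (2 * \<epsilon>) * (1 / v)"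
    using assms v by (intro mult_mono) auto
  then have "normal_density 0 \<epsilon> u \<le> 1 / (2 * \<epsilon>) * (1 / v)"
    by (simp add: normal_density_def v_def)
  also have "\<dots> = \<epsilon> / u\<^sup>2" using assms by (simp add: v_def field_simps power2_eq_square)
  also have "\<dots> \<le> 1 / u\<^sup>2" using assms by (intro divide_right_mono) auto
  finally show ?thesis .
qed

lemma integrable_inverse_1_plus_square_lebesgue: "integrable lebesgue (\<lambda>t::real. C / (1 + t\<^sup>2))"
proof -
  have "integrable lborel (\<lambda>t::real. inverse (1 + t\<^sup>2))"
    using integrable_inverse_1_plus_square by (simp add: set_integrable_def einterval_def)
  then have "integrable lebesgue (\<lambda>t::real. inverse (1 + t\<^sup>2))"
    by (subst integrable_completion) auto
  then have "integrable lebesgue (\<lambda>t::real. C * inverse (1 + t\<^sup>2))" by simp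
  then show ?thesis by (simp add: divide_inverse)
qed

text \<open>An integrable majorant uniform in \<open>\<epsilon>\<close>, for dominated convergence.
  If \<open>\<bar>t\<bar> < 2 * T\<close>, the integral is at most 1, which
  \<open>1 + 4 * T^2\<close> covers; otherwise
  \<open>\<bar>x - t\<bar> \<ge> \<bar>t\<bar> / 2\<close> on the window gives
  \<open>8 * T / t^2\<close>, which \<open>16 * T\<close> covers.\<close>

lemma gauss_window_le:
  fixes t :: real
  assumes T: "T \<ge> 1" and e: "0 < \<epsilon>" "\<epsilon> \<le> 1"
  shows "(LINT x|lebesgue. indicator {-T..T} x * normal_density 0 \<epsilon> (x - t)) \<le> (1 + 4 * T\<^sup>2 + 16 * T) / (1 + t\<^sup>2)"
proof -
  have int: "integrable lebesgue (\<lambda>x. indicator {-T..T} x * normal_density 0 \<epsilon> (x - t))"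
    using integrable_mult_indicator[OF _ integrable_normal_density_lebesgue[OF e(1)], of "{-T..T}" t] by simp
  show ?thesis
  proof (cases "\<bar>t\<bar> < 2 * T")
    case True
    have "(LINT x|lebesgue. indicator {-T..T} x * normal_density 0 \<epsilon> (x - t))
        \<le> (LINT x|lebesgue. normal_density 0 \<epsilon> (x - t))"
      by (intro integral_mono int integrable_normal_density_lebesgue e) (auto simp: indicator_def)
    also have "\<dots> = 1" by (rule integral_normal_density_lebesgue[OF e(1)])
    also have "t\<^sup>2 \<le> (2 * T)\<^sup>2" using True by (intro power2_le_iff_abs_le[THEN iffD2]) auto
    then have "1 \<le> (1 + 4 * T\<^sup>2 + 16 * T) / (1 + t\<^sup>2)"
      using T by (subst le_divide_eq_1_pos) (auto simp: power_mult_distrib add_pos_nonneg)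
    finally show ?thesis .
  next
    case False
    have "(LINT x|lebesgue. indicator {-T..T} x * normal_density 0 \<epsilon> (x - t))
        \<le> (LINT x|lebesgue. indicator {-T..T} x * (4 / t\<^sup>2))"
    proof (intro integral_mono int)
      show "integrable lebesgue (\<lambda>x. indicator {-T..T} x * (4 / t\<^sup>2) :: real)"
        by (intro integrable_mult_left integrable_real_indicator) (auto simp: emeasure_lborel_Icc_eq)
      fix x
      have "normal_density 0 \<epsilon> (x - t) \<le> 4 / t\<^sup>2" if "x \<in> {-T..T}"
      proof -
        have a: "\<bar>t\<bar> / 2 \<le> \<bar>x - t\<bar>" "x - t \<noteq> 0" "t \<noteq> 0" using that False T by (auto simp: abs_if split: if_splits)
        have "normal_density 0 \<epsilon> (x - t) \<le> 1 / (x - t)\<^sup>2"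
          by (rule normal_density_le_inverse_square[OF e a(2)])
        also have "(\<bar>t\<bar> / 2)\<^sup>2 \<le> (x - t)\<^sup>2" using power_mono[OF a(1), of 2] by simp
        then have "1 / (x - t)\<^sup>2 \<le> 4 / t\<^sup>2" using a(2,3) by (simp add: field_simps power_divide)
        finally show ?thesis .
      qed
      then show "indicator {-T..T} x * normal_density 0 \<epsilon> (x - t) \<le> indicator {-T..T} x * (4 / t\<^sup>2)"
        by (auto simp: indicator_def)
    qed
    also have "\<dots> = 8 * T / t\<^sup>2" using T by simp
    also have "\<dots> \<le> (16 * T) / (1 + t\<^sup>2)"
    proof -
      have "1 \<le> \<bar>t\<bar>" using False T by simp
      then have "1 \<le> t\<^sup>2" by (metis one_le_power power2_abs)
      then have "1 + t\<^sup>2 \<le> 2 * t\<^sup>2" "t\<^sup>2 > 0" by auto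
      then show ?thesis using T by (simp add: field_simps add_pos_nonneg) 
    qed
    also have "\<dots> \<le> (1 + 4 * T\<^sup>2 + 16 * T) / (1 + t\<^sup>2)"
      by (intro divide_right_mono) auto
    finally show ?thesis .
  qed
qed

section \<open>Approximate identities, and functions with vanishing interval integrals\<close>

definition eps :: "nat \<Rightarrow> real" where "eps n = inverse (real (Suc n))"

lemma eps_pos: "eps n > 0" and eps_le_1: "eps n \<le> 1"
  by (simp_all add: eps_def field_simps)

lemma eps_tendsto: "eps \<longlonglongrightarrow> 0"
  unfolding eps_def by (rule LIMSEQ_inverse_real_of_nat)

text \<open>The substitution \<open>x = t + eps n * y\<close> fixes the Gaussian and moves the
  parameter into \<open>g\<close>, so continuity at the single point \<open>t\<close> is what
  counts. This admits functions with jumps elsewhere, such as indicators of intervals.\<close>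

lemma gauss_approx:
  fixes g :: "real \<Rightarrow> complex"
  assumes g: "g \<in> borel_measurable borel" "\<And>x. cmod (g x) \<le> M" and c: "isCont g t"
  shows "(\<lambda>n. LINT x|lebesgue. g x * complex_of_real (normal_density 0 (eps n) (x - t))) \<longlonglongrightarrow> g t"
proof -
  note [measurable] = g(1)
  have eq: "(LINT x|lebesgue. g x * complex_of_real (normal_density 0 (eps n) (x - t)))
      = (LINT y|lborel. g (t + eps n * y) * complex_of_real (std_normal_density y))" for n
  proof -
    have "(LINT x|lebesgue. g x * complex_of_real (normal_density 0 (eps n) (x - t)))
        = (LINT x|lborel. g x * complex_of_real (normal_density 0 (eps n) (x - t)))"
      by (rule integral_completion) measurable
    also have "\<dots> = \<bar>eps n\<bar> *\<^sub>R (LINT y|lborel. g (t + eps n * y) * complex_of_real (normal_density 0 (eps n) (t + eps n * y - t)))"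
      using eps_pos[of n] by (intro lborel_integral_real_affine) auto
    also have "\<dots> = (LINT y|lborel. \<bar>eps n\<bar> *\<^sub>R (g (t + eps n * y) * complex_of_real (normal_density 0 (eps n) (t + eps n * y - t))))"
      by simp
    also have "\<dots> = (LINT y|lborel. g (t + eps n * y) * complex_of_real (std_normal_density y))"
    proof (rule Bochner_Integration.integral_cong[OF refl])
      fix y
      have "eps n * normal_density 0 (eps n) (eps n * y) = std_normal_density y"
        using eps_pos[of n] by (simp add: normal_density_def real_sqrt_mult power_mult_distrib)
      then have "complex_of_real (eps n) * complex_of_real (normal_density 0 (eps n) (eps n * y)) = complex_of_real (std_normal_density y)"
        by (metis of_real_mult)
      then show "\<bar>eps n\<bar> *\<^sub>R (g (t + eps n * y) * complex_of_real (normal_density 0 (eps n) (t + eps n * y - t)))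
          = g (t + eps n * y) * complex_of_real (std_normal_density y)"
        using eps_pos[of n] by (simp add: scaleR_conv_of_real mult_ac)
    qed
    finally show ?thesis .
  qed
  have "(\<lambda>n. LINT y|lborel. g (t + eps n * y) * complex_of_real (std_normal_density y))
      \<longlonglongrightarrow> (LINT y|lborel. g t * complex_of_real (std_normal_density y))"
  proof (rule integral_dominated_convergence[where w="\<lambda>y. M * std_normal_density y"])
    show "AE y in lborel. (\<lambda>n. g (t + eps n * y) * complex_of_real (std_normal_density y))
        \<longlonglongrightarrow> g t * complex_of_real (std_normal_density y)"
    proof (rule AE_I2)
      fix y
      have "(\<lambda>n. t + eps n * y) \<longlonglongrightarrow> t + 0 * y" by (intro tendsto_intros eps_tendsto)
      then have "(\<lambda>n. g (t + eps n * y)) \<longlonglongrightarrow> g t"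
        using isCont_tendsto_compose[OF c] by simp
      then show "(\<lambda>n. g (t + eps n * y) * complex_of_real (std_normal_density y))
        \<longlonglongrightarrow> g t * complex_of_real (std_normal_density y)" by (intro tendsto_intros)
    qed
  qed (auto simp: norm_mult intro!: mult_right_mono g(2) integrable_normal_density)
  also have "(LINT y|lborel. g t * complex_of_real (std_normal_density y)) = g t"
    by (simp add: integral_normal_density)
  finally show ?thesis unfolding eq .
qed

text \<open>After cutting to \<open>[-n, n]\<close>, Dynkin's theorem extends the hypothesis from
  half-lines to Borel sets, and every Lebesgue set is a Borel set up to a null set.\<close>

lemma AE_eq_0_if_interval_integrals_0:
  fixes u :: "real \<Rightarrow> complex"
  assumes int: "\<And>a b. integrable lebesgue (\<lambda>x. indicator {a..b} x * u x)"
    and z: "\<And>a b. (LINT x|lebesgue. indicator {a..b} x * u x) = 0"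
  shows "AE x in lebesgue. u x = 0"
proof -
  have "AE x in lebesgue. indicator {-real n..real n} x * u x = 0" for n
  proof -
    define v where "v = (\<lambda>x. indicator {-real n..real n} x * u x)"
    have v: "integrable lebesgue v" unfolding v_def by (rule int)
    have vA: "integrable lebesgue (\<lambda>x. indicat_real A x *\<^sub>R v x)" if "A \<in> sets lebesgue" for A
      using that v by (intro integrable_mult_indicator)
    have vU: "(LINT x|lebesgue. v x) = 0" unfolding v_def by (rule z)
    have borel0: "(LINT x|lebesgue. indicat_real A x *\<^sub>R v x) = 0" if A: "A \<in> sets borel" for A
    proof -
      have A: "A \<in> sigma_sets UNIV (range (\<lambda>c::real. {..c}))"
        using A by (simp add: borel_eq_atMost)
      have I: "Int_stable (range (\<lambda>c::real. {..c}))"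
        by (auto simp: Int_stable_def)
      have G: "range (\<lambda>c::real. {..c}) \<subseteq> Pow UNIV" by simp
      from I G A show ?thesis
      proof (induction A rule: sigma_sets_induct_disjoint)
        case (basic A)
        then obtain c where A: "A = {..c}" by auto
        have "indicat_real A x *\<^sub>R v x = indicator {-real n..min (real n) c} x * u x" for x
          by (auto simp: A v_def indicator_def)
        then show ?case using z by simp
      next
        case empty then show ?case by simp
      next
        case (compl A)
        then have "A \<in> sets borel" by (simp add: borel_eq_atMost)
        then have A: "A \<in> sets lebesgue" by (simp add: sets_completionI_sets)
        have "(LINT x|lebesgue. indicat_real (UNIV - A) x *\<^sub>R v x) = (LINT x|lebesgue. v x - indicat_real A x *\<^sub>R v x)"
          by (intro Bochner_Integration.integral_cong) (auto simp: indicator_def)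
        also have "\<dots> = 0" using v vA[OF A] vU compl by simp
        finally show ?case .
      next
        case (union A)
        then have "A i \<in> sets borel" for i by (auto simp: borel_eq_atMost)
        then have A: "A i \<in> sets lebesgue" for i by (simp add: sets_completionI_sets)
        have "(\<integral>x\<in>(\<Union>i. A i). v x \<partial>lebesgue) = (\<Sum>i. \<integral>x\<in>A i. v x \<partial>lebesgue)"
          using A union(1) v
          by (intro lebesgue_integral_countable_add)
            (auto simp: disjoint_family_on_def set_integrable_def intro!: vA)
        then show ?case using union by (simp add: set_lebesgue_integral_def)
      qed
    qed
    have "AE x in lebesgue. v x = 0"
    proof (rule sigma_finite_measure.density_zero[OF sigma_finite_lebesgue v])
      fix A :: "real set" assume "A \<in> sets lebesgue"
      then obtain S N N' where S: "A = S \<union> N" "N \<subseteq> N'" "N' \<in> null_sets lborel" "S \<in> sets lborel"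
        by (rule sets_completionE)
      have N': "N' \<in> null_sets lebesgue"
        using S(3) by (simp add: null_sets_completionI)
      have "set_lebesgue_integral lebesgue A v = set_lebesgue_integral lebesgue S v"
        unfolding set_lebesgue_integral_def
      proof (rule integral_cong_AE)
        show "(\<lambda>x. indicat_real A x *\<^sub>R v x) \<in> borel_measurable lebesgue" using vA[OF \<open>A \<in> sets lebesgue\<close>] by auto
        have "S \<in> sets lebesgue" using S(4) by (rule sets_completionI_sets)
        then show "(\<lambda>x. indicat_real S x *\<^sub>R v x) \<in> borel_measurable lebesgue" using vA by auto
        show "AE x in lebesgue. indicat_real A x *\<^sub>R v x = indicat_real S x *\<^sub>R v x"
          using AE_not_in[OF N'] by eventually_elim (use S in \<open>auto simp: indicator_def\<close>)
      qed
      then show "set_lebesgue_integral lebesgue A v = 0"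
        using borel0[of S] S(4) by (simp add: set_lebesgue_integral_def)
    qed
    then show ?thesis by (simp add: v_def)
  qed
  then have "AE x in lebesgue. \<forall>n. indicator {-real n..real n} x * u x = 0"
    by (intro AE_all_countable[THEN iffD2] allI)
  then show ?thesis
  proof eventually_elim
    fix x assume *: "\<forall>n. indicator {-real n..real n} x * u x = 0"
    obtain n where "\<bar>x\<bar> \<le> real n" using real_arch_simple by blast
    then show "u x = 0" using *[rule_format, of n] by (auto simp: indicator_def abs_le_iff split: if_splits)
  qed
qed

section \<open>Fourier inversion for band-limited functions\<close>

lemma L2_tendsto_iff:
  assumes "\<And>n. F n \<in> L2" "f \<in> L2"
  shows "L2_tendsto F f \<longleftrightarrow> (\<lambda>n. L2_sq (\<lambda>x. F n x - f x)) \<longlonglongrightarrow> 0"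
proof -
  have "(\<integral>\<^sup>+ x. ennreal ((cmod (F n x - f x))\<^sup>2) \<partial>lebesgue) = ennreal (L2_sq (\<lambda>x. F n x - f x))" for n
    unfolding L2_sq_def using L2_sq_integrable[OF L2_diff[OF assms(1) assms(2)]]
    by (intro nn_integral_eq_integral) auto
  then show ?thesis
    unfolding L2_tendsto_def by (simp add: tendsto_ennreal_iff L2_sq_nonneg flip: ennreal_0)
qed

lemma L2_inner_tendsto:
  assumes L: "\<And>n. F n \<in> L2" "f \<in> L2" "h \<in> L2" and lim: "(\<lambda>n. L2_sq (\<lambda>x. F n x - f x)) \<longlonglongrightarrow> 0"
  shows "(\<lambda>n. L2_inner (F n) h) \<longlonglongrightarrow> L2_inner f h"
proof -
  have "(\<lambda>n. (cmod (L2_inner (F n) h - L2_inner f h))\<^sup>2) \<longlonglongrightarrow> 0"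
  proof (rule tendsto_sandwich[OF _ _ tendsto_const])
    show "(\<lambda>n. L2_sq (\<lambda>x. F n x - f x) * L2_sq h) \<longlonglongrightarrow> 0"
      using tendsto_mult_right[OF lim, of "L2_sq h"] by simp
    show "\<forall>\<^sub>F n in sequentially. (cmod (L2_inner (F n) h - L2_inner f h))\<^sup>2 \<le> L2_sq (\<lambda>x. F n x - f x) * L2_sq h"
      using L2_cauchy_schwarz[OF L2_diff[OF L(1,2)] L(3)] L by (auto simp: L2_inner_diff_left)
  qed auto
  then have "(\<lambda>n. sqrt ((cmod (L2_inner (F n) h - L2_inner f h))\<^sup>2)) \<longlonglongrightarrow> sqrt 0"
    by (rule tendsto_real_sqrt)
  then have "(\<lambda>n. cmod (L2_inner (F n) h - L2_inner f h)) \<longlonglongrightarrow> 0" by simp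
  then show ?thesis using Lim_null tendsto_norm_zero_iff by blast
qed

lemma L2_inner_tendsto_right:
  assumes L: "\<And>n. F n \<in> L2" "f \<in> L2" "h \<in> L2" and lim: "(\<lambda>n. L2_sq (\<lambda>x. F n x - f x)) \<longlonglongrightarrow> 0"
  shows "(\<lambda>n. L2_inner h (F n)) \<longlonglongrightarrow> L2_inner h f"
  using tendsto_cnj[OF L2_inner_tendsto[OF L lim]] by (simp flip: L2_inner_cnj)

lemma L2_sq_tendsto:
  assumes L: "\<And>n. F n \<in> L2" "f \<in> L2" and lim: "(\<lambda>n. L2_sq (\<lambda>x. F n x - f x)) \<longlonglongrightarrow> 0"
  shows "(\<lambda>n. L2_sq (F n)) \<longlonglongrightarrow> L2_sq f"
proof -
  have "L2_sq (F n) = L2_sq f + L2_sq (\<lambda>x. F n x - f x) + 2 * Re (L2_inner f (F n) - L2_inner f f)" for n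
    using L2_sq_add[OF L(2) L2_diff[OF L(1) L(2)], of n] L by (simp add: L2_inner_diff_right)
  moreover have "(\<lambda>n. L2_sq f + L2_sq (\<lambda>x. F n x - f x) + 2 * Re (L2_inner f (F n) - L2_inner f f))
      \<longlonglongrightarrow> L2_sq f + 0 + 2 * Re (L2_inner f f - L2_inner f f)"
    by (intro tendsto_intros lim L2_inner_tendsto_right[OF L L(2)])
  ultimately show ?thesis by simp
qed

lemma ifourier_in_L2: "F \<in> L2 \<Longrightarrow> integrable lebesgue F \<Longrightarrow> ifourier F \<in> L2"
  using L2_cnj[OF plancherel_le(1)[OF L2_cnj, of F]] by (simp add: fourier_cnj)

lemma has_L2_fourier_sq_le:
  assumes "has_L2_fourier f g" shows "L2_sq g \<le> L2_sq f"
proof -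
  from assms obtain F where L: "f \<in> L2" "g \<in> L2" and F: "\<And>n. F n \<in> L2" "\<And>n. integrable lebesgue (F n)"
    and lim: "L2_tendsto F f" "L2_tendsto (\<lambda>n. fourier (F n)) g"
    unfolding has_L2_fourier_def by blast
  note fL = plancherel_le[OF F]
  have "(\<lambda>n. L2_sq (fourier (F n))) \<longlonglongrightarrow> L2_sq g" "(\<lambda>n. L2_sq (F n)) \<longlonglongrightarrow> L2_sq f"
    using lim by (auto intro!: L2_sq_tendsto fL F L simp: L2_tendsto_iff fL F L)
  then show ?thesis using fL(2) by (intro LIMSEQ_le) auto
qed

text \<open>The approximants in \<open>has_L2_fourier\<close> give no pointwise information, so
  \<open>f\<close> and \<open>g\<close> are tied together by testing against integrable functions;
  the identity holds for each approximant and passes to the limit.\<close>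

lemma has_L2_fourier_test:
  assumes "has_L2_fourier f g" and \<psi>: "\<psi> \<in> L2" "integrable lebesgue \<psi>"
  shows "L2_inner f (ifourier \<psi>) = L2_inner g \<psi>"
proof -
  from assms obtain F where L: "f \<in> L2" "g \<in> L2" and F: "\<And>n. F n \<in> L2" "\<And>n. integrable lebesgue (F n)"
    and lim: "L2_tendsto F f" "L2_tendsto (\<lambda>n. fourier (F n)) g"
    unfolding has_L2_fourier_def by blast
  note fL = plancherel_le[OF F]
  have eq: "L2_inner (F n) (ifourier \<psi>) = L2_inner (fourier (F n)) \<psi>" for n
    using fourier_multiplication[OF F(2)[of n], of "\<lambda>t. cnj (\<psi> t)"] \<psi>(2)
    by (simp add: L2_inner_def ifourier_cnj)
  have "(\<lambda>n. L2_inner (F n) (ifourier \<psi>)) \<longlonglongrightarrow> L2_inner f (ifourier \<psi>)"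
    using lim by (intro L2_inner_tendsto F L ifourier_in_L2 \<psi>) (simp add: L2_tendsto_iff F L)
  moreover have "(\<lambda>n. L2_inner (fourier (F n)) \<psi>) \<longlonglongrightarrow> L2_inner g \<psi>"
    using lim by (intro L2_inner_tendsto fL F L \<psi>) (simp add: L2_tendsto_iff fL F L)
  ultimately show ?thesis unfolding eq by (rule LIMSEQ_unique)
qed

lemma L2_bounded_support_integrable:
  assumes f: "f \<in> L2" and z: "\<And>x. x \<notin> {a..b} \<Longrightarrow> f x = 0"
  shows "integrable lebesgue f"
proof (rule Bochner_Integration.integrable_bound)
  show "integrable lebesgue (\<lambda>x. indicat_real {a..b} x + (cmod (f x))\<^sup>2)"
    by (intro Bochner_Integration.integrable_add L2_sq_integrable f integrable_real_indicator)
      (auto simp: emeasure_lborel_Icc_eq)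
  show "f \<in> borel_measurable lebesgue" by (rule L2_measurable[OF f])
  have "cmod (f x) \<le> 1 + (cmod (f x))\<^sup>2" for x
    using two_mult_le_squares[of "cmod (f x)" 1] norm_ge_zero[of "f x"]
    unfolding mult_1_right power_one by linarith
  then show "AE x in lebesgue. norm (f x) \<le> norm (indicat_real {a..b} x + (cmod (f x))\<^sup>2)"
    using z by (intro AE_I2) (auto simp: indicator_def)
qed

lemma indicator_interval_L2: "(\<lambda>x. indicator {a..b::real} x :: complex) \<in> L2"
proof (rule L2I)
  show "(\<lambda>x. indicator {a..b::real} x :: complex) \<in> borel_measurable lebesgue"
    by (intro measurable_completion) measurable
  show "integrable lebesgue (\<lambda>x. indicat_real {a..b} x)" by (intro integrable_real_indicator) (auto simp: emeasure_lborel_Icc_eq)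
qed (auto simp: indicator_def)

lemma isCont_indicator_interval:
  fixes a b t :: real
  assumes "t \<noteq> a" "t \<noteq> b" shows "isCont (indicator {a..b} :: real \<Rightarrow> complex) t"
proof -
  have "t \<notin> frontier {a..b}" using assms by (auto simp: frontier_def interior_atLeastAtMost_real split: if_splits)
  then have "isCont (indicat_real {a..b}) t" by (simp add: isCont_indicator)
  then have "isCont (\<lambda>x. complex_of_real (indicat_real {a..b} x)) t" by (intro continuous_of_real)
  moreover have "(\<lambda>x. complex_of_real (indicat_real {a..b} x)) = indicator {a..b}"
    by (auto simp: indicator_def)
  ultimately show ?thesis by simp
qed

text \<open>Both sides are compared on intervals. The transform of an indicator \<open>h\<close>
  need not be integrable, so the test functions are its damped versions \<open>\<psi> n\<close>,
  whose inverse transforms are Gaussian mollifications of \<open>h\<close>. Removing the damping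
  gives \<open>\<langle>f, h\<rangle> = \<langle>g, fourier h\<rangle> = \<langle>ifourier g,
  h\<rangle>\<close>.\<close>

lemma band_limited_inversion:
  assumes fg: "has_L2_fourier f g" and z: "\<And>\<xi>. \<xi> \<notin> {-pi..pi} \<Longrightarrow> g \<xi> = 0"
  shows "AE x in lebesgue. f x = ifourier g x"
proof -
  have L: "f \<in> L2" "g \<in> L2" using fg by (auto simp: has_L2_fourier_def)
  have g1: "integrable lebesgue g" by (rule L2_bounded_support_integrable[OF L(2) z])
  have if2: "ifourier g \<in> L2" by (rule ifourier_in_L2[OF L(2) g1])
  have eq: "(LINT x|lebesgue. f x * indicator {a..b} x) = (LINT x|lebesgue. ifourier g x * indicator {a..b} x)" for a b :: real
  proof -
    define h where "h = (\<lambda>x. indicator {a..b} x :: complex)"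
    have hc: "cnj (h x) = h x" for x by (simp add: h_def indicator_def)
    have h2: "h \<in> L2" unfolding h_def by (rule indicator_interval_L2)
    have h1: "integrable lebesgue h"
      by (rule L2_bounded_support_integrable[OF h2, of a b]) (auto simp: h_def)
    define T where "T = 1 + \<bar>a\<bar> + \<bar>b\<bar>"
    have T: "T \<ge> 1" "{a..b} \<subseteq> {-T..T}" by (auto simp: T_def)
    define \<psi> where "\<psi> = (\<lambda>n \<xi>. fourier h \<xi> * damp (eps n) \<xi>)"
    note fh = plancherel_le[OF h2 h1]
    have \<psi>2: "\<psi> n \<in> L2" for n
      unfolding \<psi>_def
    proof (rule L2I)
      show "(\<lambda>\<xi>. fourier h \<xi> * damp (eps n) \<xi>) \<in> borel_measurable lebesgue"
        using fourier_continuous[OF h1] damp_continuous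
        by (intro continuous_lebesgue_measurable continuous_intros)
      show "integrable lebesgue (\<lambda>\<xi>. (cmod (fourier h \<xi>))\<^sup>2)" by (rule L2_sq_integrable[OF fh(1)])
      show "\<And>x. (cmod (fourier h x * damp (eps n) x))\<^sup>2 \<le> (cmod (fourier h x))\<^sup>2"
        using damp_norm_le by (simp add: norm_mult mult_left_le power_mono)
    qed
    have "integrable lebesgue (\<lambda>\<xi>. damp (eps n) \<xi> * fourier h \<xi>)" for n
      using fourier_norm_le[OF h1]
      by (rule integrable_bounded_mult[OF damp_integrable[OF eps_pos] L2_measurable[OF fh(1)]])
    then have \<psi>1: "integrable lebesgue (\<psi> n)" for n
      by (simp add: \<psi>_def mult.commute)
    have W: "ifourier (\<psi> n) t = (LINT y|lebesgue. h y * complex_of_real (normal_density 0 (eps n) (y - t)))" for n t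
      unfolding \<psi>_def by (rule ifourier_damped_fourier[OF h1 eps_pos])
    have W': "ifourier (\<psi> n) t = complex_of_real (LINT y|lebesgue. indicator {a..b} y * normal_density 0 (eps n) (y - t))" for n t
    proof -
      have "(\<lambda>y. h y * complex_of_real (normal_density 0 (eps n) (y - t)))
          = (\<lambda>y. complex_of_real (indicator {a..b} y * normal_density 0 (eps n) (y - t)))"
        by (auto simp: h_def indicator_def)
      then show ?thesis unfolding W by (simp only: integral_complex_of_real)
    qed
    define C where "C = 1 + 4 * T\<^sup>2 + 16 * T"
    have Wb: "cmod (ifourier (\<psi> n) t) \<le> C / (1 + t\<^sup>2)" for n t
    proof -
      have i: "integrable lebesgue (\<lambda>x. indicator {c..d} x * normal_density 0 (eps n) (x - t))" for c d :: real
        using integrable_mult_indicator[OF _ integrable_normal_density_lebesgue[OF eps_pos[of n]], of "{c..d}" t] by simp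
      have "cmod (ifourier (\<psi> n) t) = (LINT y|lebesgue. indicator {a..b} y * normal_density 0 (eps n) (y - t))"
        unfolding W' norm_of_real by (intro abs_of_nonneg integral_nonneg_AE) auto
      also have "\<dots> \<le> (LINT y|lebesgue. indicator {-T..T} y * normal_density 0 (eps n) (y - t))"
        using T(2) by (intro integral_mono i) (auto simp: indicator_def)
      also have "\<dots> \<le> C / (1 + t\<^sup>2)"
        unfolding C_def by (rule gauss_window_le[OF T(1) eps_pos eps_le_1])
      finally show ?thesis .
    qed
    have C: "C \<ge> 0" using T(1) by (simp add: C_def)
    \<comment> \<open>The uniform majorant of the mollified indicators is itself in
      \<open>L2\<close>, so its product with \<open>f\<close> is an integrable majorant.\<close>
    have w2: "(\<lambda>t. complex_of_real (C / (1 + t\<^sup>2))) \<in> L2"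
    proof (rule L2I)
      show "(\<lambda>t. complex_of_real (C / (1 + t\<^sup>2))) \<in> borel_measurable lebesgue"
        by (intro measurable_completion) measurable
      show "integrable lebesgue (\<lambda>t::real. C\<^sup>2 / (1 + t\<^sup>2))" by (rule integrable_inverse_1_plus_square_lebesgue)
      fix t :: real
      have "1 + t\<^sup>2 \<le> (1 + t\<^sup>2)\<^sup>2" by (intro self_le_power) auto
      then have "C\<^sup>2 / (1 + t\<^sup>2)\<^sup>2 \<le> C\<^sup>2 / (1 + t\<^sup>2)"
        by (intro divide_left_mono) (auto simp: add_pos_nonneg intro!: mult_pos_pos zero_less_power)
      then show "(cmod (complex_of_real (C / (1 + t\<^sup>2))))\<^sup>2 \<le> C\<^sup>2 / (1 + t\<^sup>2)"
        by (simp only: norm_of_real power2_abs power_divide)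
    qed
    have lim1: "(\<lambda>n. L2_inner f (ifourier (\<psi> n))) \<longlonglongrightarrow> L2_inner f h"
      unfolding L2_inner_def
    proof (rule integral_dominated_convergence[where w="\<lambda>t. cmod (f t * complex_of_real (C / (1 + t\<^sup>2)))"])
      show "integrable lebesgue (\<lambda>t. cmod (f t * complex_of_real (C / (1 + t\<^sup>2))))"
        by (intro integrable_norm L2_mult_integrable L w2)
      show "(\<lambda>x. f x * cnj (h x)) \<in> borel_measurable lebesgue"
        using L2_inner_integrable[OF L(1) h2] by auto
      show "(\<lambda>x. f x * cnj (ifourier (\<psi> n) x)) \<in> borel_measurable lebesgue" for n
        using L2_inner_integrable[OF L(1) ifourier_in_L2[OF \<psi>2 \<psi>1]] by auto
      show "AE x in lebesgue. cmod (f x * cnj (ifourier (\<psi> n) x)) \<le> cmod (f x * complex_of_real (C / (1 + x\<^sup>2)))" for n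
      proof (rule AE_I2)
        fix x
        have "C / (1 + x\<^sup>2) \<ge> 0" using C by (intro divide_nonneg_pos) (auto simp: add_pos_nonneg)
        then have "cmod (complex_of_real (C / (1 + x\<^sup>2))) = C / (1 + x\<^sup>2)" by (simp only: norm_of_real abs_of_nonneg)
        then show "cmod (f x * cnj (ifourier (\<psi> n) x)) \<le> cmod (f x * complex_of_real (C / (1 + x\<^sup>2)))"
          unfolding norm_mult complex_mod_cnj using Wb[of n x] by (intro mult_left_mono) auto
      qed
      \<comment> \<open>Convergence of the mollifications is obtained at the continuity points of
        \<open>h\<close>, which leaves out the endpoints.\<close>
      have "{a, b} \<in> null_sets lebesgue" by (intro countable_imp_null_set_lborel[THEN null_sets_completionI]) auto
      from AE_not_in[OF this]
      show "AE x in lebesgue. (\<lambda>n. f x * cnj (ifourier (\<psi> n) x)) \<longlonglongrightarrow> f x * cnj (h x)"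
      proof eventually_elim
        fix t assume "t \<notin> {a, b}"
        then have "isCont h t" unfolding h_def using isCont_indicator_interval[of t a b] by simp
        moreover have "h \<in> borel_measurable borel" unfolding h_def by measurable
        moreover have "cmod (h x) \<le> 1" for x by (simp add: h_def indicator_def)
        ultimately have "(\<lambda>n. ifourier (\<psi> n) t) \<longlonglongrightarrow> h t"
          unfolding W by (intro gauss_approx)
        then show "(\<lambda>n. f t * cnj (ifourier (\<psi> n) t)) \<longlonglongrightarrow> f t * cnj (h t)"
          by (intro tendsto_intros)
      qed
    qed
    have lim2: "(\<lambda>n. L2_inner g (\<psi> n)) \<longlonglongrightarrow> L2_inner g (fourier h)"
      unfolding L2_inner_def
    proof (rule integral_dominated_convergence[where w="\<lambda>t. cmod (g t * cnj (fourier h t))"])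
      show "integrable lebesgue (\<lambda>t. cmod (g t * cnj (fourier h t)))"
        by (intro integrable_norm L2_inner_integrable L fh)
      show "(\<lambda>x. g x * cnj (fourier h x)) \<in> borel_measurable lebesgue"
        using L2_inner_integrable[OF L(2) fh(1)] by auto
      show "(\<lambda>x. g x * cnj (\<psi> n x)) \<in> borel_measurable lebesgue" for n
        using L2_inner_integrable[OF L(2) \<psi>2] by auto
      show "AE x in lebesgue. cmod (g x * cnj (\<psi> n x)) \<le> cmod (g x * cnj (fourier h x))" for n
        using damp_norm_le by (intro AE_I2) (simp add: \<psi>_def norm_mult mult_left_le mult_left_mono)
      show "AE x in lebesgue. (\<lambda>n. g x * cnj (\<psi> n x)) \<longlonglongrightarrow> g x * cnj (fourier h x)"
      proof (rule AE_I2)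
        fix x
        have "(\<lambda>n. g x * cnj (fourier h x * damp (eps n) x)) \<longlonglongrightarrow> g x * cnj (fourier h x * 1)"
          by (intro tendsto_intros damp_tendsto eps_tendsto)
        then show "(\<lambda>n. g x * cnj (\<psi> n x)) \<longlonglongrightarrow> g x * cnj (fourier h x)" by (simp add: \<psi>_def)
      qed
    qed
    have "L2_inner f (ifourier (\<psi> n)) = L2_inner g (\<psi> n)" for n
      by (rule has_L2_fourier_test[OF fg \<psi>2 \<psi>1])
    with lim1 lim2 have "L2_inner f h = L2_inner g (fourier h)" by (simp add: LIMSEQ_unique)
    also have "\<dots> = L2_inner (ifourier g) h"
      unfolding L2_inner_def by (rule ifourier_inner[OF h1 g1, symmetric])
    finally show ?thesis unfolding L2_inner_def hc by (simp add: h_def)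
  qed
  have "AE x in lebesgue. f x - ifourier g x = 0"
  proof (rule AE_eq_0_if_interval_integrals_0)
    fix a b :: real
    have i: "integrable lebesgue (\<lambda>x. f x * indicator {a..b} x)" "integrable lebesgue (\<lambda>x. ifourier g x * indicator {a..b} x)"
      by (intro L2_mult_integrable L if2 indicator_interval_L2)+
    have e: "(\<lambda>x. indicator {a..b} x * (f x - ifourier g x)) = (\<lambda>x. f x * indicator {a..b} x - ifourier g x * indicator {a..b} x)"
      by (auto simp: algebra_simps)
    show "integrable lebesgue (\<lambda>x. indicator {a..b} x * (f x - ifourier g x))"
      unfolding e using i by auto
    show "(LINT x|lebesgue. indicator {a..b} x * (f x - ifourier g x)) = 0"
      unfolding e using i eq[of a b] by simp
  qed
  then show ?thesis by eventually_elim simp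
qed

text \<open>What later arguments use about an element of \<open>PW\<close>. The transform is
  normalised to vanish everywhere off the band, while \<open>f\<close> is recovered from it only
  almost everywhere.\<close>

definition spectral :: "(real \<Rightarrow> complex) \<Rightarrow> (real \<Rightarrow> complex) \<Rightarrow> bool" where
  "spectral f g \<longleftrightarrow> f \<in> L2 \<and> g \<in> L2 \<and> (\<forall>\<xi>. \<xi> \<notin> {-pi..pi} \<longrightarrow> g \<xi> = 0) \<and> L2_sq g \<le> L2_sq f \<and>
     (AE x in lebesgue. f x = ifourier g x)"

lemma L2_AE_cong:
  assumes "f \<in> L2" "g \<in> borel_measurable lebesgue" "AE x in lebesgue. f x = g x"
  shows "g \<in> L2" "L2_sq g = L2_sq f"
proof -
  have m: "(\<lambda>x. (cmod (g x))\<^sup>2) \<in> borel_measurable lebesgue" "(\<lambda>x. (cmod (f x))\<^sup>2) \<in> borel_measurable lebesgue"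
    using assms(2) L2_measurable[OF assms(1)] by auto
  have ae: "AE x in lebesgue. (cmod (g x))\<^sup>2 = (cmod (f x))\<^sup>2" using assms(3) by eventually_elim simp
  show "g \<in> L2"
    using integrable_cong_AE[OF m ae] assms(2) L2_sq_integrable[OF assms(1)] by (simp add: L2_def)
  show "L2_sq g = L2_sq f" unfolding L2_sq_def by (rule integral_cong_AE[OF m ae])
qed

lemma L2_tendsto_AE_cong:
  assumes "AE x in lebesgue. f x = g x" "L2_tendsto F f" shows "L2_tendsto F g"
proof -
  have "(\<integral>\<^sup>+ x. ennreal ((cmod (F n x - f x))\<^sup>2) \<partial>lebesgue) = (\<integral>\<^sup>+ x. ennreal ((cmod (F n x - g x))\<^sup>2) \<partial>lebesgue)" for n
    by (rule nn_integral_cong_AE) (use assms(1) in eventually_elim, simp)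
  then show ?thesis using assms(2) by (simp add: L2_tendsto_def)
qed

lemma PW_spectral:
  assumes "f \<in> PW" obtains g where "spectral f g"
proof -
  obtain g0 where g0: "has_L2_fourier f g0" "AE \<xi> in lebesgue. \<xi> \<notin> {-pi..pi} \<longrightarrow> g0 \<xi> = 0"
    using assms by (auto simp: PW_def)
  define g where "g = (\<lambda>\<xi>. indicator {-pi..pi} \<xi> * g0 \<xi>)"
  have L: "f \<in> L2" "g0 \<in> L2" using g0 by (auto simp: has_L2_fourier_def)
  have g2: "g \<in> L2" unfolding g_def by (rule L2_restrict[OF L(2)]) simp
  have ae: "AE \<xi> in lebesgue. g0 \<xi> = g \<xi>"
    using g0(2) by eventually_elim (auto simp: g_def indicator_def)
  have fg: "has_L2_fourier f g"
    using g0(1) g2 L2_tendsto_AE_cong[OF ae] unfolding has_L2_fourier_def by blast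
  have z: "\<And>\<xi>. \<xi> \<notin> {-pi..pi} \<Longrightarrow> g \<xi> = 0" by (simp add: g_def)
  have "spectral f g"
    unfolding spectral_def using L g2 z has_L2_fourier_sq_le[OF fg] band_limited_inversion[OF fg z] by blast
  then show ?thesis by (rule that)
qed

section \<open>Membership in the Paley--Wiener space\<close>

lemma L2_tendsto_add:
  assumes "\<And>n. F n \<in> L2" "f \<in> L2" "\<And>n. G n \<in> L2" "g \<in> L2" "L2_tendsto F f" "L2_tendsto G g"
  shows "L2_tendsto (\<lambda>n x. F n x + G n x) (\<lambda>x. f x + g x)"
proof -
  have le: "L2_sq (\<lambda>x. (F n x + G n x) - (f x + g x)) \<le> 2 * L2_sq (\<lambda>x. F n x - f x) + 2 * L2_sq (\<lambda>x. G n x - g x)" for n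
  proof -
    have "L2_sq (\<lambda>x. (F n x + G n x) - (f x + g x)) = (LINT x|lebesgue. (cmod ((F n x - f x) + (G n x - g x)))\<^sup>2)"
      unfolding L2_sq_def by (simp add: algebra_simps)
    also have "\<dots> \<le> (LINT x|lebesgue. 2 * (cmod (F n x - f x))\<^sup>2 + 2 * (cmod (G n x - g x))\<^sup>2)"
    proof (intro integral_mono)
      show "integrable lebesgue (\<lambda>x. (cmod ((F n x - f x) + (G n x - g x)))\<^sup>2)"
        by (intro L2_sq_integrable L2_add L2_diff assms)
      show "integrable lebesgue (\<lambda>x. 2 * (cmod (F n x - f x))\<^sup>2 + 2 * (cmod (G n x - g x))\<^sup>2)"
        by (intro Bochner_Integration.integrable_add integrable_mult_right L2_sq_integrable L2_diff assms)
    qed (rule norm_add_power2_le)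
    also have "\<dots> = 2 * L2_sq (\<lambda>x. F n x - f x) + 2 * L2_sq (\<lambda>x. G n x - g x)"
      unfolding L2_sq_def using L2_sq_integrable[OF L2_diff[OF assms(1) assms(2)]] L2_sq_integrable[OF L2_diff[OF assms(3) assms(4)]]
      by simp
    finally show ?thesis .
  qed
  have lim: "(\<lambda>n. L2_sq (\<lambda>x. F n x - f x)) \<longlonglongrightarrow> 0" "(\<lambda>n. L2_sq (\<lambda>x. G n x - g x)) \<longlonglongrightarrow> 0"
    using assms by (simp_all add: L2_tendsto_iff)
  have "(\<lambda>n. 2 * L2_sq (\<lambda>x. F n x - f x) + 2 * L2_sq (\<lambda>x. G n x - g x)) \<longlonglongrightarrow> 2 * 0 + 2 * 0"
    by (intro tendsto_intros lim)
  then have "(\<lambda>n. 2 * L2_sq (\<lambda>x. F n x - f x) + 2 * L2_sq (\<lambda>x. G n x - g x)) \<longlonglongrightarrow> 0"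
    by simp
  then have "(\<lambda>n. L2_sq (\<lambda>x. (F n x + G n x) - (f x + g x))) \<longlonglongrightarrow> 0"
    by (rule tendsto_sandwich[OF always_eventually always_eventually tendsto_const, rotated 2])
      (auto simp: L2_sq_nonneg le)
  then show ?thesis by (subst L2_tendsto_iff) (auto intro: L2_add assms)
qed

lemma L2_tendsto_scale:
  assumes "\<And>n. F n \<in> L2" "f \<in> L2" "L2_tendsto F f"
  shows "L2_tendsto (\<lambda>n x. c * F n x) (\<lambda>x. c * f x)"
proof -
  have "(\<lambda>n. L2_sq (\<lambda>x. F n x - f x)) \<longlonglongrightarrow> 0" using assms by (simp add: L2_tendsto_iff)
  then have "(\<lambda>n. (cmod c)\<^sup>2 * L2_sq (\<lambda>x. F n x - f x)) \<longlonglongrightarrow> (cmod c)\<^sup>2 * 0" by (intro tendsto_intros)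
  moreover have "(cmod c)\<^sup>2 * L2_sq (\<lambda>x. F n x - f x) = L2_sq (\<lambda>x. c * F n x - c * f x)" for n
    unfolding L2_sq_scale[symmetric] by (simp add: right_diff_distrib)
  ultimately show ?thesis by (subst L2_tendsto_iff) (auto intro: L2_scale assms)
qed

lemma has_L2_fourier_add:
  assumes "has_L2_fourier f1 g1" "has_L2_fourier f2 g2"
  shows "has_L2_fourier (\<lambda>x. f1 x + f2 x) (\<lambda>x. g1 x + g2 x)"
proof -
  obtain F1 where L1: "f1 \<in> L2" "g1 \<in> L2" and F1: "\<And>n. F1 n \<in> L2" "\<And>n. integrable lebesgue (F1 n)"
    and lim1: "L2_tendsto F1 f1" "L2_tendsto (\<lambda>n. fourier (F1 n)) g1"
    using assms(1) unfolding has_L2_fourier_def by blast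
  obtain F2 where L2': "f2 \<in> L2" "g2 \<in> L2" and F2: "\<And>n. F2 n \<in> L2" "\<And>n. integrable lebesgue (F2 n)"
    and lim2: "L2_tendsto F2 f2" "L2_tendsto (\<lambda>n. fourier (F2 n)) g2"
    using assms(2) unfolding has_L2_fourier_def by blast
  have "(\<lambda>n. fourier (\<lambda>x. F1 n x + F2 n x)) = (\<lambda>n x. fourier (F1 n) x + fourier (F2 n) x)"
    using F1 F2 by (simp add: fourier_add fun_eq_iff)
  moreover have "L2_tendsto (\<lambda>n x. fourier (F1 n) x + fourier (F2 n) x) (\<lambda>x. g1 x + g2 x)"
    by (intro L2_tendsto_add plancherel_le F1 F2 L1 L2' lim1 lim2)
  moreover have "L2_tendsto (\<lambda>n x. F1 n x + F2 n x) (\<lambda>x. f1 x + f2 x)"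
    by (intro L2_tendsto_add F1 F2 L1 L2' lim1 lim2)
  ultimately show ?thesis
    unfolding has_L2_fourier_def using L1 L2' F1 F2
    by (intro conjI exI[of _ "\<lambda>n x. F1 n x + F2 n x"]) (auto intro: L2_add)
qed

lemma has_L2_fourier_scale:
  assumes "has_L2_fourier f g" shows "has_L2_fourier (\<lambda>x. c * f x) (\<lambda>x. c * g x)"
proof -
  obtain F where L: "f \<in> L2" "g \<in> L2" and F: "\<And>n. F n \<in> L2" "\<And>n. integrable lebesgue (F n)"
    and lim: "L2_tendsto F f" "L2_tendsto (\<lambda>n. fourier (F n)) g"
    using assms unfolding has_L2_fourier_def by blast
  have "(\<lambda>n. fourier (\<lambda>x. c * F n x)) = (\<lambda>n x. c * fourier (F n) x)" by (simp add: fourier_scale fun_eq_iff)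
  moreover have "L2_tendsto (\<lambda>n x. c * fourier (F n) x) (\<lambda>x. c * g x)"
    by (intro L2_tendsto_scale plancherel_le F L lim)
  moreover have "L2_tendsto (\<lambda>n x. c * F n x) (\<lambda>x. c * f x)"
    by (intro L2_tendsto_scale F L lim)
  ultimately show ?thesis
    unfolding has_L2_fourier_def using L F
    by (intro conjI exI[of _ "\<lambda>n x. c * F n x"]) (auto intro: L2_scale)
qed

lemma PW_subset_L2: "PW \<subseteq> L2" by (auto simp: PW_def)

lemma has_L2_fourier_zero: "has_L2_fourier (\<lambda>x. 0) (\<lambda>x. 0)"
  unfolding has_L2_fourier_def
  by (intro conjI exI[of _ "\<lambda>n x. 0"]) (auto simp: L2_zero L2_tendsto_def fourier_def)

lemma PW_subspace: "L2_subspace PW"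
  unfolding L2_subspace_def
proof (intro conjI ballI allI PW_subset_L2)
  show "(\<lambda>x. 0) \<in> PW" using has_L2_fourier_zero by (auto simp: PW_def L2_zero)
next
  fix f1 f2 assume f: "f1 \<in> PW" "f2 \<in> PW"
  then obtain g1 g2 where g: "has_L2_fourier f1 g1" "has_L2_fourier f2 g2"
    and ae: "AE \<xi> in lebesgue. \<xi> \<notin> {-pi..pi} \<longrightarrow> g1 \<xi> = 0" "AE \<xi> in lebesgue. \<xi> \<notin> {-pi..pi} \<longrightarrow> g2 \<xi> = 0"
    unfolding PW_def by blast
  have "AE \<xi> in lebesgue. \<xi> \<notin> {-pi..pi} \<longrightarrow> g1 \<xi> + g2 \<xi> = 0"
    using ae by eventually_elim auto
  then show "(\<lambda>x. f1 x + f2 x) \<in> PW"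
    using has_L2_fourier_add[OF g] f L2_add[of f1 f2] unfolding PW_def by blast
next
  fix c f assume f: "f \<in> PW"
  then obtain g where g: "has_L2_fourier f g" and ae: "AE \<xi> in lebesgue. \<xi> \<notin> {-pi..pi} \<longrightarrow> g \<xi> = 0"
    unfolding PW_def by blast
  have "AE \<xi> in lebesgue. \<xi> \<notin> {-pi..pi} \<longrightarrow> c * g \<xi> = 0"
    using ae by eventually_elim auto
  then show "(\<lambda>x. c * f x) \<in> PW"
    using has_L2_fourier_scale[OF g, of c] f L2_scale[of f c] unfolding PW_def by blast
qed

text \<open>The conjugate of \<open>ifourier_damped_fourier\<close>.\<close>

lemma fourier_damped_ifourier:
  assumes g: "integrable lebesgue g" and e: "\<epsilon> > 0"
  shows "fourier (\<lambda>x. ifourier g x * damp \<epsilon> x) \<eta>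
    = (LINT y|lebesgue. g y * complex_of_real (normal_density 0 \<epsilon> (y - \<eta>)))"
proof -
  have "ifourier (\<lambda>x. fourier (\<lambda>t. cnj (g t)) x * damp \<epsilon> x) \<eta>
      = (LINT y|lebesgue. cnj (g y) * complex_of_real (normal_density 0 \<epsilon> (y - \<eta>)))"
    using g e by (intro ifourier_damped_fourier) auto
  moreover have "(\<lambda>x. fourier (\<lambda>t. cnj (g t)) x * damp \<epsilon> x) = (\<lambda>x. cnj (ifourier g x * damp \<epsilon> x))"
    by (simp add: ifourier_cnj damp_def)
  ultimately have "cnj (fourier (\<lambda>x. ifourier g x * damp \<epsilon> x) \<eta>)
      = cnj (LINT y|lebesgue. g y * complex_of_real (normal_density 0 \<epsilon> (y - \<eta>)))"
    by (simp add: fourier_cnj flip: Bochner_Integration.integral_cnj)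
  then show ?thesis by (metis complex_cnj_cnj)
qed

text \<open>For a band-limited \<open>h\<close> that need not be integrable, the multiples \<open>h(x) exp (- \<epsilon>\<^sup>2 x\<^sup>2 / 2)\<close>
  are admissible approximants: their transforms are Gaussian mollifications of \<open>g\<close>.\<close>

locale band_limited =
  fixes c :: "real \<Rightarrow> complex" and g h :: "real \<Rightarrow> complex" and C :: real
  assumes c: "continuous_on UNIV c"
    and g_def: "g = (\<lambda>\<xi>. indicator {-pi..pi} \<xi> * c \<xi>)"
    and h_def: "h = ifourier g"
    and decay: "\<And>x. (cmod (h x))\<^sup>2 \<le> C / (1 + x\<^sup>2)"
begin

definition M :: real where "M = (SOME M. M \<ge> 0 \<and> (\<forall>x. cmod (g x) \<le> M))"

lemma M: "M \<ge> 0" "cmod (g x) \<le> M"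
proof -
  have "compact (c ` {-pi..pi})" using c by (intro compact_continuous_image continuous_on_subset[OF c]) auto
  then obtain B where B: "\<And>x. x \<in> {-pi..pi} \<Longrightarrow> cmod (c x) \<le> B"
    using compact_imp_bounded bounded_iff by (metis imageI)
  have "\<bar>B\<bar> \<ge> 0 \<and> (\<forall>x. cmod (g x) \<le> \<bar>B\<bar>)"
    using B by (auto simp: g_def indicator_def intro: order_trans[OF _ abs_ge_self])
  then have "M \<ge> 0 \<and> (\<forall>x. cmod (g x) \<le> M)" unfolding M_def by (rule someI)
  then show "M \<ge> 0" "cmod (g x) \<le> M" by auto
qed

lemma g_borel: "g \<in> borel_measurable borel"
  unfolding g_def using borel_measurable_continuous_onI[OF c] by measurable

lemma g_L2: "g \<in> L2"
proof (rule L2I)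
  show "g \<in> borel_measurable lebesgue" using g_borel by (intro measurable_completion) simp
  show "integrable lebesgue (\<lambda>x. M\<^sup>2 * indicat_real {-pi..pi} x)"
    by (intro integrable_mult_right integrable_real_indicator) (auto simp: emeasure_lborel_Icc_eq)
  show "(cmod (g x))\<^sup>2 \<le> M\<^sup>2 * indicat_real {-pi..pi} x" for x
    using M(2)[of x] power_mono[OF M(2)[of x], of 2] by (auto simp: indicator_def g_def)
qed

lemma g_zero: "\<xi> \<notin> {-pi..pi} \<Longrightarrow> g \<xi> = 0" by (simp add: g_def)

lemma g_integrable: "integrable lebesgue g"
  using g_L2 g_zero by (rule L2_bounded_support_integrable)

lemma h_continuous: "continuous_on UNIV h"
proof -
  have "continuous_on UNIV (\<lambda>x. fourier g (- x))"
    by (rule continuous_on_compose2[OF fourier_continuous[OF g_integrable]]) (auto intro: continuous_intros)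
  then show ?thesis by (simp add: h_def ifourier_def[abs_def])
qed

lemma h_measurable: "h \<in> borel_measurable lebesgue"
  by (rule continuous_lebesgue_measurable[OF h_continuous])

lemma h_L2: "h \<in> L2"
  by (rule L2I[OF h_measurable integrable_inverse_1_plus_square_lebesgue decay])

definition H :: "nat \<Rightarrow> real \<Rightarrow> complex" where "H n x = h x * damp (eps n) x"

lemma H_measurable: "H n \<in> borel_measurable lebesgue"
  unfolding H_def[abs_def] using h_continuous damp_continuous
  by (intro continuous_lebesgue_measurable continuous_intros)

lemma H_le: "cmod (H n x) \<le> cmod (h x)"
  using damp_norm_le by (simp add: H_def norm_mult mult_left_le)

lemma H_L2: "H n \<in> L2"
  using power_mono[OF H_le, where n=2] by (intro L2I[OF H_measurable L2_sq_integrable[OF h_L2]]) auto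

lemma H_integrable: "integrable lebesgue (H n)"
proof -
  have "cmod (h x) \<le> (LINT t|lebesgue. cmod (g t)) / sqrt (2 * pi)" for x
    unfolding h_def ifourier_def by (rule fourier_norm_le[OF g_integrable])
  then have "integrable lebesgue (\<lambda>x. damp (eps n) x * h x)"
    by (rule integrable_bounded_mult[OF damp_integrable[OF eps_pos] h_measurable])
  then show ?thesis by (simp add: H_def[abs_def] mult.commute)
qed

lemma H_tendsto: "L2_tendsto H h"
  unfolding L2_tendsto_iff[OF H_L2 h_L2] L2_sq_def
proof -
  have "(\<lambda>n. LINT x|lebesgue. (cmod (H n x - h x))\<^sup>2) \<longlonglongrightarrow> (LINT x|(lebesgue :: real measure). 0)"
  proof (rule integral_dominated_convergence[where w="\<lambda>x. 4 * (cmod (h x))\<^sup>2"])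
    show "integrable lebesgue (\<lambda>x. 4 * (cmod (h x))\<^sup>2)" by (intro integrable_mult_right L2_sq_integrable h_L2)
    show "(\<lambda>x. (cmod (H n x - h x))\<^sup>2) \<in> borel_measurable lebesgue" for n
      using L2_sq_integrable[OF L2_diff[OF H_L2 h_L2]] by auto
    show "AE x in lebesgue. norm ((cmod (H n x - h x))\<^sup>2) \<le> 4 * (cmod (h x))\<^sup>2" for n
    proof (rule AE_I2)
      fix x
      have "cmod (H n x - h x) \<le> 2 * cmod (h x)"
        using norm_triangle_ineq4[of "H n x" "h x"] H_le[of n x] by simp
      then show "norm ((cmod (H n x - h x))\<^sup>2) \<le> 4 * (cmod (h x))\<^sup>2"
        using power_mono[of "cmod (H n x - h x)" "2 * cmod (h x)" 2] by (simp add: power_mult_distrib)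
    qed
    show "AE x in lebesgue. (\<lambda>n. (cmod (H n x - h x))\<^sup>2) \<longlonglongrightarrow> 0"
    proof (rule AE_I2)
      fix x
      have "(\<lambda>n. (cmod (h x * damp (eps n) x - h x))\<^sup>2) \<longlonglongrightarrow> (cmod (h x * 1 - h x))\<^sup>2"
        by (intro tendsto_intros damp_tendsto eps_tendsto)
      then show "(\<lambda>n. (cmod (H n x - h x))\<^sup>2) \<longlonglongrightarrow> 0" by (simp add: H_def)
    qed
  qed auto
  then show "(\<lambda>n. LINT x|lebesgue. (cmod (H n x - h x))\<^sup>2) \<longlonglongrightarrow> 0" by simp
qed

lemma fourier_H: "fourier (H n) \<eta> = (LINT y|lebesgue. g y * complex_of_real (normal_density 0 (eps n) (y - \<eta>)))"
proof -
  have "H n = (\<lambda>x. h x * damp (eps n) x)" by (intro ext H_def)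
  then have "H n = (\<lambda>x. ifourier g x * damp (eps n) x)" by (simp only: h_def)
  then show ?thesis by (simp only: fourier_damped_ifourier[OF g_integrable eps_pos])
qed

lemma fourier_H_le: "cmod (fourier (H n) \<eta>) \<le> M * ((1 + 4 * pi\<^sup>2 + 16 * pi) / (1 + \<eta>\<^sup>2))"
proof -
  let ?N = "\<lambda>y. normal_density 0 (eps n) (y - \<eta>)"
  have "cmod (fourier (H n) \<eta>) \<le> (LINT y|lebesgue. cmod (g y * complex_of_real (?N y)))"
    unfolding fourier_H by (rule integral_norm_bound)
  also have "\<dots> \<le> (LINT y|lebesgue. M * (indicator {-pi..pi} y * ?N y))"
  proof (rule integral_mono')
    show "integrable lebesgue (\<lambda>y. M * (indicator {-pi..pi} y * ?N y))"
      using integrable_mult_indicator[OF _ integrable_normal_density_lebesgue[OF eps_pos[of n]], of "{-pi..pi}" \<eta>]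
      by (intro integrable_mult_right) simp
    show "cmod (g y * complex_of_real (?N y)) \<le> M * (indicator {-pi..pi} y * ?N y)" for y
      using M(2)[of y] g_zero[of y] by (auto simp: norm_mult indicator_def intro!: mult_right_mono)
    show "0 \<le> M * (indicator {-pi..pi} y * ?N y)" for y
      using M(1) by (intro mult_nonneg_nonneg) auto
  qed
  also have "\<dots> = M * (LINT y|lebesgue. indicator {-pi..pi} y * ?N y)" by simp
  also have "\<dots> \<le> M * ((1 + 4 * pi\<^sup>2 + 16 * pi) / (1 + \<eta>\<^sup>2))"
    using M(1) pi_gt3 eps_pos eps_le_1 by (intro mult_left_mono gauss_window_le) auto
  finally show ?thesis .
qed

text \<open>Dominated convergence: the mollifications of \<open>g\<close> and \<open>g\<close>
  itself share the majorant \<open>D / (1 + \<eta>\<^sup>2)\<close>, which comes from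
  \<open>gauss_window_le\<close> with \<open>T = pi\<close>.\<close>

lemma fourier_H_tendsto: "L2_tendsto (\<lambda>n. fourier (H n)) g"
proof -
  note fH = plancherel_le(1)[OF H_L2 H_integrable]
  define D where "D = M * (1 + 4 * pi\<^sup>2 + 16 * pi)"
  have D: "D \<ge> 0" using M(1) by (auto simp: D_def intro!: mult_nonneg_nonneg add_nonneg_nonneg)
  have f1: "cmod (fourier (H n) \<eta>) \<le> D / (1 + \<eta>\<^sup>2)" for n \<eta>
    using fourier_H_le[of n \<eta>] by (simp add: D_def)
  have g1: "cmod (g \<eta>) \<le> D / (1 + \<eta>\<^sup>2)" for \<eta>
  proof (cases "\<eta> \<in> {-pi..pi}")
    case True
    then have "\<eta>\<^sup>2 \<le> pi\<^sup>2" by (intro power2_le_iff_abs_le[THEN iffD2]) auto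
    then have "1 + \<eta>\<^sup>2 \<le> 1 + 4 * pi\<^sup>2 + 16 * pi" using zero_le_power2[of pi] pi_gt3 by linarith
    then have "M * (1 + \<eta>\<^sup>2) \<le> D" unfolding D_def using M(1) by (rule mult_left_mono)
    then have "M \<le> D / (1 + \<eta>\<^sup>2)" by (simp add: pos_le_divide_eq add_pos_nonneg)
    then show ?thesis using M(2)[of \<eta>] by simp
  next
    case False
    then show ?thesis using g_zero[of \<eta>] D by (simp add: add_nonneg_nonneg)
  qed
  have bd: "(cmod (fourier (H n) \<eta> - g \<eta>))\<^sup>2 \<le> 4 * D\<^sup>2 / (1 + \<eta>\<^sup>2)" for n \<eta>
  proof -
    have "cmod (fourier (H n) \<eta> - g \<eta>) \<le> 2 * (D / (1 + \<eta>\<^sup>2))"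
      using norm_triangle_ineq4[of "fourier (H n) \<eta>" "g \<eta>"] f1[of n \<eta>] g1[of \<eta>] by simp
    then have "(cmod (fourier (H n) \<eta> - g \<eta>))\<^sup>2 \<le> (2 * (D / (1 + \<eta>\<^sup>2)))\<^sup>2" by (intro power_mono) auto
    also have "\<dots> = 4 * D\<^sup>2 / (1 + \<eta>\<^sup>2)\<^sup>2" by (simp add: power_divide power_mult_distrib)
    also have "\<dots> \<le> 4 * D\<^sup>2 / (1 + \<eta>\<^sup>2)"
    proof -
      have "1 + \<eta>\<^sup>2 \<le> (1 + \<eta>\<^sup>2)\<^sup>2" by (intro self_le_power) auto
      then show ?thesis by (intro divide_left_mono) (auto simp: add_pos_nonneg intro!: mult_pos_pos zero_less_power)
    qed
    finally show ?thesis .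
  qed
  have "(\<lambda>n. LINT x|lebesgue. (cmod (fourier (H n) x - g x))\<^sup>2) \<longlonglongrightarrow> (LINT x|(lebesgue :: real measure). 0)"
  proof (rule integral_dominated_convergence[where w="\<lambda>x. 4 * D\<^sup>2 / (1 + x\<^sup>2)"])
    show "integrable lebesgue (\<lambda>x. 4 * D\<^sup>2 / (1 + x\<^sup>2))" by (rule integrable_inverse_1_plus_square_lebesgue)
    show "(\<lambda>x. (cmod (fourier (H n) x - g x))\<^sup>2) \<in> borel_measurable lebesgue" for n
      using L2_sq_integrable[OF L2_diff[OF fH g_L2]] by auto
    show "AE x in lebesgue. norm ((cmod (fourier (H n) x - g x))\<^sup>2) \<le> 4 * D\<^sup>2 / (1 + x\<^sup>2)" for n
      using bd by simp
    \<comment> \<open>The cut-off may jump at the ends of the band; elsewhere \<open>g\<close> is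
      continuous because \<open>c\<close> is.\<close>
    have "{-pi, pi} \<in> null_sets lebesgue" by (intro countable_imp_null_set_lborel[THEN null_sets_completionI]) auto
    from AE_not_in[OF this]
    show "AE x in lebesgue. (\<lambda>n. (cmod (fourier (H n) x - g x))\<^sup>2) \<longlonglongrightarrow> 0"
    proof eventually_elim
      fix x assume x: "x \<notin> {-pi, pi}"
      have "isCont c x" using c by (simp add: continuous_on_eq_continuous_at)
      then have "isCont g x" unfolding g_def
        using isCont_indicator_interval[of x "-pi" pi] x by (intro continuous_intros) auto
      then have "(\<lambda>n. fourier (H n) x) \<longlonglongrightarrow> g x"
        unfolding fourier_H by (rule gauss_approx[OF g_borel M(2)])
      then have "(\<lambda>n. (cmod (fourier (H n) x - g x))\<^sup>2) \<longlonglongrightarrow> (cmod (g x - g x))\<^sup>2" by (intro tendsto_intros)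
      then show "(\<lambda>n. (cmod (fourier (H n) x - g x))\<^sup>2) \<longlonglongrightarrow> 0" by simp
    qed
  qed auto
  then show ?thesis by (subst L2_tendsto_iff) (auto simp: fH g_L2 L2_sq_def)
qed

lemma in_PW: "h \<in> PW"
proof -
  have "has_L2_fourier h g"
    unfolding has_L2_fourier_def using h_L2 g_L2 H_L2 H_integrable H_tendsto fourier_H_tendsto by blast
  then show ?thesis using h_L2 g_zero by (auto simp: PW_def)
qed

text \<open>The function \<open>h\<close> may fail to be integrable, so
  \<open>ifourier_inner\<close> is applied to the approximants \<open>H n\<close>, and both sides
  converge in \<open>L2\<close>.\<close>

lemma parseval:
  assumes f: "f \<in> L2" "k \<in> L2" "\<And>\<xi>. \<xi> \<notin> {-pi..pi} \<Longrightarrow> k \<xi> = 0" "AE x in lebesgue. f x = ifourier k x"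
  shows "L2_inner f h = L2_inner k g"
proof -
  note fH = plancherel_le(1)[OF H_L2 H_integrable]
  have k1: "integrable lebesgue k" using f(2,3) by (rule L2_bounded_support_integrable)
  have eq: "L2_inner f (H n) = L2_inner k (fourier (H n))" for n
  proof -
    have "L2_inner f (H n) = L2_inner (ifourier k) (H n)"
      unfolding L2_inner_def
    proof (rule integral_cong_AE)
      show "(\<lambda>x. f x * cnj (H n x)) \<in> borel_measurable lebesgue"
        using L2_inner_integrable[OF f(1) H_L2] by auto
      show "(\<lambda>x. ifourier k x * cnj (H n x)) \<in> borel_measurable lebesgue"
        using L2_inner_integrable[OF ifourier_in_L2[OF f(2) k1] H_L2] by auto
      show "AE x in lebesgue. f x * cnj (H n x) = ifourier k x * cnj (H n x)"
        using f(4) by eventually_elim simp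
    qed
    also have "\<dots> = L2_inner k (fourier (H n))"
      unfolding L2_inner_def by (rule ifourier_inner[OF H_integrable k1])
    finally show ?thesis .
  qed
  have "(\<lambda>n. L2_inner f (H n)) \<longlonglongrightarrow> L2_inner f h"
    using H_tendsto by (intro L2_inner_tendsto_right f H_L2 h_L2) (simp add: L2_tendsto_iff H_L2 h_L2)
  moreover have "(\<lambda>n. L2_inner k (fourier (H n))) \<longlonglongrightarrow> L2_inner k g"
    using fourier_H_tendsto by (intro L2_inner_tendsto_right f fH g_L2) (simp add: L2_tendsto_iff fH g_L2)
  ultimately show ?thesis unfolding eq by (rule LIMSEQ_unique)
qed

end

section \<open>The sinc kernel and the projection onto the Paley--Wiener space\<close>

text \<open>The reproducing kernel \<open>sin (pi * u) / (pi * u)\<close> of \<open>PW\<close>, with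
  value 1 at 0. As a transform of the band indicator it needs no case distinction, and this is the
  form in which the multiplication formula produces it.\<close>

definition sinc_kernel :: "real \<Rightarrow> complex" where
  "sinc_kernel u = fourier (indicator {-pi..pi}) u / complex_of_real (sqrt (2 * pi))"

lemma sinc_kernel_eq: "sinc_kernel u = (LINT t|lebesgue. indicator {-pi..pi} t * exp (- (\<i> * complex_of_real u * complex_of_real t))) / complex_of_real (2 * pi)"
proof -
  have "complex_of_real (sqrt (2 * pi)) * complex_of_real (sqrt (2 * pi)) = complex_of_real (2 * pi)"
    unfolding of_real_mult[symmetric] by simp
  then have "a / complex_of_real (sqrt (2 * pi)) / complex_of_real (sqrt (2 * pi)) = a / complex_of_real (2 * pi)" for a
    by (metis divide_divide_eq_left)
  then show ?thesis unfolding sinc_kernel_def fourier_def by (simp add: of_real_divide del: of_real_mult)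
qed

lemma indicator_pi_integrable: "integrable lebesgue (indicator {-pi..pi} :: real \<Rightarrow> complex)"
  by (rule L2_bounded_support_integrable[where a="-pi" and b=pi])
    (use indicator_interval_L2[of "-pi" pi] in simp_all)

lemma integral_indicator_pi: "(LINT x|lebesgue. indicat_real {-pi..pi} x) = 2 * pi"
  by simp

lemma sinc_kernel_le_1: "cmod (sinc_kernel u) \<le> 1"
proof -
  have "cmod (fourier (indicator {-pi..pi}) u) \<le> (LINT t|lebesgue. cmod (indicator {-pi..pi} t)) / sqrt (2 * pi)"
    by (rule fourier_norm_le[OF indicator_pi_integrable])
  also have "(LINT t|lebesgue. cmod (indicator {-pi..pi} t)) = 2 * pi"
  proof -
    have "cmod (indicator {-pi..pi} t) = indicat_real {-pi..pi} t" for t :: real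
      by (simp add: indicator_def)
    then show ?thesis by (simp only: integral_indicator_pi)
  qed
  also have "2 * pi / sqrt (2 * pi) = sqrt (2 * pi)" by (simp add: real_div_sqrt)
  finally show ?thesis by (simp add: sinc_kernel_def norm_divide)
qed

lemma sinc_kernel_0: "sinc_kernel 0 = 1"
proof -
  have "(LINT t|lebesgue. indicator {-pi..pi} t * exp (- (\<i> * complex_of_real 0 * complex_of_real t)))
      = (LINT t|lebesgue. complex_of_real (indicat_real {-pi..pi} t))"
    by (intro Bochner_Integration.integral_cong) (auto simp: indicator_def)
  also have "\<dots> = complex_of_real (2 * pi)" unfolding integral_complex_of_real integral_indicator_pi ..
  finally show ?thesis by (simp add: sinc_kernel_eq)
qed

lemma sinc_kernel_sin:
  assumes "u \<noteq> 0" shows "sinc_kernel u = complex_of_real (sin (pi * u) / (pi * u))"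
proof -
  let ?F = "\<lambda>t::real. exp (- (\<i> * complex_of_real u * complex_of_real t)) / (- (\<i> * complex_of_real u))"
  have "(LINT t|lebesgue. indicator {-pi..pi} t * exp (- (\<i> * complex_of_real u * complex_of_real t)))
      = (LINT t|lborel. indicat_real {-pi..pi} t *\<^sub>R exp (- (\<i> * complex_of_real u * complex_of_real t)))"
  proof -
    have "indicator {-pi..pi} t * exp (- (\<i> * complex_of_real u * complex_of_real t))
        = indicat_real {-pi..pi} t *\<^sub>R exp (- (\<i> * complex_of_real u * complex_of_real t))" for t
      by (simp add: indicator_def)
    then show ?thesis
      by (simp only:) (intro integral_completion borel_measurable_scaleR borel_measurable_continuous_onI
        continuous_intros borel_measurable_indicator, auto)
  qed
  also have "\<dots> = ?F pi - ?F (-pi)"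
  proof (rule integral_FTC_Icc)
    fix t :: real
    have "((\<lambda>z. exp (- (\<i> * complex_of_real u * z)) / (- (\<i> * complex_of_real u))) has_field_derivative
        exp (- (\<i> * complex_of_real u * complex_of_real t))) (at (complex_of_real t))"
      using assms by (auto intro!: derivative_eq_intros)
    from has_vector_derivative_real_field[OF this]
    show "(?F has_vector_derivative exp (- (\<i> * complex_of_real u * complex_of_real t))) (at t within {-pi..pi})"
      by (simp add: o_def)
  qed (auto intro!: continuous_intros)
  also have "\<dots> = complex_of_real (2 * sin (pi * u) / u)"
  proof -
    have "exp (- (\<i> * complex_of_real u * complex_of_real pi)) = cis (- (pi * u))"
      "exp (- (\<i> * complex_of_real u * complex_of_real (- pi))) = cis (pi * u)"
      by (simp_all add: cis_conv_exp mult_ac)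
    then show ?thesis using assms
      by (simp add: complex_eq_iff Re_divide Im_divide power2_eq_square) 
  qed
  finally show ?thesis using assms by (simp add: sinc_kernel_eq field_simps)
qed

lemma sinc_kernel_le_inverse: "u \<noteq> 0 \<Longrightarrow> cmod (sinc_kernel u) \<le> 1 / \<bar>u\<bar>"
proof -
  assume u: "u \<noteq> 0"
  have "\<bar>sin (pi * u)\<bar> / (pi * \<bar>u\<bar>) \<le> 1 / (1 * \<bar>u\<bar>)"
    using u pi_gt3 by (intro frac_le mult_right_mono) auto
  then show ?thesis using u by (simp add: sinc_kernel_sin norm_divide norm_mult abs_mult)
qed

lemma sinc_kernel_int: "m \<noteq> 0 \<Longrightarrow> sinc_kernel (of_int m) = 0"
  by (simp add: sinc_kernel_sin sin_zero_iff_int2 mult.commute[of pi])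

section \<open>The projection of boundedly supported functions onto the Paley--Wiener space\<close>

definition cL2 :: "(real \<Rightarrow> complex) set" where
  "cL2 = {\<phi> \<in> L2. \<exists>R. \<forall>x. x \<notin> {-R..R} \<longrightarrow> \<phi> x = 0}"

lemma cL2_L2: "\<phi> \<in> cL2 \<Longrightarrow> \<phi> \<in> L2" by (simp add: cL2_def)

text \<open>This is the point of bounded support: \<open>fourier\<close> then applies directly, and
  the projection is an honest kernel integral.\<close>

lemma cL2_integrable: "\<phi> \<in> cL2 \<Longrightarrow> integrable lebesgue \<phi>"
  unfolding cL2_def using L2_bounded_support_integrable by blast

definition bandcut :: "(real \<Rightarrow> complex) \<Rightarrow> real \<Rightarrow> complex" where
  "bandcut \<phi> \<xi> = indicator {-pi..pi} \<xi> * fourier \<phi> \<xi>"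

text \<open>The orthogonal projection onto \<open>PW\<close>: cut off on the Fourier side and
  transform back. Its defining property is \<open>PW_inner_PWproj\<close>.\<close>

definition PWproj :: "(real \<Rightarrow> complex) \<Rightarrow> real \<Rightarrow> complex" where
  "PWproj \<phi> = ifourier (bandcut \<phi>)"

lemma PWproj_kernel:
  assumes "\<phi> \<in> cL2" shows "PWproj \<phi> x = (LINT t|lebesgue. \<phi> t * sinc_kernel (t - x))"
proof -
  let ?E = "\<lambda>\<xi>. exp (\<i> * complex_of_real x * complex_of_real \<xi>)"
  let ?c = "complex_of_real (1 / sqrt (2 * pi))"
  have i: "integrable lebesgue (\<lambda>\<xi>. indicator {-pi..pi} \<xi> * ?E \<xi>)"
    by (rule integrable_bounded_mult[OF indicator_pi_integrable, where B=1])
      (auto simp: norm_exp_eq_Re intro!: continuous_lebesgue_measurable continuous_intros)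
  have "PWproj \<phi> x = ?c * (LINT \<xi>|lebesgue. fourier \<phi> \<xi> * (indicator {-pi..pi} \<xi> * ?E \<xi>))"
    by (simp add: PWproj_def ifourier_eq bandcut_def mult_ac)
  also have "\<dots> = ?c * (LINT t|lebesgue. \<phi> t * fourier (\<lambda>\<xi>. indicator {-pi..pi} \<xi> * ?E \<xi>) t)"
    by (simp add: fourier_multiplication[OF cL2_integrable[OF assms] i])
  also have "\<dots> = (LINT t|lebesgue. \<phi> t * sinc_kernel (t - x))"
    unfolding fourier_modulate sinc_kernel_def
    by (subst integral_mult_right_zero[symmetric]) (simp add: field_simps)
  finally show ?thesis .
qed

text \<open>For \<open>\<bar>x\<bar> \<ge> 2 * R\<close> one has
  \<open>4 / x^2 \<le> 8 / (1 + x^2)\<close>, otherwise \<open>1 + x^2 \<le> 1 + 4 * R^2\<close>;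
  the factor \<open>9 + 4 * R^2\<close> is the sum of the two constants.\<close>

lemma decay_bound:
  assumes R: "R \<ge> 1" and A: "\<And>x. cmod (h x) \<le> A" and D: "\<And>x. \<bar>x\<bar> \<ge> 2 * R \<Longrightarrow> cmod (h x) \<le> 2 * A / \<bar>x\<bar>"
  shows "(cmod (h x))\<^sup>2 \<le> A\<^sup>2 * (9 + 4 * R\<^sup>2) / (1 + x\<^sup>2)"
proof (cases "\<bar>x\<bar> \<ge> 2 * R")
  case True
  then have "1 \<le> \<bar>x\<bar>" using R by simp
  then have x1: "1 \<le> x\<^sup>2" using one_le_power[of "\<bar>x\<bar>" 2] by simp
  have "8 / (2 * x\<^sup>2) \<le> 8 / (1 + x\<^sup>2)"
    using x1 by (intro divide_left_mono) (auto intro!: mult_pos_pos add_pos_nonneg)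
  then have x8: "4 / x\<^sup>2 \<le> 8 / (1 + x\<^sup>2)" by simp
  have "(cmod (h x))\<^sup>2 \<le> (2 * A / \<bar>x\<bar>)\<^sup>2" using D[OF True] by (intro power_mono) auto
  also have "\<dots> = A\<^sup>2 * (4 / x\<^sup>2)" by (simp add: power_divide power_mult_distrib)
  also have "\<dots> \<le> A\<^sup>2 * (8 / (1 + x\<^sup>2))" using x8 by (intro mult_left_mono) auto
  also have "\<dots> \<le> A\<^sup>2 * ((9 + 4 * R\<^sup>2) / (1 + x\<^sup>2))"
    by (intro mult_left_mono divide_right_mono) auto
  finally show ?thesis by simp
next
  case False
  then have "x\<^sup>2 \<le> (2 * R)\<^sup>2" by (intro power2_le_iff_abs_le[THEN iffD2]) auto
  then have "1 + x\<^sup>2 \<le> 9 + 4 * R\<^sup>2" by (simp add: power_mult_distrib)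
  then have "A\<^sup>2 * (1 + x\<^sup>2) \<le> A\<^sup>2 * (9 + 4 * R\<^sup>2)" by (intro mult_left_mono) auto
  then have "A\<^sup>2 \<le> A\<^sup>2 * (9 + 4 * R\<^sup>2) / (1 + x\<^sup>2)" by (simp add: pos_le_divide_eq add_pos_nonneg)
  moreover have "(cmod (h x))\<^sup>2 \<le> A\<^sup>2" using A by (intro power_mono) auto
  ultimately show ?thesis by linarith
qed

lemma sinc_kernel_measurable: "(\<lambda>t. sinc_kernel (t - x)) \<in> borel_measurable lebesgue"
proof -
  have "continuous_on UNIV (\<lambda>t. fourier (indicator {-pi..pi}) (t - x))"
    by (rule continuous_on_compose2[OF fourier_continuous[OF indicator_pi_integrable]]) (auto intro: continuous_intros)
  then show ?thesis unfolding sinc_kernel_def by (intro continuous_lebesgue_measurable continuous_intros) auto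
qed

lemma PWproj_norm_le:
  assumes \<phi>: "\<phi> \<in> cL2" and b: "\<And>t. \<phi> t \<noteq> 0 \<Longrightarrow> cmod (sinc_kernel (t - x)) \<le> b"
  shows "cmod (PWproj \<phi> x) \<le> b * (LINT t|lebesgue. cmod (\<phi> t))"
proof -
  have "cmod (PWproj \<phi> x) \<le> (LINT t|lebesgue. cmod (\<phi> t * sinc_kernel (t - x)))"
    unfolding PWproj_kernel[OF \<phi>] by (rule integral_norm_bound)
  also have "\<dots> \<le> (LINT t|lebesgue. b * cmod (\<phi> t))"
  proof (intro integral_mono)
    show "integrable lebesgue (\<lambda>t. cmod (\<phi> t * sinc_kernel (t - x)))"
      using sinc_kernel_le_1 by (intro integrable_norm integrable_bounded_mult[OF cL2_integrable[OF \<phi>] sinc_kernel_measurable])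
    show "integrable lebesgue (\<lambda>t. b * cmod (\<phi> t))" using cL2_integrable[OF \<phi>] by auto
    show "cmod (\<phi> t * sinc_kernel (t - x)) \<le> b * cmod (\<phi> t)" for t
      using mult_right_mono[OF b[of t], of "cmod (\<phi> t)"] by (cases "\<phi> t = 0") (auto simp: norm_mult mult.commute)
  qed
  finally show ?thesis by simp
qed

text \<open>If \<open>\<bar>x\<bar>\<close> is at least twice the radius of the support, then
  \<open>\<bar>t - x\<bar> \<ge> \<bar>x\<bar> / 2\<close> there, and the sinc kernel gives the
  decay \<open>2 / \<bar>x\<bar>\<close>.\<close>

lemma cL2_band_limited:
  assumes \<phi>: "\<phi> \<in> cL2" shows "\<exists>C. band_limited (fourier \<phi>) (bandcut \<phi>) (PWproj \<phi>) C"
proof -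
  obtain R0 where R0: "\<And>x. x \<notin> {-R0..R0} \<Longrightarrow> \<phi> x = 0" using \<phi> by (auto simp: cL2_def)
  define R where "R = max 1 R0"
  define A where "A = (LINT t|lebesgue. cmod (\<phi> t))"
  have R: "R \<ge> 1" "\<And>x. \<phi> x \<noteq> 0 \<Longrightarrow> x \<in> {-R..R}" using R0 by (force simp: R_def)+
  have 1: "cmod (PWproj \<phi> x) \<le> A" for x
    using PWproj_norm_le[OF \<phi> sinc_kernel_le_1] by (simp add: A_def)
  have 2: "cmod (PWproj \<phi> x) \<le> 2 * A / \<bar>x\<bar>" if x: "\<bar>x\<bar> \<ge> 2 * R" for x
  proof -
    have "cmod (sinc_kernel (t - x)) \<le> 2 / \<bar>x\<bar>" if "\<phi> t \<noteq> 0" for t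
    proof -
      have t: "\<bar>t\<bar> \<le> R" using R(2)[OF that] by auto
      then have tx: "\<bar>x\<bar> / 2 \<le> \<bar>t - x\<bar>" "t - x \<noteq> 0" "\<bar>x\<bar> > 0" using x R(1) by linarith+
      have "cmod (sinc_kernel (t - x)) \<le> 1 / \<bar>t - x\<bar>" by (rule sinc_kernel_le_inverse[OF tx(2)])
      also have "\<dots> \<le> 1 / (\<bar>x\<bar> / 2)" using tx by (intro divide_left_mono) auto
      finally show ?thesis by simp
    qed
    from PWproj_norm_le[OF \<phi> this] show ?thesis by (simp add: A_def)
  qed
  have "band_limited (fourier \<phi>) (bandcut \<phi>) (PWproj \<phi>) (A\<^sup>2 * (9 + 4 * R\<^sup>2))"
  proof
    show "continuous_on UNIV (fourier \<phi>)" by (rule fourier_continuous[OF cL2_integrable[OF \<phi>]])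
    show "bandcut \<phi> = (\<lambda>\<xi>. indicator {-pi..pi} \<xi> * fourier \<phi> \<xi>)" by (simp add: bandcut_def[abs_def])
    show "PWproj \<phi> = ifourier (bandcut \<phi>)" by (simp add: PWproj_def)
    show "(cmod (PWproj \<phi> x))\<^sup>2 \<le> A\<^sup>2 * (9 + 4 * R\<^sup>2) / (1 + x\<^sup>2)" for x
      by (rule decay_bound[OF R(1) 1 2])
  qed
  then show ?thesis ..
qed

lemma PWproj_in_PW: "\<phi> \<in> cL2 \<Longrightarrow> PWproj \<phi> \<in> PW"
  using cL2_band_limited band_limited.in_PW by blast

lemma bandcut_L2: "\<phi> \<in> cL2 \<Longrightarrow> bandcut \<phi> \<in> L2"
  using cL2_band_limited band_limited.g_L2 by blast

text \<open>On the Fourier side \<open>g\<close> does not see the transform of \<open>\<phi>\<close>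
  outside the band, so \<open>\<phi>\<close> and its projection have the same inner product with
  \<open>f\<close>.\<close>

lemma spectral_inner_bandcut:
  assumes "spectral f g" and \<phi>: "\<phi> \<in> cL2"
  shows "L2_inner f \<phi> = L2_inner g (bandcut \<phi>)" "L2_inner f (PWproj \<phi>) = L2_inner g (bandcut \<phi>)"
proof -
  have f: "f \<in> L2" "g \<in> L2" "\<And>\<xi>. \<xi> \<notin> {-pi..pi} \<Longrightarrow> g \<xi> = 0" "AE x in lebesgue. f x = ifourier g x"
    using assms(1) by (auto simp: spectral_def)
  have g1: "integrable lebesgue g" using f(2,3) by (rule L2_bounded_support_integrable)
  have "L2_inner f \<phi> = L2_inner (ifourier g) \<phi>"
    unfolding L2_inner_def
  proof (rule integral_cong_AE)
    show "(\<lambda>x. f x * cnj (\<phi> x)) \<in> borel_measurable lebesgue"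
      using L2_inner_integrable[OF f(1) cL2_L2[OF \<phi>]] by auto
    show "(\<lambda>x. ifourier g x * cnj (\<phi> x)) \<in> borel_measurable lebesgue"
      using L2_inner_integrable[OF ifourier_in_L2[OF f(2) g1] cL2_L2[OF \<phi>]] by auto
    show "AE x in lebesgue. f x * cnj (\<phi> x) = ifourier g x * cnj (\<phi> x)" using f(4) by eventually_elim simp
  qed
  also have "\<dots> = L2_inner g (fourier \<phi>)"
    unfolding L2_inner_def by (rule ifourier_inner[OF cL2_integrable[OF \<phi>] g1])
  also have "\<dots> = L2_inner g (bandcut \<phi>)"
    unfolding L2_inner_def using f(3)
    by (intro Bochner_Integration.integral_cong) (auto simp: bandcut_def indicator_def)
  finally show "L2_inner f \<phi> = L2_inner g (bandcut \<phi>)" .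
  show "L2_inner f (PWproj \<phi>) = L2_inner g (bandcut \<phi>)"
    using cL2_band_limited[OF \<phi>] band_limited.parseval f by blast
qed

lemma PW_inner_PWproj: "f \<in> PW \<Longrightarrow> \<phi> \<in> cL2 \<Longrightarrow> L2_inner f \<phi> = L2_inner f (PWproj \<phi>)"
  by (metis PW_spectral spectral_inner_bandcut)

text \<open>The form \<open>\<langle>P \<phi>, P \<psi>\<rangle>\<close> for the projection
  \<open>P\<close>, written on the Fourier side, where additivity and translation invariance are
  immediate.\<close>

definition conc :: "(real \<Rightarrow> complex) \<Rightarrow> (real \<Rightarrow> complex) \<Rightarrow> complex" where
  "conc \<phi> \<psi> = L2_inner (bandcut \<phi>) (bandcut \<psi>)"

lemma PWproj_inner:
  assumes \<phi>: "\<phi> \<in> cL2" and \<psi>: "\<psi> \<in> cL2"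
  shows "L2_inner (PWproj \<phi>) (PWproj \<psi>) = conc \<phi> \<psi>"
proof -
  obtain C where "band_limited (fourier \<phi>) (bandcut \<phi>) (PWproj \<phi>) C" using cL2_band_limited[OF \<phi>] by blast
  then interpret P: band_limited "fourier \<phi>" "bandcut \<phi>" "PWproj \<phi>" C .
  obtain D where "band_limited (fourier \<psi>) (bandcut \<psi>) (PWproj \<psi>) D" using cL2_band_limited[OF \<psi>] by blast
  then show ?thesis
    unfolding conc_def
    by (rule band_limited.parseval[OF _ P.h_L2 P.g_L2 P.g_zero]) (simp_all add: PWproj_def)
qed

lemma PWproj_sq: "\<phi> \<in> cL2 \<Longrightarrow> L2_sq (PWproj \<phi>) = Re (conc \<phi> \<phi>)"
  by (metis PWproj_inner L2_inner_self Re_complex_of_real)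

lemma conc_le:
  assumes \<phi>: "\<phi> \<in> cL2" and \<psi>: "\<psi> \<in> cL2" and b: "b \<ge> 0"
    "\<And>t x. \<phi> t \<noteq> 0 \<Longrightarrow> \<psi> x \<noteq> 0 \<Longrightarrow> cmod (sinc_kernel (t - x)) \<le> b"
  shows "cmod (conc \<phi> \<psi>) \<le> b * (LINT t|lebesgue. cmod (\<phi> t)) * (LINT t|lebesgue. cmod (\<psi> t))"
proof -
  let ?A = "LINT t|lebesgue. cmod (\<phi> t)"
  have "conc \<phi> \<psi> = L2_inner (PWproj \<phi>) \<psi>"
    using PWproj_inner[OF \<phi> \<psi>] PW_inner_PWproj[OF PWproj_in_PW[OF \<phi>] \<psi>] by simp
  also have "cmod \<dots> \<le> (LINT x|lebesgue. cmod (PWproj \<phi> x * cnj (\<psi> x)))"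
    unfolding L2_inner_def by (rule integral_norm_bound)
  also have "\<dots> \<le> (LINT x|lebesgue. b * ?A * cmod (\<psi> x))"
  proof (intro integral_mono)
    have "PWproj \<phi> \<in> L2" using PWproj_in_PW[OF \<phi>] PW_subset_L2 by blast
    then show "integrable lebesgue (\<lambda>x. cmod (PWproj \<phi> x * cnj (\<psi> x)))"
      by (intro integrable_norm L2_inner_integrable cL2_L2[OF \<psi>])
    show "integrable lebesgue (\<lambda>x. b * ?A * cmod (\<psi> x))" using cL2_integrable[OF \<psi>] by auto
    show "cmod (PWproj \<phi> x * cnj (\<psi> x)) \<le> b * ?A * cmod (\<psi> x)" for x
    proof (cases "\<psi> x = 0")
      case False
      then have "cmod (PWproj \<phi> x) \<le> b * ?A" using b by (intro PWproj_norm_le[OF \<phi>])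
      then show ?thesis by (simp add: norm_mult mult_right_mono)
    qed simp
  qed
  finally show ?thesis by simp
qed

lemma cL2_subspace: "L2_subspace cL2"
  unfolding L2_subspace_def
proof (intro conjI ballI allI subsetI)
  show "(\<lambda>x. 0) \<in> cL2" by (simp add: cL2_def L2_zero)
next
  fix f g assume f: "f \<in> cL2" and g: "g \<in> cL2"
  obtain R S where RS: "\<And>x. x \<notin> {-R..R} \<Longrightarrow> f x = 0" "\<And>x. x \<notin> {-S..S} \<Longrightarrow> g x = 0"
    using f g by (auto simp: cL2_def)
  have "\<forall>x. x \<notin> {-(max R S)..max R S} \<longrightarrow> f x + g x = 0"
  proof (intro allI impI)
    fix x assume "x \<notin> {-(max R S)..max R S}"
    then have "x \<notin> {-R..R}" "x \<notin> {-S..S}" by auto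
    then show "f x + g x = 0" using RS by simp
  qed
  then show "(\<lambda>x. f x + g x) \<in> cL2" using f g L2_add[of f g] unfolding cL2_def by blast
next
  fix c f assume "f \<in> cL2"
  then show "(\<lambda>x. c * f x) \<in> cL2" using L2_scale[of f c] by (force simp: cL2_def)
qed (auto simp: cL2_def)

lemma bandcut_add: "\<phi> \<in> cL2 \<Longrightarrow> \<psi> \<in> cL2 \<Longrightarrow> bandcut (\<lambda>t. \<phi> t + \<psi> t) = (\<lambda>\<xi>. bandcut \<phi> \<xi> + bandcut \<psi> \<xi>)"
  by (simp add: bandcut_def[abs_def] fourier_add cL2_integrable distrib_left)

lemma bandcut_scale: "bandcut (\<lambda>t. c * \<phi> t) = (\<lambda>\<xi>. c * bandcut \<phi> \<xi>)"
  by (simp add: bandcut_def[abs_def] fourier_scale mult_ac)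

text \<open>A common translation multiplies both transforms by the same unimodular factor, which
  cancels.\<close>

lemma conc_shift: "conc (\<lambda>t. \<phi> (t + d)) (\<lambda>t. \<psi> (t + d)) = conc \<phi> \<psi>"
  unfolding conc_def L2_inner_def
proof (intro Bochner_Integration.integral_cong refl)
  fix \<xi> :: real
  define E where "E = exp (\<i> * complex_of_real \<xi> * complex_of_real d)"
  have "cmod E = 1" by (simp add: E_def norm_exp_eq_Re)
  then have E: "E * cnj E = 1" using complex_norm_square[of E] by simp
  have "bandcut (\<lambda>t. f (t + d)) \<xi> = E * bandcut f \<xi>" for f
    by (simp add: bandcut_def fourier_shift E_def mult_ac)
  then have "bandcut (\<lambda>t. \<phi> (t + d)) \<xi> * cnj (bandcut (\<lambda>t. \<psi> (t + d)) \<xi>)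
      = (E * cnj E) * (bandcut \<phi> \<xi> * cnj (bandcut \<psi> \<xi>))"
    by (simp add: mult_ac)
  then show "bandcut (\<lambda>t. \<phi> (t + d)) \<xi> * cnj (bandcut (\<lambda>t. \<psi> (t + d)) \<xi>) = bandcut \<phi> \<xi> * cnj (bandcut \<psi> \<xi>)"
    by (simp add: E)
qed

section \<open>The integer translates of the sinc kernel\<close>

definition sincs :: "nat \<Rightarrow> real \<Rightarrow> complex" where "sincs m x = sinc_kernel (real m - x)"

lemma sincs_band_limited:
  "\<exists>C. band_limited (\<lambda>\<xi>. exp (- (\<i> * complex_of_real (real m) * complex_of_real \<xi>)) / complex_of_real (sqrt (2 * pi)))
    (\<lambda>\<xi>. indicator {-pi..pi} \<xi> * (exp (- (\<i> * complex_of_real (real m) * complex_of_real \<xi>)) / complex_of_real (sqrt (2 * pi))))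
    (sincs m) C"
proof -
  let ?c = "\<lambda>\<xi>. exp (- (\<i> * complex_of_real (real m) * complex_of_real \<xi>)) / complex_of_real (sqrt (2 * pi))"
  let ?g = "\<lambda>\<xi>. indicator {-pi..pi} \<xi> * ?c \<xi>"
  define R where "R = 1 + real m"
  have 1: "cmod (sincs m x) \<le> 1" for x by (simp add: sincs_def sinc_kernel_le_1)
  have 2: "cmod (sincs m x) \<le> 2 * 1 / \<bar>x\<bar>" if x: "\<bar>x\<bar> \<ge> 2 * R" for x
  proof -
    have tx: "\<bar>x\<bar> / 2 \<le> \<bar>real m - x\<bar>" "real m - x \<noteq> 0" "\<bar>x\<bar> > 0" using x by (auto simp: R_def abs_if split: if_splits)
    have "cmod (sinc_kernel (real m - x)) \<le> 1 / \<bar>real m - x\<bar>" by (rule sinc_kernel_le_inverse[OF tx(2)])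
    also have "\<dots> \<le> 1 / (\<bar>x\<bar> / 2)" using tx by (intro divide_left_mono) auto
    finally show ?thesis by (simp add: sincs_def)
  qed
  have "band_limited ?c ?g (sincs m) (1\<^sup>2 * (9 + 4 * R\<^sup>2))"
  proof
    show "continuous_on UNIV ?c" by (intro continuous_intros) auto
    show "sincs m = ifourier ?g"
    proof
      fix x
      have "ifourier ?g x = fourier (\<lambda>\<xi>. (1 / complex_of_real (sqrt (2 * pi))) *
          (indicator {-pi..pi} \<xi> * exp (\<i> * complex_of_real (- real m) * complex_of_real \<xi>))) (- x)"
        unfolding ifourier_def by (simp add: mult_ac)
      also have "\<dots> = sincs m x"
        unfolding fourier_scale fourier_modulate by (simp add: sincs_def sinc_kernel_def)
      finally show "sincs m x = ifourier ?g x" by simp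
    qed
    show "(cmod (sincs m x))\<^sup>2 \<le> 1\<^sup>2 * (9 + 4 * R\<^sup>2) / (1 + x\<^sup>2)" for x
      by (rule decay_bound[OF _ 1 2]) (simp_all add: R_def)
  qed (rule refl)
  then show ?thesis ..
qed

lemma sincs_PW: "sincs m \<in> PW"
  using sincs_band_limited band_limited.in_PW by blast

text \<open>By Parseval the inner product is the sinc kernel at \<open>m - l\<close>, which vanishes
  at the nonzero integers. The sequence fills up incomplete systems in
  \<open>L2_ortho_extend\<close> and shows that orthonormal systems exist for every
  \<open>K\<close>.\<close>

lemma sincs_inner: "L2_inner (sincs m) (sincs l) = (if m = l then 1 else 0)"
proof -
  let ?c = "\<lambda>m \<xi>. exp (- (\<i> * complex_of_real (real m) * complex_of_real \<xi>)) / complex_of_real (sqrt (2 * pi))"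
  let ?g = "\<lambda>m \<xi>. indicator {-pi..pi} \<xi> * ?c m \<xi>"
  obtain C where "band_limited (?c m) (?g m) (sincs m) C" using sincs_band_limited by blast
  then interpret P: band_limited "?c m" "?g m" "sincs m" C .
  obtain D where "band_limited (?c l) (?g l) (sincs l) D" using sincs_band_limited by blast
  then have "L2_inner (sincs m) (sincs l) = L2_inner (?g m) (?g l)"
    by (rule band_limited.parseval[OF _ P.h_L2 P.g_L2 P.g_zero]) (assumption, intro AE_I2, rule fun_cong[OF P.h_def])
  also have "\<dots> = (LINT \<xi>|lebesgue. (indicator {-pi..pi} \<xi> * exp (- (\<i> * complex_of_real (real m - real l) * complex_of_real \<xi>)))
      / complex_of_real (2 * pi))"
    unfolding L2_inner_def
  proof (intro Bochner_Integration.integral_cong refl)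
    fix \<xi> :: real
    have s: "complex_of_real (sqrt (2 * pi)) * complex_of_real (sqrt (2 * pi)) = complex_of_real (2 * pi)"
      unfolding of_real_mult[symmetric] by simp
    have e: "exp (- (\<i> * complex_of_real (real m) * complex_of_real \<xi>)) * exp (\<i> * complex_of_real (real l) * complex_of_real \<xi>)
        = exp (- (\<i> * complex_of_real (real m - real l) * complex_of_real \<xi>))"
      unfolding exp_add[symmetric] by (simp add: algebra_simps)
    have "?g m \<xi> * cnj (?g l \<xi>) = indicator {-pi..pi} \<xi> * (exp (- (\<i> * complex_of_real (real m) * complex_of_real \<xi>)) *
       exp (\<i> * complex_of_real (real l) * complex_of_real \<xi>)) / (complex_of_real (sqrt (2 * pi)) * complex_of_real (sqrt (2 * pi)))"
      by (simp add: indicator_def exp_cnj)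
    then show "?g m \<xi> * cnj (?g l \<xi>) = (indicator {-pi..pi} \<xi> * exp (- (\<i> * complex_of_real (real m - real l) * complex_of_real \<xi>)))
      / complex_of_real (2 * pi)" unfolding e s .
  qed
  also have "\<dots> = sinc_kernel (real m - real l)" by (simp add: sinc_kernel_eq)
  also have "\<dots> = sinc_kernel (of_int (int m - int l))" by simp
  also have "\<dots> = (if m = l then 1 else 0)"
    using sinc_kernel_int[of "int m - int l"] by (simp add: sinc_kernel_0 del: of_int_diff)
  finally show ?thesis .
qed

section \<open>Entire extensions and the bathtub principle\<close>

lemma spectral_integral_le:
  assumes "spectral f g"
  shows "(LINT \<xi>|lebesgue. cmod (g \<xi>)) \<le> sqrt (2 * pi) * sqrt (L2_sq f)"
proof -
  have g: "g \<in> L2" "\<And>\<xi>. \<xi> \<notin> {-pi..pi} \<Longrightarrow> g \<xi> = 0" "L2_sq g \<le> L2_sq f"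
    using assms by (auto simp: spectral_def)
  have "(LINT \<xi>|lebesgue. cmod (g \<xi>)) \<le> sqrt (L2_sq g * measure lebesgue {-pi..pi})"
    using g(1,2) by (intro L2_support_integral_le) (auto simp: emeasure_lborel_Icc_eq)
  also have "\<dots> = sqrt (2 * pi) * sqrt (L2_sq g)" by (simp add: real_sqrt_mult)
  also have "\<dots> \<le> sqrt (2 * pi) * sqrt (L2_sq f)" using g(3) by (intro mult_left_mono) auto
  finally show ?thesis .
qed

text \<open>The bounds depend on \<open>f\<close> only through its norm, so the extensions of
  orthonormal functions form a normal family. Holomorphy comes from expanding the exponential and
  integrating term by term over the bounded band.\<close>

lemma spectral_entire:
  assumes sp: "spectral f g"
  shows "\<exists>F. F holomorphic_on UNIV \<and> (\<forall>z. cmod (F z) \<le> exp (pi * \<bar>Im z\<bar>) * sqrt (L2_sq f)) \<and>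
    (\<forall>x y. cmod (F (complex_of_real x) - F (complex_of_real y)) \<le> pi * \<bar>x - y\<bar> * sqrt (L2_sq f)) \<and>
    (AE x in lebesgue. f x = F (complex_of_real x))"
proof -
  have g: "g \<in> L2" "\<And>\<xi>. \<xi> \<notin> {-pi..pi} \<Longrightarrow> g \<xi> = 0" "AE x in lebesgue. f x = ifourier g x"
    using sp by (auto simp: spectral_def)
  have g1: "integrable lebesgue g" using g(1,2) by (rule L2_bounded_support_integrable)
  have gm: "g \<in> borel_measurable lebesgue" by (rule L2_measurable[OF g(1)])
  let ?c = "complex_of_real (1 / sqrt (2 * pi))"
  define G where "G = (\<lambda>z. LINT \<xi>|lebesgue. g \<xi> * exp (\<i> * z * complex_of_real \<xi>))"
  define F where "F = (\<lambda>z. ?c * G z)"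
  \<comment> \<open>The factor \<open>sqrt (2 * pi)\<close> from Cauchy--Schwarz on the band cancels
    the normalisation of the transform.\<close>
  have cs: "cmod ?c * (B * (LINT \<xi>|lebesgue. cmod (g \<xi>))) \<le> B * sqrt (L2_sq f)" if "B \<ge> 0" for B
  proof -
    have "cmod ?c * (B * (LINT \<xi>|lebesgue. cmod (g \<xi>))) \<le> cmod ?c * (B * (sqrt (2 * pi) * sqrt (L2_sq f)))"
      using spectral_integral_le[OF sp] that by (intro mult_left_mono) auto
    then show ?thesis by (simp add: norm_divide)
  qed
  have kb: "cmod (g \<xi> * k \<xi>) \<le> B * cmod (g \<xi>)" if "\<And>\<xi>. \<xi> \<in> {-pi..pi} \<Longrightarrow> cmod (k \<xi>) \<le> B" for k \<xi> B
    using that[of \<xi>] g(2)[of \<xi>] mult_right_mono[of "cmod (k \<xi>)" B "cmod (g \<xi>)"]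
    by (cases "\<xi> \<in> {-pi..pi}") (auto simp: norm_mult mult.commute)
  have ki: "integrable lebesgue (\<lambda>\<xi>. g \<xi> * k \<xi>)"
    if "\<And>\<xi>. \<xi> \<in> {-pi..pi} \<Longrightarrow> cmod (k \<xi>) \<le> B" "continuous_on UNIV k" for k B
  proof (rule Bochner_Integration.integrable_bound)
    show "integrable lebesgue (\<lambda>\<xi>. B * cmod (g \<xi>))" using g1 by auto
    show "(\<lambda>\<xi>. g \<xi> * k \<xi>) \<in> borel_measurable lebesgue"
      using gm continuous_lebesgue_measurable[OF that(2)] by (intro borel_measurable_times)
    show "AE \<xi> in lebesgue. cmod (g \<xi> * k \<xi>) \<le> norm (B * cmod (g \<xi>))"
    proof (rule AE_I2)
      fix \<xi>
      have "cmod (g \<xi> * k \<xi>) \<le> B * cmod (g \<xi>)" by (rule kb) (rule that(1))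
      then show "cmod (g \<xi> * k \<xi>) \<le> norm (B * cmod (g \<xi>))" by simp
    qed
  qed
  have kn: "cmod (LINT \<xi>|lebesgue. g \<xi> * k \<xi>) \<le> B * (LINT \<xi>|lebesgue. cmod (g \<xi>))"
    if b: "\<And>\<xi>. \<xi> \<in> {-pi..pi} \<Longrightarrow> cmod (k \<xi>) \<le> B" "continuous_on UNIV k" for k B
  proof -
    have "cmod (LINT \<xi>|lebesgue. g \<xi> * k \<xi>) \<le> (LINT \<xi>|lebesgue. cmod (g \<xi> * k \<xi>))" by (rule integral_norm_bound)
    also have "\<dots> \<le> (LINT \<xi>|lebesgue. B * cmod (g \<xi>))"
      using ki[OF b] g1 kb[OF b(1)] by (intro integral_mono) auto
    finally show ?thesis by simp
  qed
  have eb: "cmod (exp (\<i> * z * complex_of_real \<xi>)) \<le> exp (pi * \<bar>Im z\<bar>)" if "\<xi> \<in> {-pi..pi}" for z \<xi>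
  proof -
    have "- (Im z * \<xi>) \<le> \<bar>Im z\<bar> * \<bar>\<xi>\<bar>" by (metis abs_ge_minus_self abs_mult)
    also have "\<dots> \<le> \<bar>Im z\<bar> * pi" using that by (intro mult_left_mono) auto
    finally show ?thesis by (simp add: norm_exp_eq_Re mult.commute)
  qed
  have bound: "cmod (F z) \<le> exp (pi * \<bar>Im z\<bar>) * sqrt (L2_sq f)" for z
  proof -
    have "cmod (F z) \<le> cmod ?c * (exp (pi * \<bar>Im z\<bar>) * (LINT \<xi>|lebesgue. cmod (g \<xi>)))"
      unfolding F_def G_def norm_mult
      by (intro mult_left_mono kn eb) (auto intro!: continuous_intros)
    also have "\<dots> \<le> exp (pi * \<bar>Im z\<bar>) * sqrt (L2_sq f)" by (rule cs) simp
    finally show ?thesis .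
  qed
  have lip: "cmod (F (complex_of_real x) - F (complex_of_real y)) \<le> pi * \<bar>x - y\<bar> * sqrt (L2_sq f)" for x y
  proof -
    let ?e = "\<lambda>x \<xi>. exp (\<i> * complex_of_real x * complex_of_real \<xi>)"
    have i: "integrable lebesgue (\<lambda>\<xi>. g \<xi> * ?e x \<xi>)" for x
      by (rule ki[where B=1]) (auto simp: norm_exp_eq_Re intro!: continuous_intros)
    have d: "cmod (?e x \<xi> - ?e y \<xi>) \<le> pi * \<bar>x - y\<bar>" if \<xi>: "\<xi> \<in> {-pi..pi}" for \<xi>
    proof -
      have "?e x \<xi> - ?e y \<xi> = ?e y \<xi> * (iexp ((x - y) * \<xi>) - 1)"
        by (simp add: algebra_simps flip: exp_add)
      then have "cmod (?e x \<xi> - ?e y \<xi>) = cmod (iexp ((x - y) * \<xi>) - 1)"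
        by (simp add: norm_mult norm_exp_eq_Re)
      also have "\<dots> \<le> \<bar>(x - y) * \<xi>\<bar>" using iexp_approx1[of "(x - y) * \<xi>" 0] by simp
      also have "\<dots> \<le> \<bar>x - y\<bar> * pi" using \<xi> unfolding abs_mult by (intro mult_left_mono) auto
      finally show ?thesis by (simp add: mult.commute)
    qed
    have "F (complex_of_real x) - F (complex_of_real y) = ?c * (LINT \<xi>|lebesgue. g \<xi> * (?e x \<xi> - ?e y \<xi>))"
      unfolding F_def G_def using i[of x] i[of y] by (simp add: right_diff_distrib diff_divide_distrib)
    then have "cmod (F (complex_of_real x) - F (complex_of_real y)) = cmod ?c * cmod (LINT \<xi>|lebesgue. g \<xi> * (?e x \<xi> - ?e y \<xi>))"
      by (simp only: norm_mult)
    also have "\<dots> \<le> cmod ?c * ((pi * \<bar>x - y\<bar>) * (LINT \<xi>|lebesgue. cmod (g \<xi>)))"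
      by (intro mult_left_mono kn d) (auto intro!: continuous_intros)
    also have "\<dots> \<le> (pi * \<bar>x - y\<bar>) * sqrt (L2_sq f)" by (rule cs) simp
    finally show ?thesis .
  qed
  have hol: "F holomorphic_on UNIV"
  proof -
    define a where "a = (\<lambda>n. LINT \<xi>|lebesgue. g \<xi> * ((\<i> * complex_of_real \<xi>) ^ n / fact n))"
    have sums: "(\<lambda>n. a n * (w - 0) ^ n) sums G w" for w
    proof -
      let ?k = "\<lambda>n \<xi>. (\<i> * w * complex_of_real \<xi>) ^ n / fact n :: complex"
      have b: "cmod (?k n \<xi>) \<le> (cmod w * pi) ^ n / fact n" if "\<xi> \<in> {-pi..pi}" for n \<xi>
        using that by (auto simp: norm_divide norm_mult norm_power intro!: divide_right_mono power_mono mult_left_mono)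
      have c: "continuous_on UNIV (?k n)" for n by (intro continuous_intros) auto
      have expb: "summable (\<lambda>n. (cmod w * pi) ^ n / fact n)"
        using summable_exp[of "cmod w * pi"] by (simp add: divide_inverse mult.commute)
      have "(\<lambda>n. LINT \<xi>|lebesgue. g \<xi> * ?k n \<xi>) sums (LINT \<xi>|lebesgue. (\<Sum>n. g \<xi> * ?k n \<xi>))"
      proof (rule sums_integral)
        show "integrable lebesgue (\<lambda>\<xi>. g \<xi> * ?k n \<xi>)" for n by (rule ki[OF b c])
        show "AE \<xi> in lebesgue. summable (\<lambda>n. cmod (g \<xi> * ?k n \<xi>))"
        proof (rule AE_I2)
          fix \<xi>
          show "summable (\<lambda>n. cmod (g \<xi> * ?k n \<xi>))"
            by (rule summable_comparison_test'[OF summable_mult2[OF expb, of "cmod (g \<xi>)"]])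
              (use kb[OF b] in auto)
        qed
        show "summable (\<lambda>n. LINT \<xi>|lebesgue. cmod (g \<xi> * ?k n \<xi>))"
        proof (rule summable_comparison_test'[OF summable_mult2[OF expb, of "LINT \<xi>|lebesgue. cmod (g \<xi>)"]])
          fix n :: nat
          have "(LINT \<xi>|lebesgue. cmod (g \<xi> * ?k n \<xi>)) \<le> (LINT \<xi>|lebesgue. (cmod w * pi) ^ n / fact n * cmod (g \<xi>))"
            using ki[OF b c] g1 kb[OF b] by (intro integral_mono) auto
          then show "norm (LINT \<xi>|lebesgue. cmod (g \<xi> * ?k n \<xi>)) \<le> (cmod w * pi) ^ n / fact n * (LINT \<xi>|lebesgue. cmod (g \<xi>))"
            by simp
        qed
      qed
      also have "(LINT \<xi>|lebesgue. (\<Sum>n. g \<xi> * ?k n \<xi>)) = G w"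
        unfolding G_def
      proof (intro Bochner_Integration.integral_cong refl)
        fix \<xi>
        have "(\<lambda>n. ?k n \<xi>) sums exp (\<i> * w * complex_of_real \<xi>)"
          using exp_converges[of "\<i> * w * complex_of_real \<xi>"] by (simp add: scaleR_conv_of_real divide_inverse mult.commute)
        then have "(\<lambda>n. g \<xi> * ?k n \<xi>) sums (g \<xi> * exp (\<i> * w * complex_of_real \<xi>))" by (rule sums_mult)
        then show "(\<Sum>n. g \<xi> * ?k n \<xi>) = g \<xi> * exp (\<i> * w * complex_of_real \<xi>)" by (simp add: sums_iff)
      qed
      also have "(\<lambda>n. LINT \<xi>|lebesgue. g \<xi> * ?k n \<xi>) = (\<lambda>n. a n * (w - 0) ^ n)"
      proof
        fix n
        have "(\<lambda>\<xi>. g \<xi> * ?k n \<xi>) = (\<lambda>\<xi>. w ^ n * (g \<xi> * ((\<i> * complex_of_real \<xi>) ^ n / fact n)))"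
          by (simp add: power_mult_distrib mult_ac)
        then show "(LINT \<xi>|lebesgue. g \<xi> * ?k n \<xi>) = a n * (w - 0) ^ n" by (simp add: a_def mult.commute)
      qed
      finally show ?thesis .
    qed
    have "G field_differentiable (at w)" for w
    proof -
      have "G holomorphic_on ball 0 (cmod w + 1)" by (rule power_series_holomorphic[OF sums])
      then show ?thesis by (simp add: holomorphic_on_open field_differentiable_def)
    qed
    then have "G holomorphic_on UNIV" by (simp add: holomorphic_on_def field_differentiable_at_within)
    then show ?thesis unfolding F_def by (intro holomorphic_intros)
  qed
  have "AE x in lebesgue. f x = F (complex_of_real x)"
    using g(3) by eventually_elim (simp add: F_def G_def ifourier_eq)
  with hol bound lip show ?thesis by blast
qed

text \<open>The measure of \<open>A \<union> (B \<inter> {-r..r})\<close> is Lipschitz in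
  \<open>r\<close> with constant 2, so it takes the value \<open>s\<close> by the intermediate value
  theorem. If \<open>B\<close> has measure exactly \<open>s\<close>, this value might not be reached
  at a finite \<open>r\<close>, and \<open>B\<close> itself is the witness.\<close>

lemma emeasure_between:
  fixes A B :: "real set"
  assumes A: "A \<in> sets lebesgue" and B: "B \<in> sets lebesgue" and AB: "A \<subseteq> B"
    and s: "s \<ge> 0" "emeasure lebesgue A \<le> ennreal s" "ennreal s \<le> emeasure lebesgue B"
  shows "\<exists>\<Omega>\<in>sets lebesgue. A \<subseteq> \<Omega> \<and> \<Omega> \<subseteq> B \<and> emeasure lebesgue \<Omega> = ennreal s"
proof (cases "emeasure lebesgue B = ennreal s")
  case True
  then show ?thesis using B AB by blast
next
  case False
  with s have lt: "ennreal s < emeasure lebesgue B" by simp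
  define C where "C = (\<lambda>r. A \<union> (B \<inter> {-r..r}))"
  have C: "C r \<in> sets lebesgue" for r
    using A B unfolding C_def by (intro sets.Un sets.Int) auto
  have Icc: "emeasure lebesgue {a..b::real} = ennreal (b - a)" if "a \<le> b" for a b
    using that by simp
  have Cfin: "emeasure lebesgue (C r) < \<infinity>" for r
  proof -
    have "emeasure lebesgue (C r) \<le> emeasure lebesgue A + emeasure lebesgue (B \<inter> {-r..r})"
      unfolding C_def using A B by (intro emeasure_subadditive) auto
    also have "\<dots> \<le> ennreal s + emeasure lebesgue {-r..r}"
      using s B by (intro add_mono emeasure_mono) auto
    also have "\<dots> < \<infinity>" by (simp add: emeasure_lborel_Icc_eq)
    finally show ?thesis .
  qed
  define m where "m = (\<lambda>r. measure lebesgue (C r))"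
  have em: "emeasure lebesgue (C r) = ennreal (m r)" for r
    unfolding m_def using Cfin[of r] by (intro emeasure_eq_ennreal_measure) auto
  have mono: "m r \<le> m r'" if "r \<le> r'" for r r'
    unfolding m_def using that C Cfin by (intro measure_mono_fmeasurable) (auto simp: C_def fmeasurable_def)
  have lip: "m r' \<le> m r + 2 * (r' - r)" if "0 \<le> r" "r \<le> r'" for r r'
  proof -
    have "emeasure lebesgue (C r') \<le> emeasure lebesgue (C r \<union> ({-r'..-r} \<union> {r..r'}))"
      using C by (intro emeasure_mono) (auto simp: C_def)
    also have "\<dots> \<le> emeasure lebesgue (C r) + emeasure lebesgue ({-r'..-r} \<union> {r..r'})"
      using C by (intro emeasure_subadditive) auto
    also have "\<dots> \<le> emeasure lebesgue (C r) + (emeasure lebesgue {-r'..-r} + emeasure lebesgue {r..r'})"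
      by (intro add_left_mono emeasure_subadditive) auto
    also have "\<dots> = ennreal (m r + 2 * (r' - r))"
      using that by (simp add: em Icc m_def flip: ennreal_plus)
    finally have "ennreal (m r') \<le> ennreal (m r + 2 * (r' - r))" by (simp only: em)
    moreover have "m r + 2 * (r' - r) \<ge> 0" using that by (simp add: m_def)
    ultimately show ?thesis by (simp only: ennreal_le_iff)
  qed
  have cont: "continuous_on {0..R} m" for R
  proof (rule lipschitz_on_continuous_on[where L=2], rule lipschitz_onI)
    fix x y assume xy: "x \<in> {0..R}" "y \<in> {0..R}"
    then show "dist (m x) (m y) \<le> 2 * dist x y"
      using lip[of x y] lip[of y x] mono[of x y] mono[of y x]
      by (cases "x \<le> y") (auto simp: dist_real_def abs_if)
  qed simp
  have "emeasure lebesgue (C 0) \<le> emeasure lebesgue A + emeasure lebesgue {0..0::real}"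
  proof (rule order_trans[OF emeasure_mono emeasure_subadditive])
    show "A \<union> {0..0} \<in> sets lebesgue" using A by (intro sets.Un) simp_all
  qed (use A in \<open>auto simp: C_def\<close>)
  then have m0: "m 0 \<le> s" using s unfolding em Icc[OF order_refl]
    by (metis add_0_right diff_self ennreal_0 ennreal_le_iff order_trans)
  have "(\<Union>n. C (real n)) = B"
  proof
    show "B \<subseteq> (\<Union>n. C (real n))"
    proof
      fix x assume "x \<in> B"
      obtain n where "\<bar>x\<bar> \<le> real n" using real_arch_simple by blast
      then have "x \<in> C (real n)" using \<open>x \<in> B\<close> by (auto simp: C_def)
      then show "x \<in> (\<Union>n. C (real n))" by blast
    qed
  qed (use AB in \<open>auto simp: C_def\<close>)
  moreover have "(SUP n. emeasure lebesgue (C (real n))) = emeasure lebesgue (\<Union>n. C (real n))"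
  proof (rule SUP_emeasure_incseq)
    show "range (\<lambda>n. C (real n)) \<subseteq> sets lebesgue" using C by auto
    show "incseq (\<lambda>n. C (real n))" unfolding incseq_def C_def by fastforce
  qed
  ultimately have "ennreal s < (SUP n. emeasure lebesgue (C (real n)))" using lt by simp
  then obtain n where "ennreal s < emeasure lebesgue (C (real n))" by (auto simp: less_SUP_iff)
  then have mn: "s < m (real n)" using s(1) by (simp add: em ennreal_less_iff)
  have "\<exists>r\<ge>0. r \<le> real n \<and> m r = s"
    by (rule IVT'[OF m0 _ _ cont]) (use mn in auto)
  then obtain r where "m r = s" by blast
  then have "emeasure lebesgue (C r) = ennreal s" by (simp add: em)
  then show ?thesis using C[of r] AB by (intro bexI[of _ "C r"]) (auto simp: C_def)
qed

text \<open>The level is the infimum of all \<open>t\<close> for which \<open>{\<rho> > t}\<close>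
  has measure at most \<open>s\<close>. Continuity of the measure gives that
  \<open>{\<rho> > c}\<close> has measure at most \<open>s\<close> and
  \<open>{\<rho> \<ge> c}\<close> at least \<open>s\<close>; part of the plateau
  \<open>{\<rho> = c}\<close> fills up to exactly \<open>s\<close>.\<close>

lemma bathtub_level:
  fixes \<rho> :: "real \<Rightarrow> real"
  assumes \<rho>: "integrable lebesgue \<rho>" "\<And>x. \<rho> x \<ge> 0" and s: "s > 0"
  shows "\<exists>c\<ge>0. \<exists>\<Omega>\<in>sets lebesgue. {x. \<rho> x > c} \<subseteq> \<Omega> \<and> \<Omega> \<subseteq> {x. \<rho> x \<ge> c} \<and> emeasure lebesgue \<Omega> = ennreal s"
proof -
  have m [measurable]: "\<rho> \<in> borel_measurable lebesgue" using \<rho> by auto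
  have S: "{x. \<rho> x > t} \<in> sets lebesgue" "{x. \<rho> x \<ge> t} \<in> sets lebesgue" for t
    using measurable_sets[OF m, of "{t<..}"] measurable_sets[OF m, of "{t..}"]
    by (simp_all add: vimage_def)
  define I where "I = (LINT x|lebesgue. \<rho> x)"
  have I: "I \<ge> 0" unfolding I_def using \<rho> by (intro integral_nonneg_AE) auto
  have markov: "emeasure lebesgue {x. \<rho> x \<ge> t} \<le> ennreal (I / t)" if t: "t > 0" for t
  proof -
    have "emeasure lebesgue {x\<in>space lebesgue. \<rho> x \<ge> t} \<le> ennreal (1 / t * (\<integral>x. \<rho> x \<partial>lebesgue))"
      using \<rho> t by (intro integral_Markov_inequality) auto
    then show ?thesis by (simp add: I_def)
  qed
  define T where "T = {t. t > 0 \<and> emeasure lebesgue {x. \<rho> x > t} \<le> ennreal s}"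
  define c where "c = Inf T"
  have "emeasure lebesgue {x. \<rho> x > (I + 1) / s} \<le> emeasure lebesgue {x. \<rho> x \<ge> (I + 1) / s}"
    using S by (intro emeasure_mono) auto
  also have "\<dots> \<le> ennreal (I / ((I + 1) / s))" using I s by (intro markov) auto
  also have "\<dots> \<le> ennreal s" using I s by (intro ennreal_leI) (simp add: field_simps)
  finally have Tne: "(I + 1) / s \<in> T" using I s by (simp add: T_def)
  have Tb: "bdd_below T" by (rule bdd_belowI[of _ 0]) (auto simp: T_def)
  have c0: "c \<ge> 0" unfolding c_def using Tne by (intro cInf_greatest) (auto simp: T_def)
  have up: "emeasure lebesgue {x. \<rho> x > t} \<le> ennreal s" if tc: "t > c" for t
  proof -
    obtain t' where t': "t' \<in> T" "t' < t" using cInf_lessD[of T t] tc Tne unfolding c_def by blast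
    have "emeasure lebesgue {x. \<rho> x > t} \<le> emeasure lebesgue {x. \<rho> x > t'}"
      using S t'(2) by (intro emeasure_mono) auto
    then show ?thesis using t' by (auto simp: T_def)
  qed
  have lo: "emeasure lebesgue {x. \<rho> x > t} > ennreal s" if "0 < t" "t < c" for t
  proof (rule ccontr)
    assume "\<not> ennreal s < emeasure lebesgue {x. \<rho> x > t}"
    then have "t \<in> T" using that by (simp add: T_def)
    then have "c \<le> t" unfolding c_def by (rule cInf_lower[OF _ Tb])
    with that show False by simp
  qed
  have A: "emeasure lebesgue {x. \<rho> x > c} \<le> ennreal s"
  proof -
    have e: "{x. \<rho> x > c} = (\<Union>n. {x. \<rho> x > c + eps n})"
    proof
      show "{x. \<rho> x > c} \<subseteq> (\<Union>n. {x. \<rho> x > c + eps n})"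
      proof
        fix x assume "x \<in> {x. \<rho> x > c}"
        then obtain n where "inverse (real (Suc n)) < \<rho> x - c" using reals_Archimedean[of "\<rho> x - c"] by auto
        then have "\<rho> x > c + eps n" by (simp add: eps_def)
        then show "x \<in> (\<Union>n. {x. \<rho> x > c + eps n})" by blast
      qed
      show "(\<Union>n. {x. \<rho> x > c + eps n}) \<subseteq> {x. \<rho> x > c}" using eps_pos by (auto intro: less_trans[rotated] simp: less_add_same_cancel1)
    qed
    have "(SUP n. emeasure lebesgue {x. \<rho> x > c + eps n}) = emeasure lebesgue (\<Union>n. {x. \<rho> x > c + eps n})"
    proof (rule SUP_emeasure_incseq)
      show "range (\<lambda>n. {x. \<rho> x > c + eps n}) \<subseteq> sets lebesgue" using S by auto
      have "eps n \<le> eps m" if "m \<le> n" for m n using that by (simp add: eps_def le_imp_inverse_le)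
      then show "incseq (\<lambda>n. {x. \<rho> x > c + eps n})"
        unfolding incseq_def by (auto intro: le_less_trans[OF add_left_mono])
    qed
    moreover have "(SUP n. emeasure lebesgue {x. \<rho> x > c + eps n}) \<le> ennreal s"
      using eps_pos by (intro SUP_least up) simp
    ultimately show ?thesis unfolding e by simp
  qed
  have B: "ennreal s \<le> emeasure lebesgue {x. \<rho> x \<ge> c}"
  proof (cases "c = 0")
    case True
    then have "{x. \<rho> x \<ge> c} = UNIV" using \<rho> by auto
    then show ?thesis by simp
  next
    case False
    with c0 have cp: "c > 0" by simp
    \<comment> \<open>A sequence of positive levels increasing to \<open>c\<close>. Positivity lets
      Markov's inequality make the sets \<open>{\<rho> \<ge> d n}\<close> finite in measure, as
      continuity from above requires.\<close>
    define d where "d = (\<lambda>n. c * (1 - eps n / 2))"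
    have d: "0 < d n" "d n < c" for n
      using cp eps_pos[of n] eps_le_1[of n] by (auto simp: d_def mult_less_cancel_left2)
    have dlim: "d \<longlonglongrightarrow> c * (1 - 0 / 2)" unfolding d_def by (intro tendsto_intros eps_tendsto) auto
    have e: "{x. \<rho> x \<ge> c} = (\<Inter>n. {x. \<rho> x \<ge> d n})"
    proof
      show "{x. \<rho> x \<ge> c} \<subseteq> (\<Inter>n. {x. \<rho> x \<ge> d n})" 
        using order_trans[OF less_imp_le[OF d(2)]] by blast
      show "(\<Inter>n. {x. \<rho> x \<ge> d n}) \<subseteq> {x. \<rho> x \<ge> c}"
      proof
        fix x assume "x \<in> (\<Inter>n. {x. \<rho> x \<ge> d n})"
        then have "\<forall>n. d n \<le> \<rho> x" by auto
        then have "c * (1 - 0 / 2) \<le> \<rho> x" using LIMSEQ_le_const2[OF dlim] by blast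
        then show "x \<in> {x. \<rho> x \<ge> c}" by simp
      qed
    qed
    have "(INF n. emeasure lebesgue {x. \<rho> x \<ge> d n}) = emeasure lebesgue (\<Inter>n. {x. \<rho> x \<ge> d n})"
    proof (rule INF_emeasure_decseq)
      show "range (\<lambda>n. {x. \<rho> x \<ge> d n}) \<subseteq> sets lebesgue" using S by auto
      have "d m \<le> d n" if "m \<le> n" for m n
        unfolding d_def using that cp by (intro mult_left_mono) (auto simp: eps_def le_imp_inverse_le)
      then show "decseq (\<lambda>n. {x. \<rho> x \<ge> d n})" unfolding decseq_def by (auto intro: order_trans)
      show "emeasure lebesgue {x. \<rho> x \<ge> d n} \<noteq> \<infinity>" for n
        using markov[OF d(1)[of n]] by (auto simp: top_unique)
    qed
    moreover have "ennreal s \<le> (INF n. emeasure lebesgue {x. \<rho> x \<ge> d n})"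
    proof (rule INF_greatest)
      fix n
      have "ennreal s < emeasure lebesgue {x. \<rho> x > d n}" by (rule lo[OF d])
      also have "\<dots> \<le> emeasure lebesgue {x. \<rho> x \<ge> d n}" using S by (intro emeasure_mono) auto
      finally show "ennreal s \<le> emeasure lebesgue {x. \<rho> x \<ge> d n}" by simp
    qed
    ultimately show ?thesis unfolding e by simp
  qed
  have "{x. \<rho> x > c} \<subseteq> {x. \<rho> x \<ge> c}" by auto
  then obtain \<Omega> where "\<Omega> \<in> sets lebesgue" "{x. \<rho> x > c} \<subseteq> \<Omega>" "\<Omega> \<subseteq> {x. \<rho> x \<ge> c}" "emeasure lebesgue \<Omega> = ennreal s"
    using emeasure_between[OF S _ _ A B] s by auto
  then show ?thesis using c0 by blast
qed

text \<open>Pointwise, \<open>(\<rho> - c) * indicator A\<close> is at most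
  \<open>(\<rho> - c) * indicator \<Omega>\<close>; integrating costs \<open>c\<close> times the
  difference of the measures, which has the right sign.\<close>

lemma bathtub_optimal:
  fixes \<rho> :: "real \<Rightarrow> real"
  assumes \<rho>: "integrable lebesgue \<rho>" and c: "c \<ge> 0" and s: "s \<ge> 0"
    and \<Omega>: "\<Omega> \<in> sets lebesgue" "{x. \<rho> x > c} \<subseteq> \<Omega>" "\<Omega> \<subseteq> {x. \<rho> x \<ge> c}" "emeasure lebesgue \<Omega> = ennreal s"
    and A: "A \<in> sets lebesgue" "emeasure lebesgue A \<le> ennreal s"
  shows "(LINT x:A|lebesgue. \<rho> x) \<le> (LINT x:\<Omega>|lebesgue. \<rho> x)"
proof -
  have Af: "emeasure lebesgue A < \<infinity>" using A(2) le_less_trans ennreal_less_top by (metis infinity_ennreal_def)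
  have mA: "measure lebesgue A \<le> s" "measure lebesgue \<Omega> = s"
    using A(2) \<Omega>(4) s Af by (auto simp: measure_def enn2real_leI)
  have i: "integrable lebesgue (\<lambda>x. indicat_real B x * \<rho> x)" if "B \<in> sets lebesgue" for B
    using integrable_mult_indicator[OF that \<rho>] by simp
  have j: "integrable lebesgue (indicat_real A)" "integrable lebesgue (indicat_real \<Omega>)"
    using A \<Omega> Af by (auto intro!: integrable_real_indicator)
  have "(LINT x|lebesgue. indicat_real A x * \<rho> x - c * indicat_real A x)
      \<le> (LINT x|lebesgue. indicat_real \<Omega> x * \<rho> x - c * indicat_real \<Omega> x)"
  proof (intro integral_mono)
    fix x
    show "indicat_real A x * \<rho> x - c * indicat_real A x \<le> indicat_real \<Omega> x * \<rho> x - c * indicat_real \<Omega> x"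
      using \<Omega>(2,3) by (auto simp: indicator_def subset_iff not_less)
  qed (use i j A \<Omega> in auto)
  then have "(LINT x|lebesgue. indicat_real A x * \<rho> x) - c * measure lebesgue A
      \<le> (LINT x|lebesgue. indicat_real \<Omega> x * \<rho> x) - c * measure lebesgue \<Omega>"
    using i j A \<Omega> by simp
  moreover have "c * measure lebesgue A \<le> c * s" using mA c by (intro mult_left_mono) auto
  ultimately show ?thesis using mA by (simp add: set_lebesgue_integral_def)
qed

section \<open>Duality\<close>

abbreviation pw_value :: "nat \<Rightarrow> real set \<Rightarrow> (nat \<Rightarrow> real \<Rightarrow> complex) \<Rightarrow> real" where
  "pw_value K \<Omega> f \<equiv> (\<Sum>k=1..K. (LINT x:\<Omega>|lebesgue. (cmod (f k x))\<^sup>2))"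

lemma L2_sq_restrict: "L2_sq (\<lambda>x. indicator \<Omega> x * f x) = (LINT x:\<Omega>|lebesgue. (cmod (f x))\<^sup>2)"
  unfolding L2_sq_def set_lebesgue_integral_def
  by (intro Bochner_Integration.integral_cong) (auto simp: indicator_def)

lemma pw_orthonormal_iff:
  "PW_orthonormal K f \<longleftrightarrow> (\<forall>k\<in>{1..K}. f k \<in> PW \<and> L2_sq (f k) = 1) \<and> L2_ortho {1..K} f"
proof
  assume P: "PW_orthonormal K f"
  have 1: "L2_sq (f k) = 1" if "k \<in> {1..K}" for k
    using P that by (auto simp: PW_orthonormal_def L2_inner_self dest!: bspec)
  moreover have "f k \<in> L2" if "k \<in> {1..K}" for k
    using P that PW_subset_L2 by (auto simp: PW_orthonormal_def)
  moreover have "L2_inner (f j) (f k) = 0" if "j \<in> {1..K}" "k \<in> {1..K}" "j \<noteq> k" for j k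
    using P that unfolding PW_orthonormal_def by (metis (full_types))
  moreover have "f k \<in> PW" if "k \<in> {1..K}" for k using P that by (simp add: PW_orthonormal_def)
  ultimately show "(\<forall>k\<in>{1..K}. f k \<in> PW \<and> L2_sq (f k) = 1) \<and> L2_ortho {1..K} f"
    unfolding L2_ortho_def by blast
next
  assume "(\<forall>k\<in>{1..K}. f k \<in> PW \<and> L2_sq (f k) = 1) \<and> L2_ortho {1..K} f"
  then show "PW_orthonormal K f"
    unfolding PW_orthonormal_def L2_ortho_def by (auto simp: L2_inner_self)
qed

definition dual_system :: "nat \<Rightarrow> real set \<Rightarrow> (nat \<Rightarrow> real \<Rightarrow> complex) \<Rightarrow> bool" where
  "dual_system K \<Omega> \<phi> \<longleftrightarrow> L2_ortho {1..K} \<phi> \<and> (\<forall>i\<in>{1..K}. \<forall>x. x \<notin> \<Omega> \<longrightarrow> \<phi> i x = 0)"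

text \<open>By \<open>PWproj_sq\<close> this is the sum of the squared norms of the
  projections.\<close>

definition dual_value :: "nat \<Rightarrow> (nat \<Rightarrow> real \<Rightarrow> complex) \<Rightarrow> real" where
  "dual_value K \<phi> = (\<Sum>i=1..K. Re (conc (\<phi> i) (\<phi> i)))"

lemma dual_system_cL2:
  assumes "dual_system K \<Omega> \<phi>" "\<Omega> \<subseteq> {-R..R}" "i \<in> {1..K}" shows "\<phi> i \<in> cL2"
  using assms unfolding dual_system_def L2_ortho_def cL2_def by blast

text \<open>Bessel's inequality applied to \<open>PWproj \<psi>\<close>, whose squared norm is the
  right-hand side. Both sides make sense for limits of orthonormal systems, too.\<close>

lemma PW_bessel:
  assumes f: "PW_orthonormal K f" and \<psi>: "\<psi> \<in> cL2"
  shows "(\<Sum>k=1..K. (cmod (L2_inner (f k) \<psi>))\<^sup>2) \<le> Re (conc \<psi> \<psi>)"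
proof -
  have P: "PWproj \<psi> \<in> L2" using PWproj_in_PW[OF \<psi>] PW_subset_L2 by blast
  have "(\<Sum>k=1..K. (cmod (L2_inner (f k) \<psi>))\<^sup>2) = (\<Sum>k=1..K. (cmod (L2_inner (PWproj \<psi>) (f k)))\<^sup>2)"
    using f PW_inner_PWproj[OF _ \<psi>]
    by (intro sum.cong) (auto simp: pw_orthonormal_iff L2_inner_norm_commute[of "PWproj \<psi>"])
  also have "\<dots> \<le> L2_sq (PWproj \<psi>)" using f by (intro L2_bessel P) (auto simp: pw_orthonormal_iff)
  finally show ?thesis by (simp add: PWproj_sq[OF \<psi>])
qed

text \<open>Both directions of the duality rest on one fact: for orthonormal bases \<open>f\<close> and \<open>\<phi>\<close> of
  finite-dimensional subspaces, the Hilbert--Schmidt sum of the \<open>|\<langle>f\<^sub>k, \<phi>\<^sub>i\<rangle>|\<^sup>2\<close> can be taken in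
  either order, so no singular value decomposition is needed.\<close>

lemma primal_to_dual:
  assumes \<Omega>: "\<Omega> \<in> sets lebesgue" "\<Omega> \<subseteq> {-R..R}"
    and u: "\<And>k. k \<in> {1..K} \<Longrightarrow> (\<lambda>x. indicator \<Omega> x * u k x) \<in> L2"
    and bessel: "\<And>\<psi>. \<psi> \<in> L2 \<Longrightarrow> (\<And>x. x \<notin> \<Omega> \<Longrightarrow> \<psi> x = 0) \<Longrightarrow>
      (\<Sum>k=1..K. (cmod (L2_inner (u k) \<psi>))\<^sup>2) \<le> Re (conc \<psi> \<psi>)"
  shows "\<exists>\<phi>. dual_system K \<Omega> \<phi> \<and> pw_value K \<Omega> u \<le> dual_value K \<phi>"
proof -
  \<comment> \<open>Of \<open>u\<close> only Bessel's inequality against functions living on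
    \<open>\<Omega>\<close> is assumed, so a limit of orthonormal systems qualifies.\<close>
  define W where "W = {\<psi> \<in> L2. \<forall>x. x \<notin> \<Omega> \<longrightarrow> \<psi> x = 0}"
  have W: "L2_subspace W"
    unfolding L2_subspace_def W_def by (auto intro: L2_add L2_scale L2_zero)
  define v where "v = (\<lambda>k x. indicator \<Omega> x * u k x)"
  have "v k \<in> W" if "k \<in> {1..K}" for k using u[OF that] by (simp add: v_def W_def)
  from L2_gram_schmidt[OF W, of K v, OF this] obtain \<phi> where \<phi>: "L2_ortho {1..K} \<phi>" "\<forall>k\<in>{1..K}. \<phi> k \<in> W"
    "\<forall>k\<in>{1..K}. L2_sq (v k) = (\<Sum>i\<in>{1..K}. (cmod (L2_inner (v k) (\<phi> i)))\<^sup>2)" by blast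
  have vu: "L2_inner (v k) (\<phi> i) = L2_inner (u k) (\<phi> i)" if "i \<in> {1..K}" for i k
    unfolding L2_inner_def using \<phi>(2) that
    by (intro Bochner_Integration.integral_cong) (auto simp: v_def W_def indicator_def)
  have "pw_value K \<Omega> u = (\<Sum>k=1..K. L2_sq (v k))" by (simp add: v_def L2_sq_restrict)
  also have "\<dots> = (\<Sum>k=1..K. \<Sum>i=1..K. (cmod (L2_inner (u k) (\<phi> i)))\<^sup>2)"
    using \<phi>(3) vu by simp
  also have "\<dots> = (\<Sum>i=1..K. \<Sum>k=1..K. (cmod (L2_inner (u k) (\<phi> i)))\<^sup>2)" by (rule sum.swap)
  also have "\<dots> \<le> dual_value K \<phi>"
    unfolding dual_value_def using \<phi>(2) by (intro sum_mono bessel) (auto simp: W_def)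
  finally show ?thesis using \<phi> by (auto simp: dual_system_def W_def)
qed

lemma dual_to_primal:
  assumes \<Omega>: "\<Omega> \<in> sets lebesgue" "\<Omega> \<subseteq> {-R..R}" and d: "dual_system K \<Omega> \<phi>"
  shows "\<exists>f. PW_orthonormal K f \<and> dual_value K \<phi> \<le> pw_value K \<Omega> f"
proof -
  note c = dual_system_cL2[OF d \<Omega>(2)]
  have P: "PWproj (\<phi> k) \<in> PW" if "k \<in> {1..K}" for k by (rule PWproj_in_PW[OF c[OF that]])
  from L2_gram_schmidt[OF PW_subspace, of K "\<lambda>k. PWproj (\<phi> k)", OF P] obtain \<theta> where \<theta>: "L2_ortho {1..K} \<theta>" "\<forall>k\<in>{1..K}. \<theta> k \<in> PW"
    "\<forall>k\<in>{1..K}. L2_sq (PWproj (\<phi> k)) = (\<Sum>i\<in>{1..K}. (cmod (L2_inner (PWproj (\<phi> k)) (\<theta> i)))\<^sup>2)" by blast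
  \<comment> \<open>The projections may be linearly dependent, in which case some
    \<open>\<theta> i\<close> vanish; these are replaced by unit vectors of
    \<open>PW\<close>.\<close>
  from L2_ortho_extend[OF PW_subspace \<theta>(1,2) sincs_PW sincs_inner] obtain f where
    f: "L2_ortho {1..K} f" "\<forall>k\<in>{1..K}. f k \<in> PW \<and> L2_sq (f k) = 1 \<and> (L2_sq (\<theta> k) = 1 \<longrightarrow> f k = \<theta> k)"
    by blast
  have fo: "PW_orthonormal K f" using f by (simp add: pw_orthonormal_iff)
  have PL: "PWproj (\<phi> k) \<in> L2" if "k \<in> {1..K}" for k using P[OF that] PW_subset_L2 by blast
  \<comment> \<open>Only zero vectors were replaced, so no inner product became smaller.\<close>
  have \<theta>f: "cmod (L2_inner (PWproj (\<phi> k)) (\<theta> i)) \<le> cmod (L2_inner (PWproj (\<phi> k)) (f i))"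
    if k: "k \<in> {1..K}" and i: "i \<in> {1..K}" for k i
  proof (cases "L2_sq (\<theta> i) = 1")
    case False
    then have "L2_sq (\<theta> i) = 0" "\<theta> i \<in> L2" using \<theta>(1) i by (auto simp: L2_ortho_def)
    then have "L2_inner (PWproj (\<phi> k)) (\<theta> i) = 0" using L2_cauchy_schwarz[OF PL[OF k], of "\<theta> i"] by simp
    then show ?thesis by simp
  qed (use f i in simp)
  have "dual_value K \<phi> = (\<Sum>k=1..K. L2_sq (PWproj (\<phi> k)))"
    unfolding dual_value_def using c by (intro sum.cong) (auto simp: PWproj_sq)
  also have "\<dots> = (\<Sum>k=1..K. \<Sum>i=1..K. (cmod (L2_inner (PWproj (\<phi> k)) (\<theta> i)))\<^sup>2)" using \<theta>(3) by simp
  also have "\<dots> \<le> (\<Sum>k=1..K. \<Sum>i=1..K. (cmod (L2_inner (PWproj (\<phi> k)) (f i)))\<^sup>2)"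
    using \<theta>f by (intro sum_mono power_mono) auto
  also have "\<dots> = (\<Sum>i=1..K. \<Sum>k=1..K. (cmod (L2_inner (\<lambda>x. indicator \<Omega> x * f i x) (\<phi> k)))\<^sup>2)"
  proof (subst sum.swap, intro sum.cong refl)
    fix i k assume ik: "i \<in> {1..K}" "k \<in> {1..K}"
    have "cmod (L2_inner (PWproj (\<phi> k)) (f i)) = cmod (L2_inner (f i) (PWproj (\<phi> k)))"
      by (rule L2_inner_norm_commute)
    also have "L2_inner (f i) (PWproj (\<phi> k)) = L2_inner (f i) (\<phi> k)"
      using f ik by (intro PW_inner_PWproj[symmetric] c) auto
    also have "\<dots> = L2_inner (\<lambda>x. indicator \<Omega> x * f i x) (\<phi> k)"
      unfolding L2_inner_def using d ik
      by (intro Bochner_Integration.integral_cong) (auto simp: dual_system_def indicator_def)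
    finally show "(cmod (L2_inner (PWproj (\<phi> k)) (f i)))\<^sup>2 = (cmod (L2_inner (\<lambda>x. indicator \<Omega> x * f i x) (\<phi> k)))\<^sup>2"
      by simp
  qed
  also have "\<dots> \<le> (\<Sum>i=1..K. L2_sq (\<lambda>x. indicator \<Omega> x * f i x))"
  proof (intro sum_mono L2_bessel)
    fix i assume "i \<in> {1..K}"
    then show "(\<lambda>x. indicator \<Omega> x * f i x) \<in> L2" using f PW_subset_L2 by (intro L2_restrict \<Omega>) auto
  qed (use d in \<open>auto simp: dual_system_def\<close>)
  also have "\<dots> = pw_value K \<Omega> f" by (simp add: L2_sq_restrict)
  finally show ?thesis using fo by blast
qed

lemma PW_sq_integrable: "f \<in> PW \<Longrightarrow> integrable lebesgue (\<lambda>x. (cmod (f x))\<^sup>2)"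
  using PW_subset_L2 by (auto intro: L2_sq_integrable)

lemma pw_value_mono:
  assumes "PW_orthonormal K f" "A \<in> sets lebesgue" "B \<in> sets lebesgue" "A \<subseteq> B"
  shows "pw_value K A f \<le> pw_value K B f"
proof (rule sum_mono)
  fix k assume "k \<in> {1..K}"
  then have i: "integrable lebesgue (\<lambda>x. (cmod (f k x))\<^sup>2)"
    using assms(1) by (intro PW_sq_integrable) (auto simp: PW_orthonormal_def)
  show "(LINT x:A|lebesgue. (cmod (f k x))\<^sup>2) \<le> (LINT x:B|lebesgue. (cmod (f k x))\<^sup>2)"
    unfolding set_lebesgue_integral_def using assms
    by (intro integral_mono integrable_mult_indicator i) (auto simp: indicator_def)
qed

lemma pw_value_le:
  assumes f: "PW_orthonormal K f" and A: "A \<in> sets lebesgue" shows "pw_value K A f \<le> real K"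
proof -
  have "pw_value K A f \<le> pw_value K UNIV f" using assms by (intro pw_value_mono) auto
  also have "\<dots> = (\<Sum>k=1..K. L2_sq (f k))" by (simp add: L2_sq_def set_lebesgue_integral_def)
  also have "\<dots> = real K" using f by (simp add: pw_orthonormal_iff)
  finally show ?thesis .
qed

text \<open>Returns from the dual to the original problem; enlarging \<open>\<Omega>\<close> to
  measure exactly \<open>s\<close> can only increase the value.\<close>

lemma concentration_value_above:
  assumes \<Omega>: "\<Omega> \<in> sets lebesgue" "\<Omega> \<subseteq> {-R..R}" "emeasure lebesgue \<Omega> \<le> ennreal s" and s: "s > 0"
    and d: "dual_system K \<Omega> \<phi>"
  shows "\<exists>v\<in>concentration_values K s. dual_value K \<phi> \<le> v"
proof -
  obtain f where f: "PW_orthonormal K f" "dual_value K \<phi> \<le> pw_value K \<Omega> f"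
    using dual_to_primal[OF \<Omega>(1,2) d] by blast
  obtain \<Omega>' where \<Omega>': "\<Omega>' \<in> sets lebesgue" "\<Omega> \<subseteq> \<Omega>'" "emeasure lebesgue \<Omega>' = ennreal s"
    using emeasure_between[OF \<Omega>(1), of UNIV s] \<Omega>(3) s by auto
  have "pw_value K \<Omega>' f \<in> concentration_values K s"
    unfolding concentration_values_def using \<Omega>' f by blast
  moreover have "dual_value K \<phi> \<le> pw_value K \<Omega>' f"
    using f pw_value_mono[OF f(1) \<Omega>(1) \<Omega>'(1,2)] by linarith
  ultimately show ?thesis by blast
qed

text \<open>The part of \<open>\<Omega>\<close> in \<open>X\<close> stays and the remainder moves
  left by \<open>t\<close>. The form is translation invariant, so only the cross terms between the
  parts change: the old ones are small by \<open>b\<close>, and the new ones are made nonnegative in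
  total by a sign. With \<open>X = {}\<close> and \<open>b = 0\<close> this is plain
  translation.\<close>

lemma dual_rearrange:
  assumes d: "dual_system K \<Omega> \<phi>" and \<Omega>: "\<Omega> \<in> sets lebesgue" "\<Omega> \<subseteq> {-R..R}" "emeasure lebesgue \<Omega> \<le> ennreal s"
    and s: "s \<ge> 0" and X: "X \<in> sets lebesgue"
    and disj: "\<And>x. x \<in> \<Omega> \<Longrightarrow> x \<in> X \<Longrightarrow> x + t \<in> \<Omega> \<Longrightarrow> x + t \<in> X"
    and b: "b \<ge> 0" "\<And>x y. x \<in> \<Omega> \<Longrightarrow> x \<in> X \<Longrightarrow> y \<in> \<Omega> \<Longrightarrow> y \<notin> X \<Longrightarrow> cmod (sinc_kernel (x - y)) \<le> b"
  defines "\<Omega>' \<equiv> {x. x \<in> \<Omega> \<and> x \<in> X \<or> x + t \<in> \<Omega> \<and> x + t \<notin> X}"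
  shows "\<exists>\<phi>'. dual_system K \<Omega>' \<phi>' \<and> dual_value K \<phi> \<le> dual_value K \<phi>' + 2 * real K * b * s"
proof -
  define p where "p = (\<lambda>i x. indicator X x * \<phi> i x)"
  define q where "q = (\<lambda>i x. indicator (-X) x * \<phi> i x)"
  define \<tau> where "\<tau> = (\<lambda>i x. q i (x + t))"
  have X': "-X \<in> sets lebesgue" using X by (metis Compl_in_sets_lebesgue)
  have zero: "\<phi> i x = 0" if "i \<in> {1..K}" "x \<notin> \<Omega>" for i x using d that by (simp add: dual_system_def)
  have \<phi>: "\<phi> i \<in> L2" "L2_sq (\<phi> i) \<le> 1" if "i \<in> {1..K}" for i
  proof -
    have "\<phi> i \<in> L2 \<and> L2_sq (\<phi> i) \<in> {0, 1}"
      using d that unfolding dual_system_def L2_ortho_def by blast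
    then show "\<phi> i \<in> L2" "L2_sq (\<phi> i) \<le> 1" by auto
  qed
  have pc: "p i \<in> cL2" and qc: "q i \<in> cL2" if "i \<in> {1..K}" for i
  proof -
    have "\<forall>x. x \<notin> {-R..R} \<longrightarrow> \<phi> i x = 0" using zero[OF that] \<Omega>(2) by blast
    then have "\<forall>x. x \<notin> {-R..R} \<longrightarrow> p i x = 0" "\<forall>x. x \<notin> {-R..R} \<longrightarrow> q i x = 0"
      unfolding p_def q_def by simp_all
    moreover have "p i \<in> L2" "q i \<in> L2"
      unfolding p_def q_def by (intro L2_restrict \<phi>[OF that] X X')+
    ultimately show "p i \<in> cL2" "q i \<in> cL2" unfolding cL2_def by blast+
  qed
  have \<phi>pq: "\<phi> i = (\<lambda>x. p i x + q i x)" for i by (auto simp: p_def q_def indicator_def)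
  have \<tau>c: "\<tau> i \<in> cL2" if i: "i \<in> {1..K}" for i
  proof -
    have q2: "q i \<in> L2" using qc[OF i] by (rule cL2_L2)
    have m: "(\<lambda>x. t + 1 * x) \<in> lebesgue \<rightarrow>\<^sub>M (lebesgue :: real measure)"
      using lebesgue_affine_measurable[where c="\<lambda>x::real. 1" and t=t] by simp
    have "(\<lambda>x. q i (t + 1 * x)) \<in> borel_measurable lebesgue"
      by (rule measurable_compose[OF m L2_measurable[OF q2]])
    moreover have "integrable lebesgue (\<lambda>x. (cmod (q i (t + 1 * x)))\<^sup>2)"
      by (rule lebesgue_integrable_real_affine[OF L2_sq_integrable[OF q2]]) simp
    ultimately have "\<tau> i \<in> L2" by (simp add: L2_def \<tau>_def add.commute)
    moreover have "\<forall>x. x \<notin> {-(R + \<bar>t\<bar>)..R + \<bar>t\<bar>} \<longrightarrow> \<tau> i x = 0"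
    proof (intro allI impI)
      fix x assume "x \<notin> {-(R + \<bar>t\<bar>)..R + \<bar>t\<bar>}"
      then have "x + t \<notin> {-R..R}" by (auto simp: abs_if split: if_splits)
      then have "x + t \<notin> \<Omega>" using \<Omega>(2) by blast
      then show "\<tau> i x = 0" using zero[OF i] by (simp add: \<tau>_def q_def)
    qed
    ultimately show ?thesis unfolding cL2_def by blast
  qed
  define S where "S = (\<Sum>i=1..K. Re (conc (p i) (\<tau> i)))"
  \<comment> \<open>A single sign for all \<open>i\<close>, as signs depending on \<open>i\<close>
    would spoil the inner products between different \<open>\<phi>' i\<close>; it makes the sum
    \<open>S\<close> of the new cross terms favourable.\<close>
  define \<sigma> where "\<sigma> = (if S \<ge> 0 then 1 else -1 :: real)"
  have \<sigma>: "\<sigma> * \<sigma> = 1" "\<sigma> * S \<ge> 0" by (auto simp: \<sigma>_def)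
  define \<phi>' where "\<phi>' = (\<lambda>i x. p i x + complex_of_real \<sigma> * \<tau> i x)"
  have conc_sq: "Re (conc \<psi> \<psi>) = L2_sq (bandcut \<psi>)" for \<psi> by (simp add: conc_def L2_inner_self)
  have v: "Re (conc (\<phi> i) (\<phi> i)) = L2_sq (bandcut (p i)) + L2_sq (bandcut (q i)) + 2 * Re (conc (p i) (q i))"
    if i: "i \<in> {1..K}" for i
    unfolding conc_sq \<phi>pq[of i] bandcut_add[OF pc[OF i] qc[OF i]]
    unfolding conc_def
    by (intro L2_sq_add bandcut_L2 pc qc i)
  have \<tau>q: "L2_sq (bandcut (\<tau> i)) = L2_sq (bandcut (q i))" for i
    unfolding conc_sq[symmetric] \<tau>_def conc_shift ..
  have v': "Re (conc (\<phi>' i) (\<phi>' i)) = L2_sq (bandcut (p i)) + L2_sq (bandcut (q i)) + 2 * (\<sigma> * Re (conc (p i) (\<tau> i)))"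
    if i: "i \<in> {1..K}" for i
  proof -
    have c: "(\<lambda>x. complex_of_real \<sigma> * \<tau> i x) \<in> cL2" by (rule L2_subspace_scale[OF cL2_subspace \<tau>c[OF i]])
    have "Re (conc (\<phi>' i) (\<phi>' i)) = L2_sq (bandcut (p i)) + L2_sq (\<lambda>\<xi>. complex_of_real \<sigma> * bandcut (\<tau> i) \<xi>)
        + 2 * Re (L2_inner (bandcut (p i)) (\<lambda>\<xi>. complex_of_real \<sigma> * bandcut (\<tau> i) \<xi>))"
      unfolding conc_sq \<phi>'_def bandcut_add[OF pc[OF i] c] bandcut_scale
      by (intro L2_sq_add L2_scale bandcut_L2 pc \<tau>c i)
    then show ?thesis
      unfolding L2_sq_scale L2_inner_scale_right \<tau>q conc_def[symmetric] using \<sigma>(1)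
      by (simp add: power2_eq_square)
  qed
  \<comment> \<open>Each piece has norm at most 1 and lives on a set of measure at most
    \<open>s\<close>, so its \<open>L^1\<close> norm is at most \<open>sqrt s\<close>. Cross terms
    enter twice for each of the \<open>K\<close> functions, whence
    \<open>2 * K * b * s\<close>.\<close>
  have cross: "Re (conc (p i) (q i)) \<le> b * s" if i: "i \<in> {1..K}" for i
  proof -
    have le: "(LINT x|lebesgue. cmod (h x)) \<le> sqrt s" if h: "h = p i \<or> h = q i" for h
    proof -
      have fin: "emeasure lebesgue \<Omega> < \<infinity>"
        using \<Omega>(3) le_less_trans ennreal_less_top by (metis infinity_ennreal_def)
      have hL: "h \<in> L2" using h pc[OF i] qc[OF i] cL2_L2 by auto
      have "L2_sq h \<le> L2_sq (\<phi> i)"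
        unfolding L2_sq_def using hL \<phi>[OF i] h
        by (intro integral_mono L2_sq_integrable) (auto simp: p_def q_def indicator_def)
      then have "L2_sq h \<le> 1" using \<phi>(2)[OF i] by simp
      moreover have "measure lebesgue \<Omega> \<le> s" using \<Omega>(3) s by (simp add: measure_def enn2real_leI)
      ultimately have "L2_sq h * measure lebesgue \<Omega> \<le> 1 * s" by (intro mult_mono) auto
      then have "sqrt (L2_sq h * measure lebesgue \<Omega>) \<le> sqrt s" by simp
      moreover have "(LINT x|lebesgue. cmod (h x)) \<le> sqrt (L2_sq h * measure lebesgue \<Omega>)"
      proof (rule L2_support_integral_le[OF hL \<Omega>(1) fin])
        show "h x = 0" if "x \<notin> \<Omega>" for x using h zero[OF i that] by (auto simp: p_def q_def)
      qed
      ultimately show ?thesis by linarith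
    qed
    have "Re (conc (p i) (q i)) \<le> cmod (conc (p i) (q i))" by (rule complex_Re_le_cmod)
    also have "\<dots> \<le> b * (LINT x|lebesgue. cmod (p i x)) * (LINT x|lebesgue. cmod (q i x))"
    proof (rule conc_le[OF pc[OF i] qc[OF i] b(1)])
      fix x y assume "p i x \<noteq> 0" "q i y \<noteq> 0"
      then show "cmod (sinc_kernel (x - y)) \<le> b"
        using zero[OF i, of x] zero[OF i, of y] by (intro b(2)) (auto simp: p_def q_def indicator_def split: if_splits)
    qed
    also have "\<dots> \<le> (b * sqrt s) * sqrt s"
      using b(1) s le by (intro mult_mono mult_left_mono mult_nonneg_nonneg integral_nonneg_AE) auto
    also have "\<dots> = b * s" using s by (simp add: mult.assoc)
    finally show ?thesis .
  qed
  have "dual_value K \<phi> \<le> (\<Sum>i=1..K. L2_sq (bandcut (p i)) + L2_sq (bandcut (q i)) + 2 * (b * s))"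
    unfolding dual_value_def by (intro sum_mono) (simp add: v cross)
  also have "\<dots> = (\<Sum>i=1..K. L2_sq (bandcut (p i)) + L2_sq (bandcut (q i))) + 2 * real K * b * s"
    by (simp add: sum.distrib)
  also have "(\<Sum>i=1..K. L2_sq (bandcut (p i)) + L2_sq (bandcut (q i))) \<le> dual_value K \<phi>'"
  proof -
    have "dual_value K \<phi>' = (\<Sum>i=1..K. L2_sq (bandcut (p i)) + L2_sq (bandcut (q i))) + 2 * (\<sigma> * S)"
      unfolding dual_value_def S_def by (simp add: v' sum.distrib sum_distrib_left)
    then show ?thesis using \<sigma>(2) by simp
  qed
  finally have val: "dual_value K \<phi> \<le> dual_value K \<phi>' + 2 * real K * b * s" by simp
  have supp: "\<phi>' i x = 0" if "i \<in> {1..K}" "x \<notin> \<Omega>'" for i x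
    using that zero[OF that(1), of x] zero[OF that(1), of "x + t"]
    by (auto simp: \<phi>'_def p_def \<tau>_def q_def \<Omega>'_def indicator_def)
  have \<phi>'2: "\<phi>' i \<in> L2" if i: "i \<in> {1..K}" for i
    unfolding \<phi>'_def by (intro L2_add L2_scale cL2_L2 pc \<tau>c i)
  \<comment> \<open>By \<open>disj\<close> the fixed piece and the shifted piece have disjoint
    supports. Inner products therefore split into two parts, and the second is unaffected by the
    shift and by \<open>\<sigma> * \<sigma> = 1\<close>.\<close>
  have inner: "L2_inner (\<phi>' i) (\<phi>' j) = L2_inner (\<phi> i) (\<phi> j)" if i: "i \<in> {1..K}" and j: "j \<in> {1..K}" for i j
  proof -
    have ints: "integrable lebesgue (\<lambda>x. p i x * cnj (p j x))" "integrable lebesgue (\<lambda>x. q i x * cnj (q j x))"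
      "integrable lebesgue (\<lambda>x. \<tau> i x * cnj (\<tau> j x))"
      by (intro L2_inner_integrable cL2_L2 pc qc \<tau>c i j)+
    have "L2_inner (\<phi>' i) (\<phi>' j) = (LINT x|lebesgue. p i x * cnj (p j x) + \<tau> i x * cnj (\<tau> j x))"
      unfolding L2_inner_def
    proof (intro Bochner_Integration.integral_cong refl)
      fix x
      have \<sigma>': "complex_of_real \<sigma> * complex_of_real \<sigma> = 1" unfolding of_real_mult[symmetric] \<sigma>(1) by simp
      show "\<phi>' i x * cnj (\<phi>' j x) = p i x * cnj (p j x) + \<tau> i x * cnj (\<tau> j x)"
      proof (cases "x \<in> \<Omega> \<and> x \<in> X")
        case True
        then have "\<tau> k x = 0" if "k \<in> {1..K}" for k
          using disj[of x] zero[OF that, of "x + t"] by (auto simp: \<tau>_def q_def indicator_def)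
        then show ?thesis using i j by (simp add: \<phi>'_def)
      next
        case False
        then have "p k x = 0" if "k \<in> {1..K}" for k using zero[OF that, of x] by (auto simp: p_def)
        then have "\<phi>' i x * cnj (\<phi>' j x) = (complex_of_real \<sigma> * complex_of_real \<sigma>) * (\<tau> i x * cnj (\<tau> j x))"
          using i j by (simp add: \<phi>'_def mult_ac)
        then show ?thesis using \<open>\<And>k. k \<in> {1..K} \<Longrightarrow> p k x = 0\<close> i j by (simp add: \<sigma>')
      qed
    qed
    also have "\<dots> = (LINT x|lebesgue. p i x * cnj (p j x)) + (LINT x|lebesgue. \<tau> i x * cnj (\<tau> j x))"
      using ints by simp
    also have "(LINT x|lebesgue. \<tau> i x * cnj (\<tau> j x)) = (LINT x|lebesgue. q i x * cnj (q j x))"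
      using lebesgue_integral_real_affine[of 1 "\<lambda>x. q i x * cnj (q j x)" t] by (simp add: \<tau>_def add.commute)
    also have "(LINT x|lebesgue. p i x * cnj (p j x)) + \<dots> = (LINT x|lebesgue. p i x * cnj (p j x) + q i x * cnj (q j x))"
      using ints by simp
    also have "\<dots> = L2_inner (\<phi> i) (\<phi> j)"
      unfolding L2_inner_def
      by (intro Bochner_Integration.integral_cong refl) (auto simp: p_def q_def indicator_def)
    finally show ?thesis .
  qed
  have sq: "L2_sq (\<phi>' i) = L2_sq (\<phi> i)" if "i \<in> {1..K}" for i
    using inner[OF that that] by (simp add: L2_inner_self)
  have "L2_ortho {1..K} \<phi>'"
    using d unfolding L2_ortho_def dual_system_def by (simp add: \<phi>'2 sq inner)
  then have "dual_system K \<Omega>' \<phi>'" using supp by (simp add: dual_system_def)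
  then show ?thesis using val by blast
qed

section \<open>Sets with gaps\<close>

text \<open>If the maximum \<open>\<mu>\<close> over all slices \<open>d j = 0\<close> is exceeded by some \<open>\<Phi> d1\<close>, then every competitor of
  \<open>d1\<close> has all its entries bounded by \<open>C / (\<Phi> d1 - \<mu>)\<close>.\<close>

lemma fun_max_if_zeroing_bound:
  fixes \<Phi> :: "(nat \<Rightarrow> nat) \<Rightarrow> real"
  assumes "finite J" and \<Phi>: "\<And>d j. j \<in> J \<Longrightarrow> \<Phi> d \<le> \<Phi> (d(j := 0)) + C / real (d j)"
  shows "\<exists>m. (\<forall>i. i \<notin> J \<longrightarrow> m i = d0 i) \<and> (\<forall>d. (\<forall>i. i \<notin> J \<longrightarrow> d i = d0 i) \<longrightarrow> \<Phi> d \<le> \<Phi> m)"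
  using assms
proof (induction "card J" arbitrary: J d0)
  case 0
  then have "J = {}" by simp
  then show ?case by (intro exI[of _ d0]) (auto simp: fun_eq_iff intro!: arg_cong[of _ _ \<Phi>] eq_refl)
next
  case (Suc n)
  note J = \<open>finite J\<close> and \<Phi> = \<open>\<And>d j. j \<in> J \<Longrightarrow> \<Phi> d \<le> \<Phi> (d(j := 0)) + C / real (d j)\<close>
  define A where "A = {d. \<forall>i. i \<notin> J \<longrightarrow> d i = d0 i}"
  have Jne: "J \<noteq> {}" using Suc by auto
  have "\<exists>m. m \<in> A \<and> (\<forall>d\<in>A. d j = 0 \<longrightarrow> \<Phi> d \<le> \<Phi> m)" if j: "j \<in> J" for j
  proof -
    \<comment> \<open>The slice \<open>d j = 0\<close> is the same problem with one coordinate
      fewer: \<open>j\<close> is frozen by changing the base point.\<close>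
    have "\<exists>m. (\<forall>i. i \<notin> J - {j} \<longrightarrow> m i = (d0(j := 0)) i) \<and>
        (\<forall>d. (\<forall>i. i \<notin> J - {j} \<longrightarrow> d i = (d0(j := 0)) i) \<longrightarrow> \<Phi> d \<le> \<Phi> m)"
      using Suc.hyps(2) j J by (intro Suc.hyps(1)) (auto intro: \<Phi>)
    then obtain m where m: "\<forall>i. i \<notin> J - {j} \<longrightarrow> m i = (d0(j := 0)) i"
      "\<And>d. (\<forall>i. i \<notin> J - {j} \<longrightarrow> d i = (d0(j := 0)) i) \<Longrightarrow> \<Phi> d \<le> \<Phi> m" by blast
    have "m \<in> A" using m(1) j by (auto simp: A_def)
    moreover have "\<Phi> d \<le> \<Phi> m" if "d \<in> A" "d j = 0" for d
      using that by (intro m(2)) (auto simp: A_def)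
    ultimately show ?thesis by blast
  qed
  then obtain b where b: "\<And>j. j \<in> J \<Longrightarrow> b j \<in> A" "\<And>j d. j \<in> J \<Longrightarrow> d \<in> A \<Longrightarrow> d j = 0 \<Longrightarrow> \<Phi> d \<le> \<Phi> (b j)"
    by metis
  define \<mu> where "\<mu> = Max ((\<lambda>j. \<Phi> (b j)) ` J)"
  have \<mu>: "\<Phi> (b j) \<le> \<mu>" if "j \<in> J" for j
    unfolding \<mu>_def using J that by (intro Max_ge) auto
  have "\<mu> \<in> (\<lambda>j. \<Phi> (b j)) ` J" unfolding \<mu>_def using J Jne by (intro Max_in) auto
  then obtain j0 where j0: "j0 \<in> J" "\<Phi> (b j0) = \<mu>" by auto
  have "\<exists>m\<in>A. \<forall>d\<in>A. \<Phi> d \<le> \<Phi> m"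
  proof (cases "\<exists>d1\<in>A. \<Phi> d1 > \<mu>")
    case False
    then have "\<forall>d\<in>A. \<Phi> d \<le> \<Phi> (b j0)" using j0 by (auto simp: not_less)
    then show ?thesis using b(1)[OF j0(1)] by blast
  next
    case True
    then obtain d1 where d1: "d1 \<in> A" "\<Phi> d1 > \<mu>" by blast
    define \<delta> where "\<delta> = \<Phi> d1 - \<mu>"
    have \<delta>: "\<delta> > 0" using d1 by (simp add: \<delta>_def)
    \<comment> \<open>An entry \<open>d j > 0\<close> of a competitor of \<open>d1\<close> satisfies
      \<open>\<delta> \<le> C / d j\<close>, because zeroing it leads into a slice, where the value
      is at most \<open>\<mu>\<close>.\<close>
    define M where "M = nat \<lceil>\<bar>C\<bar> / \<delta>\<rceil>"
    have small: "d j \<le> M" if d: "d \<in> A" "\<Phi> d \<ge> \<Phi> d1" and j: "j \<in> J" for d j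
    proof (cases "d j = 0")
      case False
      have "d(j := 0) \<in> A" using d j by (auto simp: A_def)
      then have "\<Phi> (d(j := 0)) \<le> \<mu>" using b(2)[OF j] \<mu>[OF j] by (metis fun_upd_same order_trans)
      then have "\<delta> \<le> C / real (d j)" using \<Phi>[OF j, of d] d(2) by (simp add: \<delta>_def)
      also have "\<dots> \<le> \<bar>C\<bar> / real (d j)" by (intro divide_right_mono) auto
      finally have "real (d j) \<le> \<bar>C\<bar> / \<delta>" using False \<delta> by (simp add: field_simps)
      then show ?thesis unfolding M_def by linarith
    qed simp
    \<comment> \<open>A finite box that contains every competitor at least as good as
      \<open>d1\<close>, so a maximum over it is a maximum over \<open>A\<close>.\<close>
    define D where "D = {d\<in>A. \<forall>j\<in>J. d j \<le> M}"
    have "D \<subseteq> (\<lambda>h i. if i \<in> J then h i else d0 i) ` (PiE J (\<lambda>_. {..M}))"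
    proof
      fix d assume d: "d \<in> D"
      then have "d = (\<lambda>i. if i \<in> J then restrict d J i else d0 i)" by (auto simp: D_def A_def)
      moreover have "restrict d J \<in> PiE J (\<lambda>_. {..M})" using d by (auto simp: D_def)
      ultimately show "d \<in> (\<lambda>h i. if i \<in> J then h i else d0 i) ` (PiE J (\<lambda>_. {..M}))" by blast
    qed
    then have fin: "finite D" using J by (meson finite_PiE finite_atMost finite_imageI finite_subset)
    have d1D: "d1 \<in> D" using d1 small[OF d1(1)] by (auto simp: D_def)
    have "Max (\<Phi> ` D) \<in> \<Phi> ` D" using fin d1D by (intro Max_in) auto
    then obtain m where m: "m \<in> D" "\<Phi> m = Max (\<Phi> ` D)" by auto
    have mx: "\<Phi> d \<le> \<Phi> m" if "d \<in> D" for d unfolding m(2) using fin that by (intro Max_ge) auto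
    have "\<Phi> d \<le> \<Phi> m" if "d \<in> A" for d
    proof (cases "\<Phi> d \<ge> \<Phi> d1")
      case True
      then have "d \<in> D" using that small by (auto simp: D_def)
      then show ?thesis by (rule mx)
    next
      case False
      then show ?thesis using mx[OF d1D] by simp
    qed
    then show ?thesis using m(1) by (auto simp: D_def)
  qed
  then show ?case by (auto simp: A_def)
qed

section \<open>Unions of unit cells, described by their gaps\<close>

definition gap_pos :: "(nat \<Rightarrow> nat) \<Rightarrow> nat \<Rightarrow> nat" where
  "gap_pos d i = (\<Sum>l<i. 1 + d l)"

text \<open>The gaps are read off the sorted list of \<open>A\<close>. If \<open>A\<close> has fewer
  than \<open>N\<close> elements, the image may contain surplus positions, so one number of cells
  serves all these sets.\<close>

lemma finite_int_set_gaps: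
  fixes A :: "int set"
  assumes "finite A" "card A \<le> N"
  shows "\<exists>p d. A \<subseteq> (\<lambda>i. p + int (gap_pos d i)) ` {..<N}"
proof -
  define xs where "xs = sorted_list_of_set A"
  have xs: "set xs = A" "length xs = card A" "sorted xs" "distinct xs"
    using assms by (auto simp: xs_def)
  define p where "p = xs ! 0"
  \<comment> \<open>Consecutive integers have gap 0, hence the \<open>- 1\<close>. Past the end of
    the list the entries are unspecified, which only affects surplus positions.\<close>
  define d where "d = (\<lambda>l. nat (xs ! Suc l - xs ! l - 1))"
  have "xs ! i = p + int (gap_pos d i)" if "i < length xs" for i
    using that
  proof (induction i)
    case 0
    then show ?case by (simp add: p_def gap_pos_def)
  next
    case (Suc i)
    have "xs ! i \<le> xs ! Suc i" using xs(3) Suc.prems by (intro sorted_nth_mono) auto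
    moreover have "xs ! i \<noteq> xs ! Suc i" using xs(4) Suc.prems by (simp add: nth_eq_iff_index_eq)
    ultimately have "int (d i) = xs ! Suc i - xs ! i - 1" by (simp add: d_def)
    then show ?case using Suc by (simp add: gap_pos_def)
  qed
  then have "A \<subseteq> (\<lambda>i. p + int (gap_pos d i)) ` {..<N}"
    using xs assms(2) by (force simp: in_set_conv_nth)
  then show ?thesis by blast
qed

text \<open>The first cell starts at 0, and \<open>d l\<close> is the length of the gap between
  cells \<open>l\<close> and \<open>l + 1\<close>; overall translations are treated
  separately.\<close>

definition cells :: "nat \<Rightarrow> (nat \<Rightarrow> nat) \<Rightarrow> real set" where
  "cells N d = (\<Union>i<N. {real (gap_pos d i)..<real (gap_pos d i) + 1})"

lemma gap_pos_mono: "i \<le> j \<Longrightarrow> gap_pos d i \<le> gap_pos d j"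
  unfolding gap_pos_def by (intro sum_mono2) auto

lemma gap_pos_Suc: "gap_pos d (Suc i) = gap_pos d i + 1 + d i"
  by (simp add: gap_pos_def)

lemma cells_bounded: "cells N d \<subseteq> {- real (gap_pos d N)..real (gap_pos d N)}"
proof
  fix x assume "x \<in> cells N d"
  then obtain i where i: "i < N" "real (gap_pos d i) \<le> x" "x < real (gap_pos d i) + 1" by (auto simp: cells_def)
  have "gap_pos d i + 1 \<le> gap_pos d (Suc i)" by (simp add: gap_pos_Suc)
  also have "\<dots> \<le> gap_pos d N" using i by (intro gap_pos_mono) simp
  finally show "x \<in> {- real (gap_pos d N)..real (gap_pos d N)}" using i by simp
qed

lemma cells_cong: "(\<And>l. l < N - 1 \<Longrightarrow> d l = d' l) \<Longrightarrow> cells N d = cells N d'"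
  unfolding cells_def gap_pos_def by (intro SUP_cong refl) (auto intro!: arg_cong[of _ _ real] sum.cong)

lemma gap_pos_upd_le: "i \<le> j \<Longrightarrow> gap_pos (d(j := 0)) i = gap_pos d i"
  unfolding gap_pos_def by (intro sum.cong) auto

lemma gap_pos_upd_gt: "j < i \<Longrightarrow> gap_pos d i = gap_pos (d(j := 0)) i + d j"
proof (induction i)
  case (Suc i)
  then show ?case using gap_pos_upd_le[of i j d]
    by (cases "j = i") (auto simp: gap_pos_Suc fun_upd_apply[of d _ 0 i] simp del: fun_upd_apply)
qed simp

lemma lebesgue_shift_sets: "A \<in> sets lebesgue \<Longrightarrow> {x::real. x + t \<in> A} \<in> sets lebesgue"
proof -
  assume A: "A \<in> sets lebesgue"
  have m: "(\<lambda>x. t + 1 * x) \<in> lebesgue \<rightarrow>\<^sub>M (lebesgue :: real measure)"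
    using lebesgue_affine_measurable[where c="\<lambda>x::real. 1" and t=t] by simp
  show ?thesis using measurable_sets[OF m A] by (simp add: vimage_def add.commute)
qed

lemma emeasure_lebesgue_shift:
  assumes A: "A \<in> sets lebesgue" shows "emeasure lebesgue {x::real. x + t \<in> A} = emeasure lebesgue A"
proof -
  have "emeasure lebesgue A = (\<integral>\<^sup>+ x. indicator A x \<partial>lebesgue)" using A by simp
  also have "\<dots> = (\<integral>\<^sup>+ x. indicator A (t + 1 * x) \<partial>lebesgue)"
    using A by (subst nn_integral_real_affine_lebesgue[where c=1 and t=t]) auto
  also have "\<dots> = (\<integral>\<^sup>+ x. indicator {x. x + t \<in> A} x \<partial>lebesgue)"
    by (intro nn_integral_cong) (auto simp: indicator_def add.commute)
  finally show ?thesis using lebesgue_shift_sets[OF A] by simp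
qed

text \<open>The measure is only bounded above, since \<open>cells N d\<close> may have measure less
  than \<open>s\<close>; equality is restored by \<open>concentration_value_above\<close>.\<close>

definition dual_feasible :: "nat \<Rightarrow> real \<Rightarrow> real set \<Rightarrow> (nat \<Rightarrow> real \<Rightarrow> complex) \<Rightarrow> bool" where
  "dual_feasible K s B \<phi> \<longleftrightarrow> (\<exists>\<Omega>\<in>sets lebesgue. \<Omega> \<subseteq> B \<and> emeasure lebesgue \<Omega> \<le> ennreal s \<and> dual_system K \<Omega> \<phi>)"

definition dual_sup :: "nat \<Rightarrow> real \<Rightarrow> real set \<Rightarrow> real" where
  "dual_sup K s B = Sup (dual_value K ` {\<phi>. dual_feasible K s B \<phi>})"

lemma dual_value_le:
  assumes "B \<subseteq> {-R..R}" "dual_feasible K s B \<phi>" shows "dual_value K \<phi> \<le> real K"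
proof -
  obtain \<Omega> where \<Omega>: "\<Omega> \<in> sets lebesgue" "\<Omega> \<subseteq> B" "dual_system K \<Omega> \<phi>"
    using assms(2) by (auto simp: dual_feasible_def)
  then obtain f where "PW_orthonormal K f" "dual_value K \<phi> \<le> pw_value K \<Omega> f"
    using dual_to_primal[of \<Omega> R K \<phi>] assms(1) by auto
  then show ?thesis using pw_value_le[of K f \<Omega>] \<Omega> by linarith
qed

lemma dual_sup_upper:
  assumes "B \<subseteq> {-R..R}" "dual_feasible K s B \<phi>" shows "dual_value K \<phi> \<le> dual_sup K s B"
  unfolding dual_sup_def using dual_value_le[OF assms(1)] assms(2)
  by (intro cSup_upper bdd_aboveI2[where M="real K"]) auto

lemma dual_feasible_zero: "dual_feasible K s B (\<lambda>_ _. 0)"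
  unfolding dual_feasible_def dual_system_def L2_ortho_def
  by (intro bexI[of _ "{}"]) (auto simp: L2_zero L2_sq_def L2_inner_def)

lemma dual_sup_least:
  assumes "\<And>\<phi>. dual_feasible K s B \<phi> \<Longrightarrow> dual_value K \<phi> \<le> v" shows "dual_sup K s B \<le> v"
  unfolding dual_sup_def using assms dual_feasible_zero by (intro cSup_least) blast+

text \<open>The gap after cell \<open>j\<close> cuts the set into two parts at distance at least
  \<open>d j\<close>, so \<open>dual_rearrange\<close> applies with shift \<open>d j\<close> and
  \<open>b = 1 / d j\<close>. For \<open>d j = 0\<close> both sides agree, division by zero being
  0.\<close>

lemma dual_sup_close_gap:
  assumes s: "s \<ge> 0" and j: "j < N - 1"
  shows "dual_sup K s (cells N d) \<le> dual_sup K s (cells N (d(j := 0))) + (2 * real K * s) / real (d j)"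
proof (cases "d j = 0")
  case True
  then have "d(j := 0) = d" by auto
  then show ?thesis using True by simp
next
  case False
  let ?d' = "d(j := 0)"
  have "dual_value K \<phi> \<le> dual_sup K s (cells N ?d') + (2 * real K * s) / real (d j)"
    if \<phi>: "dual_feasible K s (cells N d) \<phi>" for \<phi>
  proof -
    obtain \<Omega> where \<Omega>: "\<Omega> \<in> sets lebesgue" "\<Omega> \<subseteq> cells N d" "emeasure lebesgue \<Omega> \<le> ennreal s" "dual_system K \<Omega> \<phi>"
      using \<phi> by (auto simp: dual_feasible_def)
    define X where "X = {..<real (gap_pos d (Suc j))}"
    define t where "t = real (d j)"
    have left: "\<exists>i\<le>j. i < N \<and> x \<in> {real (gap_pos d i)..<real (gap_pos d i) + 1} \<and> x < real (gap_pos d j) + 1"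
      if x: "x \<in> \<Omega>" "x \<in> X" for x
    proof -
      obtain i where i: "i < N" "x \<in> {real (gap_pos d i)..<real (gap_pos d i) + 1}"
        using x \<Omega>(2) by (auto simp: cells_def)
      have "i \<le> j"
      proof (rule ccontr)
        assume "\<not> i \<le> j"
        then have "gap_pos d (Suc j) \<le> gap_pos d i" by (intro gap_pos_mono) simp
        then show False using i x(2) by (simp add: X_def)
      qed
      moreover from this have "gap_pos d i \<le> gap_pos d j" by (rule gap_pos_mono)
      then have "x < real (gap_pos d j) + 1" using i(2) by simp
      ultimately show ?thesis using i by blast
    qed
    have right: "\<exists>i>j. i < N \<and> x \<in> {real (gap_pos d i)..<real (gap_pos d i) + 1} \<and> x \<ge> real (gap_pos d j) + 1 + t"
      if x: "x \<in> \<Omega>" "x \<notin> X" for x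
    proof -
      obtain i where i: "i < N" "x \<in> {real (gap_pos d i)..<real (gap_pos d i) + 1}"
        using x \<Omega>(2) by (auto simp: cells_def)
      have "i > j"
      proof (rule ccontr)
        assume "\<not> i > j"
        then have "gap_pos d i \<le> gap_pos d j" by (intro gap_pos_mono) simp
        then have "x < real (gap_pos d (Suc j))" using i(2) by (simp add: gap_pos_Suc)
        then show False using x(2) by (simp add: X_def)
      qed
      moreover have "x \<ge> real (gap_pos d j) + 1 + t" using x(2) by (simp add: X_def gap_pos_Suc t_def)
      ultimately show ?thesis using i by blast
    qed
    define \<Omega>' where "\<Omega>' = {x. x \<in> \<Omega> \<and> x \<in> X \<or> x + t \<in> \<Omega> \<and> x + t \<notin> X}"
    have t: "t > 0" using False by (simp add: t_def)
    have "\<exists>\<phi>'. dual_system K \<Omega>' \<phi>' \<and> dual_value K \<phi> \<le> dual_value K \<phi>' + 2 * real K * (1 / t) * s"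
      unfolding \<Omega>'_def
    proof (rule dual_rearrange[OF \<Omega>(4,1) order_trans[OF \<Omega>(2) cells_bounded] \<Omega>(3) s])
      show "X \<in> sets lebesgue" by (simp add: X_def)
      show "x + t \<in> X" if "x \<in> \<Omega>" "x \<in> X" "x + t \<in> \<Omega>" for x
        using left[OF that(1,2)] right[OF that(3)] by fastforce
      show "cmod (sinc_kernel (x - y)) \<le> 1 / t" if "x \<in> \<Omega>" "x \<in> X" "y \<in> \<Omega>" "y \<notin> X" for x y
      proof -
        have "t \<le> \<bar>x - y\<bar>" "x - y \<noteq> 0" using left[OF that(1,2)] right[OF that(3,4)] t by fastforce+
        then have "cmod (sinc_kernel (x - y)) \<le> 1 / \<bar>x - y\<bar>" by (intro sinc_kernel_le_inverse)
        also have "\<dots> \<le> 1 / t" using t \<open>t \<le> \<bar>x - y\<bar>\<close> by (intro divide_left_mono) auto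
        finally show ?thesis .
      qed
    qed (use t in simp)
    then obtain \<phi>' where \<phi>': "dual_system K \<Omega>' \<phi>'" "dual_value K \<phi> \<le> dual_value K \<phi>' + 2 * real K * (1 / t) * s" by blast
    have parts: "\<Omega>' = (\<Omega> \<inter> X) \<union> {x. x + t \<in> \<Omega> - X}" by (auto simp: \<Omega>'_def)
    have X: "X \<in> sets lebesgue" by (simp add: X_def)
    have PS: "\<Omega> \<inter> X \<in> sets lebesgue" "\<Omega> - X \<in> sets lebesgue" using \<Omega>(1) X by (auto intro: sets.Int sets.Diff)
    have "\<Omega>' \<in> sets lebesgue" unfolding parts using PS lebesgue_shift_sets[OF PS(2)] by (intro sets.Un)
    moreover have "emeasure lebesgue \<Omega>' \<le> ennreal s"
    proof -
      have "emeasure lebesgue \<Omega>' \<le> emeasure lebesgue (\<Omega> \<inter> X) + emeasure lebesgue {x. x + t \<in> \<Omega> - X}"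
        unfolding parts using PS lebesgue_shift_sets[OF PS(2)] by (intro emeasure_subadditive)
      also have "\<dots> = emeasure lebesgue (\<Omega> \<inter> X) + emeasure lebesgue (\<Omega> - X)"
        by (simp only: emeasure_lebesgue_shift[OF PS(2)])
      also have "\<dots> = emeasure lebesgue ((\<Omega> \<inter> X) \<union> (\<Omega> - X))" using PS by (intro plus_emeasure) auto
      also have "(\<Omega> \<inter> X) \<union> (\<Omega> - X) = \<Omega>" by auto
      finally show ?thesis using \<Omega>(3) by simp
    qed
    moreover have "\<Omega>' \<subseteq> cells N ?d'"
    proof
      fix x assume "x \<in> \<Omega>'"
      then consider "x \<in> \<Omega>" "x \<in> X" | "x + t \<in> \<Omega>" "x + t \<notin> X" by (auto simp: \<Omega>'_def)
      then show "x \<in> cells N ?d'"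
      proof cases
        case 1
        then obtain i where i: "i \<le> j" "i < N" "x \<in> {real (gap_pos d i)..<real (gap_pos d i) + 1}" using left by blast
        have "x \<in> {real (gap_pos ?d' i)..<real (gap_pos ?d' i) + 1}" using i(3) gap_pos_upd_le[OF i(1), of d] by simp
        then show ?thesis using i(2) unfolding cells_def by blast
      next
        case 2
        then obtain i where i: "i > j" "i < N" "x + t \<in> {real (gap_pos d i)..<real (gap_pos d i) + 1}" using right by blast
        have "x \<in> {real (gap_pos ?d' i)..<real (gap_pos ?d' i) + 1}" using i(3) gap_pos_upd_gt[OF i(1), of d] by (simp add: t_def)
        then show ?thesis using i(2) unfolding cells_def by blast
      qed
    qed
    ultimately have "dual_feasible K s (cells N ?d') \<phi>'" using \<phi>'(1) by (auto simp: dual_feasible_def)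
    then have "dual_value K \<phi>' \<le> dual_sup K s (cells N ?d')" by (rule dual_sup_upper[OF cells_bounded])
    then show ?thesis using \<phi>'(2) by (simp add: t_def)
  qed
  then show ?thesis by (rule dual_sup_least)
qed

text \<open>Only the first \<open>N - 1\<close> gaps influence \<open>cells N d\<close>. Setting the
  others to 0 leaves finitely many coordinates for \<open>fun_max_if_zeroing_bound\<close>.\<close>

lemma dual_sup_cells_max:
  assumes s: "s \<ge> 0" shows "\<exists>m. \<forall>d. dual_sup K s (cells N d) \<le> dual_sup K s (cells N m)"
proof -
  have "\<exists>m. (\<forall>i. i \<notin> {..<N - 1} \<longrightarrow> m i = 0) \<and>
      (\<forall>d. (\<forall>i. i \<notin> {..<N - 1} \<longrightarrow> d i = 0) \<longrightarrow> dual_sup K s (cells N d) \<le> dual_sup K s (cells N m))"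
    using fun_max_if_zeroing_bound[of "{..<N - 1}" "\<lambda>d. dual_sup K s (cells N d)" "2 * real K * s" "\<lambda>_. 0"]
      dual_sup_close_gap[OF s] by simp
  then obtain m where m: "\<And>d. (\<forall>i. i \<notin> {..<N - 1} \<longrightarrow> d i = 0) \<Longrightarrow> dual_sup K s (cells N d) \<le> dual_sup K s (cells N m)"
    by blast
  have "dual_sup K s (cells N d) \<le> dual_sup K s (cells N m)" for d
  proof -
    have "cells N d = cells N (\<lambda>i. if i < N - 1 then d i else 0)" by (rule cells_cong) simp
    then show ?thesis using m[of "\<lambda>i. if i < N - 1 then d i else 0"] by simp
  qed
  then show ?thesis by blast
qed

section \<open>Bounded windows\<close>

text \<open>The estimates of \<open>spectral_entire\<close> at norm one. They are uniform over all
  orthonormal systems and invariant under real translations, which allows limits of recentred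
  systems.\<close>

definition pw_entire :: "(complex \<Rightarrow> complex) \<Rightarrow> bool" where
  "pw_entire F \<longleftrightarrow> F holomorphic_on UNIV \<and> (\<forall>z. cmod (F z) \<le> exp (pi * \<bar>Im z\<bar>)) \<and>
    (\<forall>x y. cmod (F (complex_of_real x) - F (complex_of_real y)) \<le> pi * \<bar>x - y\<bar>)"

definition pw_density :: "nat \<Rightarrow> (nat \<Rightarrow> complex \<Rightarrow> complex) \<Rightarrow> real \<Rightarrow> real" where
  "pw_density K F x = (\<Sum>k=1..K. (cmod (F k (complex_of_real x)))\<^sup>2)"

lemma PW_orthonormal_entire:
  assumes f: "PW_orthonormal K f"
  shows "\<exists>F. \<forall>k\<in>{1..K}. pw_entire (F k) \<and> (AE x in lebesgue. f k x = F k (complex_of_real x))"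
proof -
  have "\<exists>F. pw_entire F \<and> (AE x in lebesgue. f k x = F (complex_of_real x))" if k: "k \<in> {1..K}" for k
  proof -
    have "f k \<in> PW" "L2_sq (f k) = 1" using f k by (auto simp: pw_orthonormal_iff)
    then obtain g where "spectral (f k) g" using PW_spectral by blast
    from spectral_entire[OF this] \<open>L2_sq (f k) = 1\<close> show ?thesis by (auto simp: pw_entire_def)
  qed
  then show ?thesis by (intro bchoice) blast
qed

lemma pw_entire_real_continuous: "F holomorphic_on UNIV \<Longrightarrow> continuous_on A (\<lambda>x. F (complex_of_real x))"
  by (rule continuous_on_compose2[OF holomorphic_on_imp_continuous_on]) (auto intro: continuous_intros)

lemma pw_entire_real_le_1: "pw_entire F \<Longrightarrow> cmod (F (complex_of_real x)) \<le> 1"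
  unfolding pw_entire_def by (metis Im_complex_of_real abs_zero exp_zero mult_zero_right)

text \<open>Induction on \<open>K\<close>, refining the subsequence once per component; on a compact
  set \<open>\<bar>Im z\<bar>\<close> is bounded, which makes the family locally bounded.\<close>

lemma pw_montel:
  fixes F :: "nat \<Rightarrow> nat \<Rightarrow> complex \<Rightarrow> complex"
  assumes "\<And>n k. k \<in> {1..K} \<Longrightarrow> F n k holomorphic_on UNIV"
    and "\<And>n k z. k \<in> {1..K} \<Longrightarrow> cmod (F n k z) \<le> exp (pi * \<bar>Im z\<bar>)"
  shows "\<exists>r G. strict_mono (r :: nat \<Rightarrow> nat) \<and>
    (\<forall>k\<in>{1..K}. G k holomorphic_on UNIV \<and> (\<forall>z. (\<lambda>n. F (r n) k z) \<longlonglongrightarrow> G k z))"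
  using assms
proof (induction K)
  case 0
  show ?case by (intro exI[of _ id]) (auto simp: strict_mono_def)
next
  case (Suc K)
  have "\<exists>r G. strict_mono (r :: nat \<Rightarrow> nat) \<and>
      (\<forall>k\<in>{1..K}. G k holomorphic_on UNIV \<and> (\<forall>z. (\<lambda>n. F (r n) k z) \<longlonglongrightarrow> G k z))"
    by (rule Suc.IH) (simp_all add: Suc.prems)
  then obtain r G where r: "strict_mono (r :: nat \<Rightarrow> nat)"
    and G: "\<forall>k\<in>{1..K}. G k holomorphic_on UNIV \<and> (\<forall>z. (\<lambda>n. F (r n) k z) \<longlonglongrightarrow> G k z)"
    by blast
  let ?F = "\<lambda>n. F (r n) (Suc K)"
  have bd: "\<exists>B. \<forall>h\<in>range ?F. \<forall>z\<in>C. cmod (h z) \<le> B" if C: "compact C" for C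
  proof -
    obtain B where B: "\<And>z. z \<in> C \<Longrightarrow> cmod z \<le> B" using compact_imp_bounded[OF C] by (auto simp: bounded_iff)
    have "cmod (?F n z) \<le> exp (pi * B)" if "z \<in> C" for n z
    proof -
      have "\<bar>Im z\<bar> \<le> B" using B[OF that] abs_Im_le_cmod[of z] by linarith
      then have "exp (pi * \<bar>Im z\<bar>) \<le> exp (pi * B)" by simp
      then show ?thesis by (rule order_trans[OF Suc.prems(2)[of "Suc K" "r n" z], rotated]) simp
    qed
    then show ?thesis by blast
  qed
  have hol: "\<And>h. h \<in> range ?F \<Longrightarrow> h holomorphic_on UNIV" using Suc.prems(1) by auto
  obtain g q where g: "g holomorphic_on UNIV" and q: "strict_mono (q :: nat \<Rightarrow> nat)"
    and lim: "\<And>z. z \<in> UNIV \<Longrightarrow> ((\<lambda>n. ?F (q n) z) \<longlongrightarrow> g z) sequentially"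
    by (rule Montel[OF open_UNIV hol bd, where \<F>="?F"]) auto
  have "(\<lambda>n. F ((r \<circ> q) n) k z) \<longlonglongrightarrow> G k z" if "k \<in> {1..K}" for k z
    using LIMSEQ_subseq_LIMSEQ[OF _ q, of "\<lambda>n. F (r n) k z"] G that by (auto simp: o_def)
  then have "\<forall>k\<in>{1..Suc K}. (G(Suc K := g)) k holomorphic_on UNIV \<and> (\<forall>z. (\<lambda>n. F ((r \<circ> q) n) k z) \<longlonglongrightarrow> (G(Suc K := g)) k z)"
    using G g lim by (auto simp: le_Suc_eq)
  then show ?case using strict_mono_o[OF r q] by blast
qed

lemma pw_density_continuous: "(\<And>k. k \<in> {1..K} \<Longrightarrow> F k holomorphic_on UNIV) \<Longrightarrow> continuous_on A (pw_density K F)"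
  unfolding pw_density_def by (intro continuous_intros pw_entire_real_continuous)

lemma pw_density_nonneg: "pw_density K F x \<ge> 0"
  unfolding pw_density_def by (intro sum_nonneg) simp

lemma pw_density_le:
  assumes "\<And>k. k \<in> {1..K} \<Longrightarrow> cmod (F k (complex_of_real x)) \<le> 1" shows "pw_density K F x \<le> real K"
proof -
  have "pw_density K F x \<le> (\<Sum>k=1..K. 1)"
    unfolding pw_density_def using assms by (intro sum_mono) (simp add: power_le_one)
  then show ?thesis by simp
qed

lemma pw_density_integrable_bounded:
  assumes F: "\<And>k. k \<in> {1..K} \<Longrightarrow> F k holomorphic_on UNIV"
    and le: "\<And>k x. k \<in> {1..K} \<Longrightarrow> cmod (F k (complex_of_real x)) \<le> 1"
    and A: "A \<in> sets lebesgue" "A \<subseteq> {-R..R}"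
  shows "integrable lebesgue (\<lambda>x. indicator A x * pw_density K F x)"
proof (rule Bochner_Integration.integrable_bound)
  show "integrable lebesgue (\<lambda>x. indicat_real {-R..R} x * real K)"
    by (intro integrable_mult_left integrable_real_indicator) (auto simp: emeasure_lborel_Icc_eq)
  have "pw_density K F \<in> borel_measurable lebesgue"
    by (intro continuous_lebesgue_measurable pw_density_continuous F)
  then show "(\<lambda>x. indicator A x * pw_density K F x) \<in> borel_measurable lebesgue"
    using A by (intro borel_measurable_times borel_measurable_indicator)
  show "AE x in lebesgue. norm (indicat_real A x * pw_density K F x) \<le> norm (indicat_real {-R..R} x * real K)"
    using A(2) pw_density_le[of K F, OF le] pw_density_nonneg[of K F] by (intro AE_I2) (auto simp: indicator_def)
qed

lemma pw_value_density:
  assumes f: "PW_orthonormal K f" and \<Omega>: "\<Omega> \<in> sets lebesgue"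
    and F: "\<And>k. k \<in> {1..K} \<Longrightarrow> F k holomorphic_on UNIV" "\<And>k. k \<in> {1..K} \<Longrightarrow> AE x in lebesgue. f k x = F k (complex_of_real x)"
  shows "integrable lebesgue (pw_density K F)" "pw_value K \<Omega> f = (LINT x|lebesgue. indicator \<Omega> x * pw_density K F x)"
    "(LINT x|lebesgue. pw_density K F x) = real K"
proof -
  have m: "(\<lambda>x. F k (complex_of_real x)) \<in> borel_measurable lebesgue" if "k \<in> {1..K}" for k
    by (intro continuous_lebesgue_measurable pw_entire_real_continuous F(1)[OF that])
  have fL: "f k \<in> L2" "L2_sq (f k) = 1" if "k \<in> {1..K}" for k
    using f that PW_subset_L2 by (auto simp: pw_orthonormal_iff)
  have FL: "(\<lambda>x. F k (complex_of_real x)) \<in> L2" "L2_sq (\<lambda>x. F k (complex_of_real x)) = 1" if k: "k \<in> {1..K}" for k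
    using L2_AE_cong[OF fL(1)[OF k] m[OF k] F(2)[OF k]] fL(2)[OF k] by auto
  have i: "integrable lebesgue (\<lambda>x. (cmod (F k (complex_of_real x)))\<^sup>2)" if k: "k \<in> {1..K}" for k
    by (rule L2_sq_integrable[OF FL(1)[OF k]])
  show "integrable lebesgue (pw_density K F)"
    unfolding pw_density_def[abs_def] by (intro Bochner_Integration.integrable_sum i)
  have "(LINT x|lebesgue. pw_density K F x) = (\<Sum>k=1..K. L2_sq (\<lambda>x. F k (complex_of_real x)))"
    unfolding pw_density_def L2_sq_def by (intro Bochner_Integration.integral_sum i)
  then show "(LINT x|lebesgue. pw_density K F x) = real K" by (simp add: FL(2))
  have ir: "integrable lebesgue (\<lambda>x. indicat_real \<Omega> x * (cmod (F k (complex_of_real x)))\<^sup>2)" if k: "k \<in> {1..K}" for k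
    using integrable_mult_indicator[OF \<Omega> i[OF k]] by simp
  have "(LINT x:\<Omega>|lebesgue. (cmod (f k x))\<^sup>2) = (LINT x|lebesgue. indicat_real \<Omega> x * (cmod (F k (complex_of_real x)))\<^sup>2)"
    if k: "k \<in> {1..K}" for k
    unfolding set_lebesgue_integral_def
  proof (rule integral_cong_AE)
    show "(\<lambda>x. indicat_real \<Omega> x *\<^sub>R (cmod (f k x))\<^sup>2) \<in> borel_measurable lebesgue"
      using integrable_mult_indicator[OF \<Omega> L2_sq_integrable[OF fL(1)[OF k]]] by (rule borel_measurable_integrable)
    show "(\<lambda>x. indicat_real \<Omega> x * (cmod (F k (complex_of_real x)))\<^sup>2) \<in> borel_measurable lebesgue"
      using ir[OF k] by (rule borel_measurable_integrable)
    show "AE x in lebesgue. indicat_real \<Omega> x *\<^sub>R (cmod (f k x))\<^sup>2 = indicat_real \<Omega> x * (cmod (F k (complex_of_real x)))\<^sup>2"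
      using F(2)[OF k] by eventually_elim simp
  qed
  then have "pw_value K \<Omega> f = (\<Sum>k=1..K. LINT x|lebesgue. indicat_real \<Omega> x * (cmod (F k (complex_of_real x)))\<^sup>2)"
    by (intro sum.cong) auto
  also have "\<dots> = (LINT x|lebesgue. (\<Sum>k=1..K. indicat_real \<Omega> x * (cmod (F k (complex_of_real x)))\<^sup>2))"
    by (intro Bochner_Integration.integral_sum[symmetric] ir)
  finally show "pw_value K \<Omega> f = (LINT x|lebesgue. indicator \<Omega> x * pw_density K F x)"
    by (simp add: pw_density_def sum_distrib_left)
qed

lemma sincs_orthonormal: "PW_orthonormal K sincs"
  by (auto simp: PW_orthonormal_def sincs_PW sincs_inner)

text \<open>Mass that escapes to infinity is invisible in the window, where the densities converge
  in \<open>L^1\<close>. The bound \<open>v\<close> is a value of the unrestricted problem, since it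
  is reached through the dual and its set may leave the window when it is enlarged to measure
  \<open>s\<close>.\<close>

lemma window_attained:
  assumes s: "s > 0"
  shows "\<exists>v\<in>concentration_values K s. \<forall>\<Omega> f. \<Omega> \<in> sets lebesgue \<and> \<Omega> \<subseteq> {-R..R} \<and> emeasure lebesgue \<Omega> \<le> ennreal s \<and>
    PW_orthonormal K f \<longrightarrow> pw_value K \<Omega> f \<le> v"
proof -
  define S where "S = {pw_value K \<Omega> f | \<Omega> f. \<Omega> \<in> sets lebesgue \<and> \<Omega> \<subseteq> {-R..R} \<and> emeasure lebesgue \<Omega> \<le> ennreal s \<and> PW_orthonormal K f}"
  have Sne: "pw_value K {} sincs \<in> S" unfolding S_def using sincs_orthonormal by fastforce
  have Sb: "bdd_above S"
  proof (rule bdd_aboveI[of _ "real K"])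
    fix y assume "y \<in> S"
    then show "y \<le> real K" unfolding S_def using pw_value_le by blast
  qed
  define V where "V = Sup S"
  have "\<exists>\<Omega> f. \<Omega> \<in> sets lebesgue \<and> \<Omega> \<subseteq> {-R..R} \<and> emeasure lebesgue \<Omega> \<le> ennreal s \<and> PW_orthonormal K f
      \<and> V - eps n < pw_value K \<Omega> f" for n
  proof -
    have "V - eps n < Sup S" using eps_pos[of n] by (simp add: V_def)
    then obtain y where y: "y \<in> S" "V - eps n < y" using less_cSup_iff[OF _ Sb] Sne by blast
    then show ?thesis unfolding S_def by blast
  qed
  then obtain \<Omega> f where \<Omega>: "\<And>n. \<Omega> n \<in> sets lebesgue" "\<And>n. \<Omega> n \<subseteq> {-R..R}" "\<And>n. emeasure lebesgue (\<Omega> n) \<le> ennreal s"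
    and f: "\<And>n. PW_orthonormal K (f n)" and V: "\<And>n. V - eps n < pw_value K (\<Omega> n) (f n)" by metis
  have "\<exists>F. \<forall>n. \<forall>k\<in>{1..K}. pw_entire (F n k) \<and> (AE x in lebesgue. f n k x = F n k (complex_of_real x))"
    using PW_orthonormal_entire[OF f] by (intro choice) blast
  then obtain F where F: "\<And>n k. k \<in> {1..K} \<Longrightarrow> pw_entire (F n k)"
    "\<And>n k. k \<in> {1..K} \<Longrightarrow> AE x in lebesgue. f n k x = F n k (complex_of_real x)" by blast
  have Fh: "F n k holomorphic_on UNIV" if "k \<in> {1..K}" for n k using F(1)[OF that] by (simp add: pw_entire_def)
  have Fb: "cmod (F n k z) \<le> exp (pi * \<bar>Im z\<bar>)" if "k \<in> {1..K}" for n k z using F(1)[OF that] by (simp add: pw_entire_def)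
  obtain r G where r: "strict_mono (r :: nat \<Rightarrow> nat)"
    and G: "\<And>k. k \<in> {1..K} \<Longrightarrow> G k holomorphic_on UNIV" "\<And>k z. k \<in> {1..K} \<Longrightarrow> (\<lambda>n. F (r n) k z) \<longlonglongrightarrow> G k z"
    using pw_montel[of K F, OF Fh Fb] by blast
  have F1: "cmod (F n k (complex_of_real x)) \<le> 1" if "k \<in> {1..K}" for n k x
    by (rule pw_entire_real_le_1[OF F(1)[OF that]])
  have G1: "cmod (G k (complex_of_real x)) \<le> 1" if "k \<in> {1..K}" for k x
    by (rule LIMSEQ_le_const2[OF tendsto_norm[OF G(2)[OF that, of "complex_of_real x"]]]) (use F1[OF that] in blast)
  define B where "B = {-R..R}"
  define \<rho> where "\<rho> = (\<lambda>x. indicator B x * pw_density K G x)"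
  have \<rho>: "integrable lebesgue \<rho>" "\<And>x. \<rho> x \<ge> 0"
    unfolding \<rho>_def using pw_density_integrable_bounded[of K G B R] G(1) G1 pw_density_nonneg[of K G] by (auto simp: B_def)
  \<comment> \<open>The sets \<open>\<Omega> n\<close> are not taken to a limit; the optimal set for
    the limit density replaces them all.\<close>
  obtain c \<Omega>s where c: "c \<ge> 0" and \<Omega>s: "\<Omega>s \<in> sets lebesgue" "{x. \<rho> x > c} \<subseteq> \<Omega>s" "\<Omega>s \<subseteq> {x. \<rho> x \<ge> c}" "emeasure lebesgue \<Omega>s = ennreal s"
    using bathtub_level[OF \<rho> s] by blast
  define \<Omega>' where "\<Omega>' = \<Omega>s \<inter> B"
  have \<Omega>': "\<Omega>' \<in> sets lebesgue" "\<Omega>' \<subseteq> {-R..R}" "emeasure lebesgue \<Omega>' \<le> ennreal s"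
  proof -
    show "\<Omega>' \<in> sets lebesgue" unfolding \<Omega>'_def B_def using \<Omega>s(1) by (intro sets.Int) auto
    show "\<Omega>' \<subseteq> {-R..R}" by (simp add: \<Omega>'_def B_def)
    show "emeasure lebesgue \<Omega>' \<le> ennreal s"
      unfolding \<Omega>s(4)[symmetric] using \<Omega>s(1) by (intro emeasure_mono) (auto simp: \<Omega>'_def)
  qed
  define u where "u = (\<lambda>k x. G k (complex_of_real x))"
  have um: "u k \<in> borel_measurable lebesgue" if "k \<in> {1..K}" for k
    unfolding u_def by (intro continuous_lebesgue_measurable pw_entire_real_continuous G(1)[OF that])
  have fin: "emeasure lebesgue \<Omega>' < \<infinity>" using \<Omega>'(3) le_less_trans ennreal_less_top by (metis infinity_ennreal_def)
  have uL: "(\<lambda>x. indicator \<Omega>' x * u k x) \<in> L2" if k: "k \<in> {1..K}" for k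
  proof (rule L2I)
    show "(\<lambda>x. indicator \<Omega>' x * u k x) \<in> borel_measurable lebesgue"
      using um[OF k] \<Omega>'(1) by (intro borel_measurable_times borel_measurable_indicator)
    show "integrable lebesgue (indicat_real \<Omega>')" using \<Omega>'(1) fin by (intro integrable_real_indicator)
    show "(cmod (indicator \<Omega>' x * u k x))\<^sup>2 \<le> indicat_real \<Omega>' x" for x
      using G1[OF k] by (auto simp: u_def indicator_def power_le_one)
  qed
  \<comment> \<open>Mass may escape in the limit, so only this Bessel inequality survives of orthonormality.\<close>
  have bessel: "(\<Sum>k=1..K. (cmod (L2_inner (u k) \<psi>))\<^sup>2) \<le> Re (conc \<psi> \<psi>)"
    if \<psi>: "\<psi> \<in> L2" "\<And>x. x \<notin> \<Omega>' \<Longrightarrow> \<psi> x = 0" for \<psi>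
  proof -
    have \<psi>c: "\<psi> \<in> cL2" using \<psi> \<Omega>'(2) unfolding cL2_def by blast
    have \<psi>i: "integrable lebesgue \<psi>" by (rule cL2_integrable[OF \<psi>c])
    have lim: "(\<lambda>n. L2_inner (f (r n) k) \<psi>) \<longlonglongrightarrow> L2_inner (u k) \<psi>" if k: "k \<in> {1..K}" for k
      unfolding L2_inner_def
    proof (rule integral_dominated_convergence[where w="\<lambda>x. cmod (\<psi> x)"])
      have fL: "f n k \<in> L2" for n using f[of n] k PW_subset_L2 by (auto simp: pw_orthonormal_iff)
      show "(\<lambda>x. f (r n) k x * cnj (\<psi> x)) \<in> borel_measurable lebesgue" for n
        using L2_inner_integrable[OF fL \<psi>(1)] by auto
      show "(\<lambda>x. u k x * cnj (\<psi> x)) \<in> borel_measurable lebesgue"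
        using um[OF k] L2_measurable[OF L2_cnj[OF \<psi>(1)]] by (intro borel_measurable_times)
      show "integrable lebesgue (\<lambda>x. cmod (\<psi> x))" using \<psi>i by auto
      have "AE x in lebesgue. \<forall>n. f n k x = F n k (complex_of_real x)"
        using F(2)[OF k] by (intro AE_all_countable[THEN iffD2] allI)
      then show "AE x in lebesgue. (\<lambda>n. f (r n) k x * cnj (\<psi> x)) \<longlonglongrightarrow> u k x * cnj (\<psi> x)"
        by eventually_elim (auto simp: u_def intro!: tendsto_intros G(2)[OF k])
      show "AE x in lebesgue. cmod (f (r n) k x * cnj (\<psi> x)) \<le> cmod (\<psi> x)" for n
        using F(2)[OF k, of "r n"] by eventually_elim (use F1[OF k] in \<open>auto simp: norm_mult intro!: mult_left_le_one_le\<close>)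
    qed
    have "(\<lambda>n. \<Sum>k=1..K. (cmod (L2_inner (f (r n) k) \<psi>))\<^sup>2) \<longlonglongrightarrow> (\<Sum>k=1..K. (cmod (L2_inner (u k) \<psi>))\<^sup>2)"
      by (intro tendsto_intros lim)
    then show ?thesis using PW_bessel[OF f \<psi>c] by (intro LIMSEQ_le_const2) blast+
  qed
  obtain \<phi> where \<phi>: "dual_system K \<Omega>' \<phi>" "pw_value K \<Omega>' u \<le> dual_value K \<phi>"
    using primal_to_dual[OF \<Omega>'(1,2) uL bessel] by blast
  obtain v where v: "v \<in> concentration_values K s" "dual_value K \<phi> \<le> v"
    using concentration_value_above[OF \<Omega>' s \<phi>(1)] by blast
  have uval: "pw_value K \<Omega>' u = (LINT x:\<Omega>s|lebesgue. \<rho> x)"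
  proof -
    have iu: "integrable lebesgue (\<lambda>x. indicat_real \<Omega>' x * (cmod (u k x))\<^sup>2)" if k: "k \<in> {1..K}" for k
    proof -
      have "(\<lambda>x. (cmod (indicator \<Omega>' x * u k x))\<^sup>2) = (\<lambda>x. indicat_real \<Omega>' x * (cmod (u k x))\<^sup>2)"
        by (auto simp: indicator_def)
      then show ?thesis using L2_sq_integrable[OF uL[OF k]] by simp
    qed
    have "pw_value K \<Omega>' u = (LINT x|lebesgue. (\<Sum>k=1..K. indicat_real \<Omega>' x * (cmod (u k x))\<^sup>2))"
      unfolding set_lebesgue_integral_def real_scaleR_def by (intro Bochner_Integration.integral_sum[symmetric] iu)
    also have "\<dots> = (LINT x:\<Omega>s|lebesgue. \<rho> x)"
      unfolding set_lebesgue_integral_def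
      by (intro Bochner_Integration.integral_cong) (auto simp: \<rho>_def \<Omega>'_def u_def pw_density_def indicator_def)
    finally show ?thesis .
  qed
  define D where "D = (\<lambda>n. LINT x|lebesgue. \<bar>indicator B x * pw_density K (F (r n)) x - \<rho> x\<bar>)"
  have iF: "integrable lebesgue (\<lambda>x. indicator B x * pw_density K (F n) x)" for n
    using pw_density_integrable_bounded[of K "F n" B R] Fh F1 by (auto simp: B_def)
  have D: "D \<longlonglongrightarrow> 0"
  proof -
    have "(\<lambda>n. LINT x|lebesgue. \<bar>indicator B x * pw_density K (F (r n)) x - \<rho> x\<bar>) \<longlonglongrightarrow> (LINT x|(lebesgue :: real measure). 0)"
    proof (rule integral_dominated_convergence[where w="\<lambda>x. 2 * real K * indicat_real B x"])
      show "integrable lebesgue (\<lambda>x. 2 * real K * indicat_real B x)"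
        unfolding B_def by (intro integrable_mult_right integrable_real_indicator) (auto simp: emeasure_lborel_Icc_eq)
      show "(\<lambda>x. \<bar>indicator B x * pw_density K (F (r n)) x - \<rho> x\<bar>) \<in> borel_measurable lebesgue" for n
        using iF[of "r n"] \<rho>(1) by (intro borel_measurable_abs borel_measurable_diff borel_measurable_integrable)
      show "AE x in lebesgue. norm \<bar>indicator B x * pw_density K (F (r n)) x - \<rho> x\<bar> \<le> 2 * real K * indicat_real B x" for n
      proof (rule AE_I2)
        fix x
        have "pw_density K (F (r n)) x \<le> real K" "pw_density K G x \<le> real K" by (intro pw_density_le F1 G1; assumption)+
        then show "norm \<bar>indicator B x * pw_density K (F (r n)) x - \<rho> x\<bar> \<le> 2 * real K * indicat_real B x"
          using pw_density_nonneg[of K "F (r n)" x] pw_density_nonneg[of K G x] by (auto simp: \<rho>_def indicator_def)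
      qed
      show "AE x in lebesgue. (\<lambda>n. \<bar>indicator B x * pw_density K (F (r n)) x - \<rho> x\<bar>) \<longlonglongrightarrow> 0"
      proof (rule AE_I2)
        fix x
        have "(\<lambda>n. pw_density K (F (r n)) x) \<longlonglongrightarrow> pw_density K G x"
          unfolding pw_density_def by (intro tendsto_intros G(2))
        then have "(\<lambda>n. \<bar>indicator B x * pw_density K (F (r n)) x - \<rho> x\<bar>) \<longlonglongrightarrow> \<bar>indicator B x * pw_density K G x - \<rho> x\<bar>"
          by (intro tendsto_intros)
        then show "(\<lambda>n. \<bar>indicator B x * pw_density K (F (r n)) x - \<rho> x\<bar>) \<longlonglongrightarrow> 0" by (simp add: \<rho>_def)
      qed
    qed simp
    then show ?thesis by (simp add: D_def)
  qed
  \<comment> \<open>Exchanging the density for its limit costs at most \<open>D n\<close> whatever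
    the set, and for the limit density \<open>\<Omega>s\<close> is at least as good as
    \<open>\<Omega> (r n)\<close>.\<close>
  have step: "V - eps (r n) \<le> pw_value K \<Omega>' u + D n" for n
  proof -
    let ?w = "\<Omega> (r n)"
    have iw: "integrable lebesgue (\<lambda>x. indicat_real ?w x * \<rho> x)"
      using integrable_mult_indicator[OF \<Omega>(1) \<rho>(1)] by simp
    have "pw_value K ?w (f (r n)) = (LINT x|lebesgue. indicator ?w x * pw_density K (F (r n)) x)"
      using pw_value_density(2)[OF f \<Omega>(1), of "F (r n)" "r n" "r n"] Fh F(2) by blast
    also have "\<dots> \<le> (LINT x|lebesgue. indicat_real ?w x * \<rho> x + \<bar>indicator B x * pw_density K (F (r n)) x - \<rho> x\<bar>)"
    proof (rule integral_mono)
      show "integrable lebesgue (\<lambda>x. indicator ?w x * pw_density K (F (r n)) x)"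
        using pw_density_integrable_bounded[of K "F (r n)" ?w R] Fh F1 \<Omega> by blast
      show "integrable lebesgue (\<lambda>x. indicat_real ?w x * \<rho> x + \<bar>indicator B x * pw_density K (F (r n)) x - \<rho> x\<bar>)"
        using iw iF[of "r n"] \<rho>(1) by (intro Bochner_Integration.integrable_add integrable_abs Bochner_Integration.integrable_diff)
      fix x
      show "indicator ?w x * pw_density K (F (r n)) x \<le> indicat_real ?w x * \<rho> x + \<bar>indicator B x * pw_density K (F (r n)) x - \<rho> x\<bar>"
        using \<Omega>(2)[of "r n"] by (auto simp: indicator_def B_def)
    qed
    also have "\<dots> = (LINT x|lebesgue. indicat_real ?w x * \<rho> x) + D n"
      unfolding D_def using iw iF[of "r n"] \<rho>(1)
      by (intro Bochner_Integration.integral_add integrable_abs Bochner_Integration.integrable_diff)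
    also have "(LINT x|lebesgue. indicat_real ?w x * \<rho> x) = (LINT x:?w|lebesgue. \<rho> x)"
      by (simp add: set_lebesgue_integral_def)
    also have "\<dots> \<le> (LINT x:\<Omega>s|lebesgue. \<rho> x)"
      using s by (intro bathtub_optimal[OF \<rho>(1) c _ \<Omega>s \<Omega>(1,3)]) simp
    finally show ?thesis using V[of "r n"] uval by linarith
  qed
  have "(\<lambda>n. V - eps (r n)) \<longlonglongrightarrow> V - 0"
    using LIMSEQ_subseq_LIMSEQ[OF eps_tendsto r] by (intro tendsto_intros) (simp add: o_def)
  moreover have "(\<lambda>n. pw_value K \<Omega>' u + D n) \<longlonglongrightarrow> pw_value K \<Omega>' u + 0" by (intro tendsto_intros D)
  ultimately have "V - 0 \<le> pw_value K \<Omega>' u + 0" using step by (intro LIMSEQ_le) blast+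
  then have Vv: "V \<le> v" using \<phi>(2) v(2) by simp
  have up: "pw_value K A g \<le> V" if "A \<in> sets lebesgue" "A \<subseteq> {-R..R}" "emeasure lebesgue A \<le> ennreal s" "PW_orthonormal K g" for A g
  proof -
    have "pw_value K A g \<in> S" unfolding S_def using that by blast
    then show ?thesis unfolding V_def by (rule cSup_upper[OF _ Sb])
  qed
  show ?thesis
  proof (rule bexI[OF _ v(1)], intro allI impI)
    fix A g
    assume "A \<in> sets lebesgue \<and> A \<subseteq> {-R..R} \<and> emeasure lebesgue A \<le> ennreal s \<and> PW_orthonormal K g"
    then have "pw_value K A g \<le> V" using up by blast
    then show "pw_value K A g \<le> v" using Vv by (rule order_trans)
  qed
qed

section \<open>Reduction to bounded windows\<close>

text \<open>Otherwise translates of a sequence of counterexamples would converge to a nonzero entire system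
  that vanishes on a set of positive measure.\<close>

lemma pw_density_superlevel:
  fixes K :: nat
  assumes a: "a > 0" and s: "s > 0"
  shows "\<exists>c>0. \<forall>F x0. (\<forall>k\<in>{1..K}. pw_entire (F k)) \<and> a \<le> pw_density K F x0 \<longrightarrow>
    ennreal s < emeasure lebesgue {x. c < pw_density K F x}"
proof (rule ccontr)
  assume "\<not> ?thesis"
  then have "\<exists>F x0. (\<forall>k\<in>{1..K}. pw_entire (F k)) \<and> a \<le> pw_density K F x0 \<and>
      emeasure lebesgue {x. eps n < pw_density K F x} \<le> ennreal s" for n
    using eps_pos[of n] by (meson not_less)
  then obtain F x0 where F: "\<And>n k. k \<in> {1..K} \<Longrightarrow> pw_entire (F n k)" and x0: "\<And>n. a \<le> pw_density K (F n) (x0 n)"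
    and small: "\<And>n. emeasure lebesgue {x. eps n < pw_density K (F n) x} \<le> ennreal s"
    by metis
  \<comment> \<open>Recentring moves the points of height \<open>a\<close> to 0, so the limit system
    does not vanish there.\<close>
  define H where "H = (\<lambda>n k z. F n k (z + complex_of_real (x0 n)))"
  have Hh: "H n k holomorphic_on UNIV" if "k \<in> {1..K}" for n k
  proof -
    have "(F n k \<circ> (\<lambda>z. z + complex_of_real (x0 n))) holomorphic_on UNIV"
      using F[OF that, of n] by (intro holomorphic_on_compose_gen[where t=UNIV]) (auto simp: pw_entire_def intro!: holomorphic_intros)
    then show ?thesis by (simp add: H_def o_def)
  qed
  have Hb: "cmod (H n k z) \<le> exp (pi * \<bar>Im z\<bar>)" if "k \<in> {1..K}" for n k z
    using F[OF that, of n] unfolding pw_entire_def H_def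
    by (metis Im_complex_of_real add.right_neutral plus_complex.sel(2))
  obtain r G where r: "strict_mono (r :: nat \<Rightarrow> nat)"
    and G: "\<And>k. k \<in> {1..K} \<Longrightarrow> G k holomorphic_on UNIV" "\<And>k z. k \<in> {1..K} \<Longrightarrow> (\<lambda>n. H (r n) k z) \<longlonglongrightarrow> G k z"
    using pw_montel[of K H, OF Hh Hb] by blast
  have H_F: "pw_density K (H n) x = pw_density K (F n) (x + x0 n)" for n x
    by (simp add: pw_density_def H_def)
  have lim: "(\<lambda>n. pw_density K (H (r n)) x) \<longlonglongrightarrow> pw_density K G x" for x
    unfolding pw_density_def by (intro tendsto_intros G(2))
  have "a \<le> pw_density K (H n) 0" for n using x0[of n] by (simp add: H_F)
  then have "a \<le> pw_density K G 0" using lim[of 0] by (intro LIMSEQ_le_const[OF lim]) blast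
  then have "pw_density K G 0 \<noteq> 0" using a by simp
  then obtain k where k: "k \<in> {1..K}" "G k 0 \<noteq> 0"
    unfolding pw_density_def by (metis (no_types, lifting) norm_zero of_real_0 sum.neutral zero_power2)
  have "countable {z. G k z = 0}"
  proof (cases "G k constant_on UNIV")
    case True
    then have "{z. G k z = 0} = {}" using k(2) by (auto simp: constant_on_def)
    then show ?thesis by simp
  next
    case False
    then show ?thesis
      using holomorphic_countable_zeros[OF G(1)[OF k(1)] open_UNIV connected_UNIV] by simp
  qed
  then have "countable (complex_of_real -` {z. G k z = 0})"
    by (rule countable_subset[rotated, OF countable_image[where f=Re]]) (auto intro!: image_eqI[where x="complex_of_real _"])
  then have null: "complex_of_real -` {z. G k z = 0} \<in> null_sets lebesgue"
    by (intro countable_imp_null_set_lborel[THEN null_sets_completionI])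
  define Z where "Z = (\<lambda>n. {x. eps (r n) < pw_density K (H (r n)) x})"
  have Zm: "Z n \<in> sets lebesgue" for n
  proof -
    have m: "pw_density K (H (r n)) \<in> borel_measurable lebesgue"
      by (intro continuous_lebesgue_measurable pw_density_continuous Hh)
    show ?thesis using measurable_sets[OF m, of "{eps (r n)<..}"] by (simp add: Z_def vimage_def)
  qed
  have Zs: "emeasure lebesgue (Z n) \<le> ennreal s" for n
  proof -
    let ?A = "{x. eps (r n) < pw_density K (F (r n)) x}"
    have m: "pw_density K (F (r n)) \<in> borel_measurable lebesgue"
      using F by (intro continuous_lebesgue_measurable pw_density_continuous) (auto simp: pw_entire_def)
    have A: "?A \<in> sets lebesgue" using measurable_sets[OF m, of "{eps (r n)<..}"] by (simp add: vimage_def)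
    have "Z n = {x. x + x0 (r n) \<in> ?A}" by (simp add: Z_def H_F)
    then show ?thesis using emeasure_lebesgue_shift[OF A, of "x0 (r n)"] small[of "r n"] by simp
  qed
  \<comment> \<open>Any interval longer than \<open>s\<close> would do. Off the countable zero set
    of \<open>G k\<close> the limit density is positive, so almost every point of \<open>I\<close>
    eventually lies in \<open>Z n\<close>, although \<open>Z n\<close> has measure at most
    \<open>s\<close>.\<close>
  define I where "I = {0..2 * s}"
  have "(\<lambda>n. LINT x|lebesgue. indicat_real (I \<inter> Z n) x) \<longlonglongrightarrow> (LINT x|lebesgue. indicat_real I x)"
  proof (rule integral_dominated_convergence[where w="indicat_real I"])
    show "integrable lebesgue (indicat_real I)"
      unfolding I_def by (intro integrable_real_indicator) (auto simp: emeasure_lborel_Icc_eq)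
    show "indicat_real I \<in> borel_measurable lebesgue" unfolding I_def by (intro borel_measurable_indicator) simp
    show "indicat_real (I \<inter> Z n) \<in> borel_measurable lebesgue" for n
      unfolding I_def using Zm by (intro borel_measurable_indicator sets.Int) auto
    show "AE x in lebesgue. norm (indicat_real (I \<inter> Z n) x) \<le> indicat_real I x" for n
      by (auto simp: indicator_def)
    show "AE x in lebesgue. (\<lambda>n. indicat_real (I \<inter> Z n) x) \<longlonglongrightarrow> indicat_real I x"
      using AE_not_in[OF null]
    proof eventually_elim
      fix x assume "x \<notin> complex_of_real -` {z. G k z = 0}"
      then have "0 < (cmod (G k (complex_of_real x)))\<^sup>2" by simp
      also have "\<dots> \<le> pw_density K G x"
        unfolding pw_density_def using k(1) by (intro member_le_sum) auto
      finally have pos: "pw_density K G x > 0" .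
      have e0: "(\<lambda>n. eps (r n)) \<longlonglongrightarrow> 0" using LIMSEQ_subseq_LIMSEQ[OF eps_tendsto r] by (simp add: o_def)
      have "(\<lambda>n. pw_density K (H (r n)) x - eps (r n)) \<longlonglongrightarrow> pw_density K G x - 0" by (intro tendsto_intros lim e0)
      then have "\<forall>\<^sub>F n in sequentially. 0 < pw_density K (H (r n)) x - eps (r n)"
        using pos by (intro order_tendstoD(1)) auto
      then have "\<forall>\<^sub>F n in sequentially. indicat_real (I \<inter> Z n) x = indicat_real I x"
        by eventually_elim (auto simp: Z_def indicator_def)
      then show "(\<lambda>n. indicat_real (I \<inter> Z n) x) \<longlonglongrightarrow> indicat_real I x" by (rule tendsto_eventually)
    qed
  qed
  moreover have "(LINT x|lebesgue. indicat_real (I \<inter> Z n) x) \<le> s" for n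
  proof -
    have IZ: "I \<inter> Z n \<in> sets lebesgue" unfolding I_def using Zm by (intro sets.Int) auto
    have "emeasure lebesgue (I \<inter> Z n) \<le> emeasure lebesgue (Z n)" using Zm by (intro emeasure_mono) auto
    then have "emeasure lebesgue (I \<inter> Z n) \<le> ennreal s" using Zs[of n] by (rule order_trans)
    then have "measure lebesgue (I \<inter> Z n) \<le> s" using s by (simp add: measure_def enn2real_leI)
    then show ?thesis using IZ by simp
  qed
  ultimately have "(LINT x|lebesgue. indicat_real I x) \<le> s" by (intro LIMSEQ_le_const2) blast+
  moreover have "(LINT x|lebesgue. indicat_real I x) = 2 * s" using s by (simp add: I_def)
  ultimately show False using s by simp
qed

lemma pw_density_lipschitz:
  assumes F: "\<And>k. k \<in> {1..K} \<Longrightarrow> pw_entire (F k)"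
  shows "\<bar>pw_density K F x - pw_density K F y\<bar> \<le> 2 * pi * real K * \<bar>x - y\<bar>"
proof -
  have "\<bar>(cmod (F k (complex_of_real x)))\<^sup>2 - (cmod (F k (complex_of_real y)))\<^sup>2\<bar> \<le> 2 * pi * \<bar>x - y\<bar>" if k: "k \<in> {1..K}" for k
  proof -
    let ?u = "cmod (F k (complex_of_real x))" and ?v = "cmod (F k (complex_of_real y))"
    have 1: "?u \<le> 1" "?v \<le> 1" using pw_entire_real_le_1[OF F[OF k]] by auto
    have "\<bar>?u - ?v\<bar> \<le> cmod (F k (complex_of_real x) - F k (complex_of_real y))" by (rule norm_triangle_ineq3)
    also have "\<dots> \<le> pi * \<bar>x - y\<bar>" using F[OF k] by (simp add: pw_entire_def)
    finally have "(?u + ?v) * \<bar>?u - ?v\<bar> \<le> 2 * (pi * \<bar>x - y\<bar>)" using 1 by (intro mult_mono) auto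
    moreover have "\<bar>?u\<^sup>2 - ?v\<^sup>2\<bar> = (?u + ?v) * \<bar>?u - ?v\<bar>"
      by (simp add: power2_eq_square square_diff_square_factored abs_mult)
    ultimately show ?thesis by simp
  qed
  then have "(\<Sum>k=1..K. \<bar>(cmod (F k (complex_of_real x)))\<^sup>2 - (cmod (F k (complex_of_real y)))\<^sup>2\<bar>) \<le> (\<Sum>k=1..K. 2 * pi * \<bar>x - y\<bar>)"
    by (intro sum_mono)
  moreover have "\<bar>pw_density K F x - pw_density K F y\<bar> \<le> (\<Sum>k=1..K. \<bar>(cmod (F k (complex_of_real x)))\<^sup>2 - (cmod (F k (complex_of_real y)))\<^sup>2\<bar>)"
    unfolding pw_density_def sum_subtractf[symmetric] by (rule sum_abs)
  ultimately show ?thesis by (simp add: mult_ac)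
qed

text \<open>If the density is at least \<open>c\<close> at \<open>x\<close>, the Lipschitz bound
  keeps it above \<open>c / 2\<close> on \<open>[x, x + \<delta>]\<close>, which lies in
  \<open>[m, m + 2]\<close> for \<open>m = \<lfloor>x\<rfloor>\<close> because
  \<open>\<delta> \<le> 1\<close>. Each such \<open>m\<close> thus accounts for mass
  \<open>\<delta> * c / 2\<close>. A point lies in at most three of these closed intervals and the
  total mass is \<open>K\<close>, whence \<open>6 * K / (\<delta> * c)\<close>.\<close>

lemma card_superlevel_cells:
  assumes K: "K \<ge> 1" and c: "c > 0" and F: "\<And>k. k \<in> {1..K} \<Longrightarrow> pw_entire (F k)"
    and int: "integrable lebesgue (pw_density K F)" "(LINT x|lebesgue. pw_density K F x) = real K"
  defines "\<delta> \<equiv> min 1 (c / (4 * pi * real K))"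
  defines "N \<equiv> nat \<lceil>6 * real K / (\<delta> * c)\<rceil>"
  shows "finite {\<lfloor>x\<rfloor> | x. c \<le> pw_density K F x}" "card {\<lfloor>x\<rfloor> | x. c \<le> pw_density K F x} \<le> N"
proof -
  let ?A = "{\<lfloor>x\<rfloor> | x. c \<le> pw_density K F x}"
  let ?\<rho> = "pw_density K F"
  have \<delta>: "\<delta> > 0" "\<delta> \<le> 1" "\<delta> \<le> c / (4 * pi * real K)" using c K by (auto simp: \<delta>_def)
  let ?J = "\<lambda>m::int. {real_of_int m..real_of_int m + 2}"
  have ij: "integrable lebesgue (\<lambda>x. indicat_real (?J m) x * ?\<rho> x)" for m
    using integrable_mult_indicator[OF _ int(1), of "?J m"] by simp
  have mass: "\<delta> * c / 2 \<le> (LINT x|lebesgue. indicat_real (?J m) x * ?\<rho> x)" if m: "m \<in> ?A" for m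
  proof -
    obtain x where x: "m = \<lfloor>x\<rfloor>" "c \<le> ?\<rho> x" using m by auto
    have "\<delta> * c / 2 = (LINT y|lebesgue. indicat_real {x..x + \<delta>} y * (c / 2))"
      using \<delta> by simp
    also have "\<dots> \<le> (LINT y|lebesgue. indicat_real (?J m) y * ?\<rho> y)"
    proof (intro integral_mono ij)
      show "integrable lebesgue (\<lambda>y. indicat_real {x..x + \<delta>} y * (c / 2))"
        by (intro integrable_mult_left integrable_real_indicator) (auto simp: emeasure_lborel_Icc_eq)
      fix y
      show "indicat_real {x..x + \<delta>} y * (c / 2) \<le> indicat_real (?J m) y * ?\<rho> y"
      proof (cases "y \<in> {x..x + \<delta>}")
        case True
        have "y \<in> ?J m" using True \<delta>(2) x(1) by (auto; linarith)
        have "2 * pi * real K * \<bar>x - y\<bar> \<le> 2 * pi * real K * (c / (4 * pi * real K))"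
          using True \<delta>(3) by (intro mult_left_mono) auto
        also have "\<dots> = c / 2" using K by simp
        finally have "c / 2 \<le> ?\<rho> y" using pw_density_lipschitz[of K F x y, OF F] x(2) by linarith
        then show ?thesis using True \<open>y \<in> ?J m\<close> by simp
      next
        case False
        then show ?thesis using pw_density_nonneg[of K F y] by simp
      qed
    qed
    finally show ?thesis .
  qed
  have card: "card A' \<le> N" if A': "A' \<subseteq> ?A" "finite A'" for A'
  proof -
    have "real (card A') * (\<delta> * c / 2) = (\<Sum>m\<in>A'. \<delta> * c / 2)" by simp
    also have "\<dots> \<le> (\<Sum>m\<in>A'. LINT x|lebesgue. indicat_real (?J m) x * ?\<rho> x)"
      using A' by (intro sum_mono mass) auto
    also have "\<dots> = (LINT x|lebesgue. (\<Sum>m\<in>A'. indicat_real (?J m) x * ?\<rho> x))"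
      by (intro Bochner_Integration.integral_sum[symmetric] ij)
    also have "\<dots> \<le> (LINT x|lebesgue. 3 * ?\<rho> x)"
    proof (intro integral_mono Bochner_Integration.integrable_sum ij)
      show "integrable lebesgue (\<lambda>x. 3 * ?\<rho> x)" using int(1) by simp
      fix x
      have "{m\<in>A'. x \<in> ?J m} \<subseteq> {\<lfloor>x\<rfloor> - 2..\<lfloor>x\<rfloor>}" by (auto; linarith)
      then have "card {m\<in>A'. x \<in> ?J m} \<le> card {\<lfloor>x\<rfloor> - 2..\<lfloor>x\<rfloor>}" by (intro card_mono) auto
      then have c3: "real (card {m\<in>A'. x \<in> ?J m}) \<le> 3" by simp
      have "(\<Sum>m\<in>A'. indicat_real (?J m) x) = real (card {m\<in>A'. x \<in> ?J m})"
        using A'(2) by (simp add: indicator_def sum.If_cases Int_def of_bool_def)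
      then have "(\<Sum>m\<in>A'. indicat_real (?J m) x) * ?\<rho> x \<le> 3 * ?\<rho> x"
        using c3 pw_density_nonneg[of K F x] by (intro mult_right_mono) auto
      then show "(\<Sum>m\<in>A'. indicat_real (?J m) x * ?\<rho> x) \<le> 3 * ?\<rho> x"
        by (simp add: sum_distrib_right)
    qed
    also have "\<dots> = 3 * real K" using int by simp
    finally have "real (card A') \<le> 6 * real K / (\<delta> * c)" using \<delta>(1) c by (simp add: field_simps)
    then show ?thesis unfolding N_def by linarith
  qed
  have "finite ?A \<and> card ?A \<le> N"
    by (rule finite_if_finite_subsets_card_bdd) (use card in blast)
  then show "finite ?A" "card ?A \<le> N" by auto
qed

text \<open>\<open>N\<close> must not depend on the system. A value of at least \<open>v0\<close>
  forces a fixed height of the density, so \<open>pw_density_superlevel\<close> supplies a uniform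
  \<open>c\<close>; the bathtub level cannot be below \<open>c\<close>, as the optimal set would
  then contain a set of measure above \<open>s\<close>.\<close>

lemma value_concentrates_on_cells:
  assumes K: "K \<ge> 1" and s: "s > 0" and v0: "v0 > 0"
  shows "\<exists>N. \<forall>\<Omega> f. \<Omega> \<in> sets lebesgue \<and> emeasure lebesgue \<Omega> = ennreal s \<and> PW_orthonormal K f \<and> v0 \<le> pw_value K \<Omega> f \<longrightarrow>
    (\<exists>\<Omega>' A. \<Omega>' \<in> sets lebesgue \<and> emeasure lebesgue \<Omega>' = ennreal s \<and> finite A \<and> card A \<le> N \<and>
      (\<forall>x\<in>\<Omega>'. \<lfloor>x\<rfloor> \<in> A) \<and> pw_value K \<Omega> f \<le> pw_value K \<Omega>' f)"
proof -
  \<comment> \<open>A density at most \<open>a\<close> everywhere would give a value of at most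
    \<open>s * a = v0 / 2\<close>.\<close>
  define a where "a = v0 / (2 * s)"
  have a: "a > 0" using v0 s by (simp add: a_def)
  obtain c where c: "c > 0" and level: "\<And>F x0. (\<forall>k\<in>{1..K}. pw_entire (F k)) \<Longrightarrow> a \<le> pw_density K F x0 \<Longrightarrow>
    ennreal s < emeasure lebesgue {x. c < pw_density K F x}"
    using pw_density_superlevel[OF a s, of K] by blast
  define \<delta> where "\<delta> = min 1 (c / (4 * pi * real K))"
  define N where "N = nat \<lceil>6 * real K / (\<delta> * c)\<rceil>"
  have "\<exists>\<Omega>' A. \<Omega>' \<in> sets lebesgue \<and> emeasure lebesgue \<Omega>' = ennreal s \<and> finite A \<and> card A \<le> N \<and>
      (\<forall>x\<in>\<Omega>'. \<lfloor>x\<rfloor> \<in> A) \<and> pw_value K \<Omega> f \<le> pw_value K \<Omega>' f"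
    if \<Omega>: "\<Omega> \<in> sets lebesgue" "emeasure lebesgue \<Omega> = ennreal s" and f: "PW_orthonormal K f" and v: "v0 \<le> pw_value K \<Omega> f" for \<Omega> f
  proof -
    obtain F where F: "\<And>k. k \<in> {1..K} \<Longrightarrow> pw_entire (F k)" "\<And>k. k \<in> {1..K} \<Longrightarrow> AE x in lebesgue. f k x = F k (complex_of_real x)"
      using PW_orthonormal_entire[OF f] by blast
    have Fh: "F k holomorphic_on UNIV" if "k \<in> {1..K}" for k using F(1)[OF that] by (simp add: pw_entire_def)
    let ?\<rho> = "pw_density K F"
    note dens = pw_value_density[OF f _ Fh F(2)]
    have int: "integrable lebesgue ?\<rho>" "(LINT x|lebesgue. ?\<rho> x) = real K" using dens(1,3)[OF \<Omega>(1)] by auto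
    have "\<exists>x0. a \<le> ?\<rho> x0"
    proof (rule ccontr)
      assume "\<not> ?thesis"
      then have lt: "?\<rho> x \<le> a" for x by (meson linear)
      have "pw_value K \<Omega> f = (LINT x|lebesgue. indicat_real \<Omega> x * ?\<rho> x)" by (rule dens(2)[OF \<Omega>(1)])
      also have "\<dots> \<le> (LINT x|lebesgue. indicat_real \<Omega> x * a)"
      proof (intro integral_mono)
        show "integrable lebesgue (\<lambda>x. indicat_real \<Omega> x * ?\<rho> x)" using integrable_mult_indicator[OF \<Omega>(1) int(1)] by simp
        show "integrable lebesgue (\<lambda>x. indicat_real \<Omega> x * a)"
          using \<Omega> by (intro integrable_mult_left integrable_real_indicator) auto
      qed (use lt in \<open>auto intro: mult_left_mono\<close>)
      also have "\<dots> = s * a" using \<Omega> s by (simp add: measure_def)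
      also have "\<dots> = v0 / 2" using s by (simp add: a_def)
      finally show False using v v0 by simp
    qed
    then obtain x0 where x0: "a \<le> ?\<rho> x0" ..
    obtain t \<Omega>' where t: "t \<ge> 0" and \<Omega>': "\<Omega>' \<in> sets lebesgue" "{x. ?\<rho> x > t} \<subseteq> \<Omega>'" "\<Omega>' \<subseteq> {x. ?\<rho> x \<ge> t}" "emeasure lebesgue \<Omega>' = ennreal s"
      using bathtub_level[OF int(1) pw_density_nonneg s] by blast
    have tc: "c \<le> t"
    proof (rule ccontr)
      assume "\<not> c \<le> t"
      then have "emeasure lebesgue {x. c < ?\<rho> x} \<le> emeasure lebesgue \<Omega>'"
        using \<Omega>'(1,2) by (intro emeasure_mono) auto
      then show False using level[of F x0] F(1) x0 \<Omega>'(4) by (simp add: not_less[symmetric])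
    qed
    let ?A = "{\<lfloor>x\<rfloor> | x. c \<le> ?\<rho> x}"
    have A: "finite ?A" "card ?A \<le> N"
      using card_superlevel_cells[OF K c F(1) int] unfolding N_def \<delta>_def by auto
    have set_int: "(LINT x:B|lebesgue. ?\<rho> x) = (LINT x|lebesgue. indicat_real B x * ?\<rho> x)" for B
      by (simp add: set_lebesgue_integral_def)
    have "pw_value K \<Omega> f \<le> pw_value K \<Omega>' f"
      using bathtub_optimal[OF int(1) t less_imp_le[OF s] \<Omega>' \<Omega>(1) eq_refl[OF \<Omega>(2)]]
        dens(2)[OF \<Omega>(1)] dens(2)[OF \<Omega>'(1)] unfolding set_int by linarith
    moreover have "\<forall>x\<in>\<Omega>'. \<lfloor>x\<rfloor> \<in> ?A" using \<Omega>'(3) tc by fastforce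
    ultimately show ?thesis using A \<Omega>' by blast
  qed
  then show ?thesis by blast
qed

theorem theorem5p6:
  fixes K :: nat and s :: real
  assumes "K \<ge> 1" and "s > 0"
  shows "bdd_above (concentration_values K s) \<and>
         Sup (concentration_values K s) \<in> concentration_values K s"
proof -
  note K = assms(1) and s = assms(2)
  let ?V = "concentration_values K s"
  have bdd: "bdd_above ?V"
  proof (rule bdd_aboveI[of _ "real K"])
    fix y assume "y \<in> ?V"
    then show "y \<le> real K" unfolding concentration_values_def using pw_value_le by blast
  qed
  have nonneg: "y \<ge> 0" if "y \<in> ?V" for y
    using that unfolding concentration_values_def set_lebesgue_integral_def
    by (auto intro!: sum_nonneg integral_nonneg_AE)
  have "pw_value K {0..s} sincs \<in> ?V"
    unfolding concentration_values_def using sincs_orthonormal s by fastforce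
  then have ne: "?V \<noteq> {}" by blast
  have "Sup ?V \<in> ?V"
  \<comment> \<open>All values are nonnegative, so a supremum of at most 0 equals every one of
    them.\<close>
  proof (cases "Sup ?V \<le> 0")
    case True
    obtain y where y: "y \<in> ?V" using ne by blast
    have "y = Sup ?V" using cSup_upper[OF y bdd] nonneg[OF y] True by simp
    then show ?thesis using y by simp
  next
    case False
    \<comment> \<open>Any number strictly between 0 and the supremum serves as the
      threshold.\<close>
    define v0 where "v0 = Sup ?V / 2"
    have v0: "v0 > 0" "v0 < Sup ?V" using False by (auto simp: v0_def)
    obtain N where N: "\<And>\<Omega> f. \<Omega> \<in> sets lebesgue \<Longrightarrow> emeasure lebesgue \<Omega> = ennreal s \<Longrightarrow> PW_orthonormal K f \<Longrightarrow> v0 \<le> pw_value K \<Omega> f \<Longrightarrow>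
      (\<exists>\<Omega>' A. \<Omega>' \<in> sets lebesgue \<and> emeasure lebesgue \<Omega>' = ennreal s \<and> finite A \<and> card A \<le> N \<and>
      (\<forall>x\<in>\<Omega>'. \<lfloor>x\<rfloor> \<in> A) \<and> pw_value K \<Omega> f \<le> pw_value K \<Omega>' f)"
      using value_concentrates_on_cells[OF K s v0(1)] by blast
    obtain m where m: "\<And>d. dual_sup K s (cells N d) \<le> dual_sup K s (cells N m)"
      using dual_sup_cells_max[of s K N] s by auto
    obtain v where v: "v \<in> ?V" and window: "\<And>\<Omega> f. \<Omega> \<in> sets lebesgue \<Longrightarrow> \<Omega> \<subseteq> {- real (gap_pos m N)..real (gap_pos m N)} \<Longrightarrow>
        emeasure lebesgue \<Omega> \<le> ennreal s \<Longrightarrow> PW_orthonormal K f \<Longrightarrow> pw_value K \<Omega> f \<le> v"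
      using window_attained[OF s, where K=K and R="real (gap_pos m N)"] by blast
    \<comment> \<open>A dual system on the cells of \<open>m\<close> yields an orthonormal system
      with at least the same value on the same set, which lies in the window.\<close>
    have mv: "dual_sup K s (cells N m) \<le> v"
    proof (rule dual_sup_least)
      fix \<phi> assume "dual_feasible K s (cells N m) \<phi>"
      then obtain \<Omega> where \<Omega>: "\<Omega> \<in> sets lebesgue" "\<Omega> \<subseteq> cells N m" "emeasure lebesgue \<Omega> \<le> ennreal s" "dual_system K \<Omega> \<phi>"
        by (auto simp: dual_feasible_def)
      have \<Omega>b: "\<Omega> \<subseteq> {- real (gap_pos m N)..real (gap_pos m N)}" using \<Omega>(2) cells_bounded by blast
      obtain f where "PW_orthonormal K f" "dual_value K \<phi> \<le> pw_value K \<Omega> f"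
        using dual_to_primal[OF \<Omega>(1) \<Omega>b \<Omega>(4)] by blast
      then show "dual_value K \<phi> \<le> v" using window[OF \<Omega>(1) \<Omega>b \<Omega>(3)] by fastforce
    qed
    \<comment> \<open>The chain: concentrate on at most \<open>N\<close> cells, pass to the dual,
      translate so that the first cell starts at 0, and compare with the best gap sequence
      \<open>m\<close>.\<close>
    have large: "w \<le> v" if w: "w \<in> ?V" "v0 \<le> w" for w
    proof -
      obtain \<Omega>0 f where "\<Omega>0 \<in> sets lebesgue" "emeasure lebesgue \<Omega>0 = ennreal s" and f: "PW_orthonormal K f"
        and w0: "w = pw_value K \<Omega>0 f"
        using w(1) unfolding concentration_values_def by blast
      then obtain \<Omega> A where \<Omega>: "\<Omega> \<in> sets lebesgue" "emeasure lebesgue \<Omega> = ennreal s" and A: "finite A" "card A \<le> N" "\<forall>x\<in>\<Omega>. \<lfloor>x\<rfloor> \<in> A"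
        and w\<Omega>: "w \<le> pw_value K \<Omega> f"
        using N[of \<Omega>0 f] w(2) by blast
      obtain p d where pd: "A \<subseteq> (\<lambda>i. p + int (gap_pos d i)) ` {..<N}"
        using finite_int_set_gaps[OF A(1,2)] by blast
      define t where "t = real_of_int p"
      have \<Omega>c: "x - t \<in> cells N d" if x: "x \<in> \<Omega>" for x
      proof -
        obtain i where "i < N" "\<lfloor>x\<rfloor> = p + int (gap_pos d i)" using A(3) pd x by blast
        then have "x - t \<in> {real (gap_pos d i)..<real (gap_pos d i) + 1}" unfolding t_def by (auto; linarith)
        then show ?thesis using \<open>i < N\<close> unfolding cells_def by blast
      qed
      define R where "R = real (gap_pos d N) + \<bar>t\<bar>"
      have \<Omega>R: "\<Omega> \<subseteq> {-R..R}"
      proof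
        fix x assume "x \<in> \<Omega>"
        then have "x - t \<in> {- real (gap_pos d N)..real (gap_pos d N)}" using \<Omega>c cells_bounded by blast
        then show "x \<in> {-R..R}" by (auto simp: R_def)
      qed
      have fL: "f k \<in> L2" if "k \<in> {1..K}" for k using f that PW_subset_L2 by (auto simp: pw_orthonormal_iff)
      obtain \<phi> where \<phi>: "dual_system K \<Omega> \<phi>" "pw_value K \<Omega> f \<le> dual_value K \<phi>"
      proof -
        have "(\<Sum>k=1..K. (cmod (L2_inner (f k) \<psi>))\<^sup>2) \<le> Re (conc \<psi> \<psi>)"
          if "\<psi> \<in> L2" "\<And>x. x \<notin> \<Omega> \<Longrightarrow> \<psi> x = 0" for \<psi>
        proof (rule PW_bessel[OF f])
          show "\<psi> \<in> cL2" using that \<Omega>R unfolding cL2_def by blast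
        qed
        then show ?thesis using primal_to_dual[OF \<Omega>(1) \<Omega>R, of K f] L2_restrict[OF fL \<Omega>(1)] that by blast
      qed
      \<comment> \<open>With \<open>X\<close> empty there is no fixed part and no cross term, so the
        translation is free of loss.\<close>
      obtain \<phi>' where \<phi>': "dual_system K {x. x + t \<in> \<Omega>} \<phi>'" "dual_value K \<phi> \<le> dual_value K \<phi>'"
        using dual_rearrange[OF \<phi>(1) \<Omega>(1) \<Omega>R eq_refl[OF \<Omega>(2)] less_imp_le[OF s], of "{}" t 0] by auto
      have "{x. x + t \<in> \<Omega>} \<subseteq> cells N d" using \<Omega>c by fastforce
      then have "dual_feasible K s (cells N d) \<phi>'"
        unfolding dual_feasible_def using \<phi>'(1) lebesgue_shift_sets[OF \<Omega>(1)] emeasure_lebesgue_shift[OF \<Omega>(1), of t] \<Omega>(2)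
        by (intro bexI[of _ "{x. x + t \<in> \<Omega>}"]) auto
      then have "dual_value K \<phi>' \<le> dual_sup K s (cells N d)" by (rule dual_sup_upper[OF cells_bounded])
      also have "\<dots> \<le> v" using m[of d] mv by linarith
      finally show ?thesis using w\<Omega> \<phi>(2) \<phi>'(2) by linarith
    qed
    \<comment> \<open>Values below the threshold are dominated by some value above it.\<close>
    have "w \<le> v" if w: "w \<in> ?V" for w
    proof (cases "v0 \<le> w")
      case True
      then show ?thesis by (rule large[OF w])
    next
      case False
      obtain w' where "w' \<in> ?V" "v0 < w'" using less_cSup_iff[OF ne bdd] v0(2) by blast
      then show ?thesis using large[of w'] False by simp
    qed
    then have "Sup ?V = v" using v by (intro cSup_eq_maximum)
    then show ?thesis using v by simp
  qed
  with bdd show ?thesis by blast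
qed

end
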